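(* Let $d\ge 1$, $n\in\mathbb{N}$ with $n\ge 1$, $\alpha\in(0,1]$, $p\in[1,\infty]$, and $I=[0,1]$. Then the Besov space $\mathcal{B}^{n,\alpha,p}(\mathbb{R}^d,\mathbb{R}^d)$ is ODE-closed, i.e. for every pointwise time-dependent $\mathcal{B}^{n,\alpha,p}$-vector field $u\in\mathfrak{X}_{n,\alpha,p}$ and every $t\in I$ one has $\phi_u(t,\cdot)=\Phi_u(t,\cdot)-\mathrm{Id}\in\mathcal{B}^{n,\alpha,p}(\mathbb{R}^d,\mathbb{R}^d)$, where $\Phi_u$ is the flow of $u$. Moreover, for each fixed $u\in\mathfrak{X}_{n,\alpha,p}$, the mapping $t\mapsto\phi_u(t,\cdot)$ belongs to $C(I,\mathcal{B}^{n,\alpha,p}(\mathbb{R}^d,\mathbb{R}^d))$, i.e. it is continuous from $I$ into the normed space $\mathcal{B}^{n,\alpha,p}(\mathbb{R}^d,\mathbb{R}^d)$.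
   Context: Besov spaces. Let $E,F$ be Banach spaces. $L_k(E;F)$ denotes the bounded $k$-linear maps $E^k\to F$ with the operator norm. $C^n(E,F)$ is the space of $n$-times continuously Fréchet differentiable maps, $f^{(k)}:E\to L_k(E;F)$ is the $k$-th derivative, and $\|f\|_{C^n_b}=\sup_{0\le k\le n}\|f^{(k)}\|_\infty$. For a function $f$ on $E$ with values in a Banach space put $\Delta^2_hf(x)=f(x+2h)-2f(x+h)+f(x)$ and $\eta(f;t)=\sup_{x\in E,\ \|h\|\le t}\|\Delta_h^2f(x)\|$. For $\alpha\in(0,1]$ let $$Z^{\alpha,p}(f)=\Big(\int_0^\infty\Big(\frac{\eta(f;t)}{t^\alpha}\Big)^p\frac{dt}{t}\Big)^{1/p}\ (1\le p<\infty),\qquad Z^{\alpha,\infty}(f)=\sup_{t>0}\frac{\eta(f;t)}{t^\alpha}.$$ For $n\in\mathbb{N}=\{0,1,2,\dots\}$, $$\mathcal{B}^{n,\alpha,p}(E,F)=\{f\in C^n(E,F):\ \|f\|^{\mathcal Z}_{n,\alpha,p}:=\sup\{\|f\|_{C^n_b},\,Z^{\alpha,p}(f^{(n)})\}<\infty\},$$ normed by $\|\cdot\|^{\mathcal Z}_{n,\alpha,p}$. Vector fields. $\mathfrak{X}_{n,\alpha,p}$ is the set of all $u:I\times\mathbb{R}^d\to\mathbb{R}^d$ such that: $u(t,\cdot)\in\mathcal{B}^{n,\alpha,p}(\mathbb{R}^d,\mathbb{R}^d)$ for every $t\in I$; $u(\cdot,x)$ is measurable for every $x\in\mathbb{R}^d$;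 and $t\mapsto\|u(t,\cdot)\|^{\mathcal Z}_{n,\alpha,p}$ is Lebesgue integrable on $I$. Flow. The flow of $u$ is the unique map $\Phi_u:I\times\mathbb{R}^d\to\mathbb{R}^d$, with $t\mapsto\Phi_u(t,x)$ absolutely continuous for each $x$, such that $$\Phi_u(t,x)=x+\int_0^tu(s,\Phi_u(s,x))\,ds\qquad\text{for all }t\in I,\ x\in\mathbb{R}^d,$$ and $\phi_u(t,x):=\Phi_u(t,x)-x$. (Existence and uniqueness hold by the standard Carathéodory theory, since $n\ge1$.) *)

theory Defs
  imports "HOL-Analysis.Analysis"
begin

text \<open>Bounded \<open>k\<close>-linear maps \<open>E\<^sup>k \<rightarrow> F\<close> for variable \<open>k\<close> are encoded as functions on lists
  of vectors; only lists of length \<open>k\<close> matter, and the function is \<open>0\<close> on all other lists so that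
  every \<open>k\<close>-linear map has exactly one representative.  All norms and seminorms take values in
  \<^typ>\<open>ennreal\<close>, so that suprema and integrals are meaningful without side conditions.\<close>

definition multi_norm :: "nat \<Rightarrow> ('a::real_normed_vector list \<Rightarrow> 'b::real_normed_vector) \<Rightarrow> ennreal"
  where "multi_norm k T =
    (SUP vs \<in> {vs. length vs = k \<and> (\<forall>v\<in>set vs. norm v \<le> 1)}. ennreal (norm (T vs)))"

definition bounded_multilinear :: "nat \<Rightarrow> ('a::real_normed_vector list \<Rightarrow> 'b::real_normed_vector) set"
  where "bounded_multilinear k = {T.
    (\<forall>us ws. Suc (length us + length ws) = k \<longrightarrow> linear (\<lambda>v. T (us @ v # ws))) \<and>
    (\<forall>vs. length vs \<noteq> k \<longrightarrow> T vs = 0) \<and>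
    multi_norm k T < \<infinity>}"

text \<open>Frechet differentiability at \<open>x\<close>, with respect to the operator norm, of a map \<open>G\<close> from \<open>E\<close> to
  the space of bounded \<open>k\<close>-linear maps.  The derivative, a bounded linear map into the \<open>k\<close>-linear
  maps, is identified with the \<open>k+1\<close>-linear map \<open>D\<close> whose first argument is the direction of
  differentiation.\<close>

definition has_multi_derivative ::
  "nat \<Rightarrow> ('a::banach \<Rightarrow> 'a list \<Rightarrow> 'b::banach) \<Rightarrow> ('a list \<Rightarrow> 'b) \<Rightarrow> 'a \<Rightarrow> bool"
  where "has_multi_derivative k G D x \<longleftrightarrow>
    D \<in> bounded_multilinear (Suc k) \<and>
    ((\<lambda>h. multi_norm k (\<lambda>vs. G (x + h) vs - G x vs - D (h # vs)) / ennreal (norm h))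
      \<longlongrightarrow> 0) (at 0)"

text \<open>The derivative is unique, so the definite description in \<open>kth_deriv\<close> below denotes it
  whenever it exists.\<close>

lemma multi_norm_upper:
  assumes "length vs = k" "\<forall>v\<in>set vs. norm v \<le> 1"
  shows "ennreal (norm (T vs)) \<le> multi_norm k T"
  unfolding multi_norm_def by (rule SUP_upper) (use assms in auto)

lemma multilinear_eq_0_if_ball:
  assumes "T \<in> bounded_multilinear k" "length us + length ws = k" "\<And>vs. length vs = k \<Longrightarrow> \<forall>v\<in>set vs. norm v \<le> 1 \<Longrightarrow> T vs = 0"
   "\<forall>v\<in>set us. norm v \<le> 1"
  shows "T (us @ ws) = 0"
  using assms(2,4)
proof (induction ws arbitrary: us)
  case Nil then show ?case using assms(3) by auto
next
  case (Cons a ws)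
  have lin: "linear (\<lambda>v. T (us @ v # ws))" using assms(1) Cons.prems unfolding bounded_multilinear_def by auto
  define b where "b = (1/(1+norm a)) *\<^sub>R a"
  have nb: "norm b \<le> 1" by (simp add: b_def divide_le_eq add_pos_nonneg)
  have 1: "T ((us @ [b]) @ ws) = 0" by (rule Cons.IH) (use Cons.prems nb in auto)
  have "1+norm a > 0" by (simp add: add_pos_nonneg)
  then have "a = (1+norm a) *\<^sub>R b" by (simp add: b_def)
  then have "T (us @ a # ws) = (1+norm a) *\<^sub>R T (us @ b # ws)" using linear_scale[OF lin, of "1+norm a" b] by simp
  then show ?case using 1 by simp
qed

lemma has_multi_derivative_unique:
  assumes "has_multi_derivative k G D x" "has_multi_derivative k G D' x"
  shows "D = (D'::'a::banach list \<Rightarrow> 'b::banach)"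
proof -
  have L: "D \<in> bounded_multilinear (Suc k)" "D' \<in> bounded_multilinear (Suc k)"
    using assms unfolding has_multi_derivative_def by auto
  define E where "E vs = D vs - D' vs" for vs
  have lin: "linear (\<lambda>v. E (us @ v # ws))" if "length us + length ws = k" for us ws
    using L that unfolding bounded_multilinear_def E_def by (auto intro!: linear_compose_sub)
  have key: "E (v # vs) = 0" if lv: "length vs = k" "\<forall>v\<in>set vs. norm v \<le> 1" for v vs
  proof (cases "v = 0")
    case True then show ?thesis using linear_0[OF lin[of "[]" vs]] lv by simp
  next
    case False
    let ?R = "\<lambda>D h. multi_norm k (\<lambda>vs. G (x + h) vs - G x vs - D (h # vs)) / ennreal (norm h)"
    have "((\<lambda>h. ?R D h + ?R D' h) \<longlongrightarrow> 0 + 0) (at 0)"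
      using assms unfolding has_multi_derivative_def by (intro tendsto_add) auto
    moreover have "filterlim (\<lambda>s::real. s *\<^sub>R v) (at 0) (at_right 0)"
      unfolding filterlim_at using False by (auto intro!: tendsto_eq_intros eventually_at_right_less
         simp: eventually_at_filter)
    ultimately have lim: "((\<lambda>s. ?R D (s *\<^sub>R v) + ?R D' (s *\<^sub>R v)) \<longlongrightarrow> 0) (at_right (0::real))"
      using filterlim_compose[of "\<lambda>h. ?R D h + ?R D' h" "nhds 0" "at 0" "\<lambda>s. s *\<^sub>R v"] by (simp only: add_0)
    have "ennreal (norm (E (v#vs)) / norm v) \<le> ?R D (s *\<^sub>R v) + ?R D' (s *\<^sub>R v)" if s: "s > 0" for s
    proof -
      let ?a = "\<lambda>D. norm (G (x + s *\<^sub>R v) vs - G x vs - D ((s *\<^sub>R v) # vs))"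
      have e: "E ((s *\<^sub>R v) # vs) = s *\<^sub>R E (v#vs)" using linear_scale[OF lin[of "[]" vs]] lv by simp
      have "s * norm (E (v#vs)) = norm (E ((s *\<^sub>R v) # vs))" using e s by simp
      also have "\<dots> \<le> ?a D + ?a D'" unfolding E_def by norm
      finally have le: "s * norm (E (v#vs)) \<le> ?a D + ?a D'" .
      have "norm (E (v#vs)) / norm v = s * norm (E (v#vs)) / norm (s *\<^sub>R v)" using s by simp
      also have "\<dots> \<le> (?a D + ?a D') / norm (s *\<^sub>R v)" by (rule divide_right_mono[OF le]) simp
      finally have "norm (E (v#vs)) / norm v \<le> ?a D / norm (s *\<^sub>R v) + ?a D' / norm (s *\<^sub>R v)" by (simp add: add_divide_distrib)
      then have "ennreal (norm (E (v#vs)) / norm v) \<le> ennreal (?a D) / norm (s *\<^sub>R v) + ennreal (?a D') / norm (s *\<^sub>R v)"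
        using s False by (simp add: divide_ennreal flip: ennreal_plus)
      also have "\<dots> \<le> ?R D (s *\<^sub>R v) + ?R D' (s *\<^sub>R v)"
        by (intro add_mono divide_right_mono_ennreal multi_norm_upper lv) 
      finally show ?thesis .
    qed
    then have "ennreal (norm (E (v#vs)) / norm v) \<le> 0"
      by (intro tendsto_lowerbound[OF lim]) (auto simp: eventually_at_filter)
    then show ?thesis using False by (simp add: ennreal_eq_0_iff zero_less_iff_neq_zero divide_le_0_iff)
  qed
  have "multi_norm (Suc k) E \<le> 0" unfolding multi_norm_def
  proof (rule SUP_least)
    fix i :: "'a list" assume "i \<in> {vs. length vs = Suc k \<and> (\<forall>v\<in>set vs. norm v \<le> 1)}"
    then show "ennreal (norm (E i)) \<le> 0" using key by (cases i) auto
  qed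
  then have EL: "E \<in> bounded_multilinear (Suc k)"
    using L lin unfolding bounded_multilinear_def by (auto simp: E_def)
  have "E vs = 0" for vs
  proof (cases "length vs = Suc k")
    case True
    have "E ws = 0" if "length ws = Suc k" "\<forall>v\<in>set ws. norm v \<le> 1" for ws
      using that key by (cases ws) auto
    then show ?thesis using multilinear_eq_0_if_ball[OF EL, of "[]" vs] True by simp
  qed (use EL in \<open>auto simp: bounded_multilinear_def\<close>)
  then show ?thesis unfolding E_def by (simp add: fun_eq_iff)
qed

primrec kth_deriv :: "('a::banach \<Rightarrow> 'b::banach) \<Rightarrow> nat \<Rightarrow> 'a \<Rightarrow> 'a list \<Rightarrow> 'b" where
  "kth_deriv f 0 = (\<lambda>x vs. if vs = [] then f x else 0)"
| "kth_deriv f (Suc k) = (\<lambda>x. THE D. has_multi_derivative k (kth_deriv f k) D x)"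

definition Cn :: "nat \<Rightarrow> ('a::banach \<Rightarrow> 'b::banach) set" where
  "Cn n = {f.
    (\<forall>k<n. \<forall>x. \<exists>D. has_multi_derivative k (kth_deriv f k) D x) \<and>
    (\<forall>x. ((\<lambda>y. multi_norm n (\<lambda>vs. kth_deriv f n y vs - kth_deriv f n x vs)) \<longlongrightarrow> 0) (at x))}"

definition Cb_norm :: "nat \<Rightarrow> ('a::banach \<Rightarrow> 'b::banach) \<Rightarrow> ennreal" where
  "Cb_norm n f = (SUP k\<in>{..n}. SUP x. multi_norm k (kth_deriv f k x))"

definition second_diff ::
  "('a::real_vector \<Rightarrow> 'a list \<Rightarrow> 'b::real_vector) \<Rightarrow> 'a \<Rightarrow> 'a \<Rightarrow> 'a list \<Rightarrow> 'b" where
  "second_diff G h x = (\<lambda>vs. G (x + 2 *\<^sub>R h) vs - 2 *\<^sub>R G (x + h) vs + G x vs)"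

definition smoothness_modulus ::
  "nat \<Rightarrow> ('a::banach \<Rightarrow> 'a list \<Rightarrow> 'b::banach) \<Rightarrow> real \<Rightarrow> ennreal" where
  "smoothness_modulus k G t = (SUP x. SUP h\<in>{h. norm h \<le> t}. multi_norm k (second_diff G h x))"

text \<open>Powers with a positive real exponent.\<close>

definition ennreal_powr :: "ennreal \<Rightarrow> real \<Rightarrow> ennreal" where
  "ennreal_powr y a = (if y = \<infinity> then \<infinity> else ennreal (enn2real y powr a))"

definition zygmund ::
  "nat \<Rightarrow> real \<Rightarrow> ennreal \<Rightarrow> ('a::banach \<Rightarrow> 'a list \<Rightarrow> 'b::banach) \<Rightarrow> ennreal" where
  "zygmund k \<alpha> p G =
    (if p = \<infinity> then SUP t\<in>{0<..}. smoothness_modulus k G t / ennreal (t powr \<alpha>)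
     else ennreal_powr
       (\<integral>\<^sup>+t\<in>{0<..}. (ennreal_powr (smoothness_modulus k G t / ennreal (t powr \<alpha>)) (enn2real p)
                        / ennreal t) \<partial>lborel)
       (1 / enn2real p))"

definition besov_norm :: "nat \<Rightarrow> real \<Rightarrow> ennreal \<Rightarrow> ('a::banach \<Rightarrow> 'b::banach) \<Rightarrow> ennreal" where
  "besov_norm n \<alpha> p f = max (Cb_norm n f) (zygmund n \<alpha> p (kth_deriv f n))"

definition besov :: "nat \<Rightarrow> real \<Rightarrow> ennreal \<Rightarrow> ('a::banach \<Rightarrow> 'b::banach) set" where
  "besov n \<alpha> p = {f \<in> Cn n. besov_norm n \<alpha> p f < \<infinity>}"

text \<open>The time interval is \<open>I = [0,1]\<close>; a map on \<open>I \<times> \<real>\<^sup>d\<close> is a curried function whose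
  values at times outside \<open>I\<close> are irrelevant.\<close>

definition vector_fields ::
  "nat \<Rightarrow> real \<Rightarrow> ennreal \<Rightarrow> (real \<Rightarrow> 'a::euclidean_space \<Rightarrow> 'a) set" where
  "vector_fields n \<alpha> p = {u.
    (\<forall>t\<in>{0..1}. u t \<in> besov n \<alpha> p) \<and>
    (\<forall>x. (\<lambda>t. u t x) \<in> borel_measurable (lebesgue_on {0..1})) \<and>
    integrable (lebesgue_on {0..1}) (\<lambda>t. enn2real (besov_norm n \<alpha> p (u t)))}"

text \<open>Absolute continuity of a function on a set of reals, over finite families of nonoverlapping
  compact intervals.\<close>

definition abs_continuous_on :: "real set \<Rightarrow> (real \<Rightarrow> 'a::real_normed_vector) \<Rightarrow> bool" where
  "abs_continuous_on S f \<longleftrightarrow>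
    (\<forall>\<epsilon>>0. \<exists>\<delta>>0. \<forall>\<D>. \<D> division_of \<Union>\<D> \<and> \<Union>\<D> \<subseteq> S \<and> (\<Sum>K\<in>\<D>. Sup K - Inf K) < \<delta>
      \<longrightarrow> (\<Sum>K\<in>\<D>. norm (f (Sup K) - f (Inf K))) < \<epsilon>)"

text \<open>The condition \<^term>\<open>\<Phi> \<in> extensional {0..1}\<close> fixes the irrelevant values outside \<open>I\<close>, so
  that the flow is unique as a total function.\<close>

definition is_flow ::
  "(real \<Rightarrow> 'a::euclidean_space \<Rightarrow> 'a) \<Rightarrow> (real \<Rightarrow> 'a \<Rightarrow> 'a) \<Rightarrow> bool" where
  "is_flow u \<Phi> \<longleftrightarrow> \<Phi> \<in> extensional {0..1} \<and>
    (\<forall>x. abs_continuous_on {0..1} (\<lambda>t. \<Phi> t x) \<and>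
         integrable (lebesgue_on {0..1}) (\<lambda>s. u s (\<Phi> s x)) \<and>
         (\<forall>t\<in>{0..1}. \<Phi> t x = x + (\<integral>s. u s (\<Phi> s x) \<partial>(lebesgue_on {0..t}))))"

definition flow :: "(real \<Rightarrow> 'a::euclidean_space \<Rightarrow> 'a) \<Rightarrow> real \<Rightarrow> 'a \<Rightarrow> 'a" where
  "flow u = (THE \<Phi>. is_flow u \<Phi>)"

definition flow_disp :: "(real \<Rightarrow> 'a::euclidean_space \<Rightarrow> 'a) \<Rightarrow> real \<Rightarrow> 'a \<Rightarrow> 'a" where
  "flow_disp u t x = flow u t x - x"

end

theory Submission
  imports Defs
begin

text \<open>Let \<open>\<gamma> < \<alpha>\<close> with \<open>\<gamma> + \<gamma>\<^sup>2 > \<alpha>\<close>.  A function \<open>f\<close> of class \<open>\<B>\<^sup>n\<^sup>,\<^sup>\<alpha>\<^sup>,\<^sup>p\<close> is of class \<open>C\<^sup>n\<^sup>,\<^sup>\<gamma>\<close>, and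
  the norm of \<open>\<B>\<^sup>n\<^sup>,\<^sup>\<alpha>\<^sup>,\<^sup>p\<close> is submultiplicative up to a constant, satisfies Minkowski's inequality
  for integrals over a parameter, and has closed balls with respect to pointwise convergence.
  Composition with a map \<open>\<Phi>\<close> is bounded on \<open>\<B>\<^sup>0\<^sup>,\<^sup>\<alpha>\<^sup>,\<^sup>p\<close> as soon as \<open>\<Phi>\<close> is of class \<open>C\<^sup>1\<^sup>,\<^sup>\<gamma>\<close>, because
  \<open>\<Delta>\<^sup>2(f \<circ> \<Phi>)\<close> differs from a second difference of \<open>f\<close> by a term of order \<open>\<gamma> + \<gamma>\<^sup>2\<close>; the bound at
  level \<open>n + 1\<close> follows from the chain rule and the bound at level \<open>n\<close>, and it is affine in the
  top-order norm of \<open>\<Phi> - id\<close>.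

  The Picard iterates of the flow equation are therefore bounded in \<open>\<B>\<^sup>n\<^sup>,\<^sup>\<alpha>\<^sup>,\<^sup>p\<close>, uniformly in the
  number of iterations: by induction on the level, where the affine dependence on the top-order norm
  gives a linear integral inequality.  The same argument for Hoelder spaces, where
  composition needs only a Lipschitz bound, first provides the uniform \<open>C\<^sup>1\<^sup>,\<^sup>\<gamma>\<close> bound.  Passing
  to the limit, \<open>u(s, \<Phi>(s, \<cdot>))\<close> has norm at most \<open>C\<close> times that of \<open>u(s, \<cdot>)\<close>, so that
  \<open>\<phi>(t) - \<phi>(r) = \<integral>\<^sub>r\<^sup>t u(s, \<Phi>(s, \<cdot>)) ds\<close> has norm at most \<open>C\<close> times the integral of the norm of
  \<open>u(s, \<cdot>)\<close> over \<open>[r, t]\<close>.\<close>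

section \<open>Scalar functions with bounded Besov norm\<close>

text \<open>Fields are measurable in time only for each fixed x. Nothing makes \<open>u s\<close>
  Bochner measurable into the Besov space or a supremum such as \<open>smoothness_modulus\<close>
  measurable in s. Hence all estimates concern inequalities between finitely many values of a
  function; the norms of the statement occur only on entry and on exit. The numerical condition on
  \<gamma> has this origin. For \<alpha> = 1 a function of Zygmund class need not be Lipschitz, so a
  smaller Hoelder exponent \<gamma> is used, and it enters twice: in the modulus of f and in the
  Taylor remainder |h|^(1 + \<gamma>) of \<Phi>. The resulting error |h|^(\<gamma> (1 + \<gamma>)),
  sampled at |h| = 2^(-j), must have a finite sum against weights of size 2^(j \<alpha>). Picard
  iterates replace the flow because an a priori estimate for the flow would presuppose the
  regularity to be proved, while the zeroth displacement vanishes and each iteration step stays in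
  the class. That the highest derivative enters the chain rule only once matters for time: a bound
  of higher degree in it would close only on a short interval, not on all of I.\<close>

definition sdiff :: "('a::real_vector \<Rightarrow> real) \<Rightarrow> 'a \<Rightarrow> 'a \<Rightarrow> real" where
  "sdiff f x h = f (x + 2 *\<^sub>R h) - 2 * f (x + h) + f x"

text \<open>The Zygmund condition in dual form.  For a suitable set \<open>Y\<close> of weights (the polar of a
  weighted \<open>\<ell>\<^sup>p\<close> ball, defined below) it says that the \<open>\<ell>\<^sup>p\<close> norm of the dyadic smoothness moduli is
  at most \<open>K\<close>, but since it only involves finite sums of values of \<open>f\<close>, it passes to pointwise limits
  and to integrals over a parameter without any measurability of suprema.  For \<open>Y = {}\<close> it is
  void.\<close>

definition zyg_le :: "(nat \<Rightarrow> real) set \<Rightarrow> real \<Rightarrow> ('a::real_normed_vector \<Rightarrow> real) \<Rightarrow> bool" where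
  "zyg_le Y K f \<longleftrightarrow> (\<forall>y\<in>Y. \<forall>J x h. (\<forall>j<J. norm (h j) \<le> (1/2)^j) \<longrightarrow>
     (\<Sum>j<J. y j * \<bar>sdiff f (x j) (h j)\<bar>) \<le> K)"

text \<open>The Hoelder bound is recorded beside \<open>zyg_le\<close> because the latter may be
  void: with Y = {} this is the ordinary bounded \<gamma>-Hoelder class.\<close>

definition bes0 :: "real \<Rightarrow> (nat \<Rightarrow> real) set \<Rightarrow> real \<Rightarrow> ('a::euclidean_space \<Rightarrow> real) \<Rightarrow> bool" where
  "bes0 \<gamma> Y K f \<longleftrightarrow>
     (\<forall>x. \<bar>f x\<bar> \<le> K) \<and> (\<forall>x y. \<bar>f x - f y\<bar> \<le> K * norm (x - y) powr \<gamma>) \<and> zyg_le Y K f"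

text \<open>The derivative is required to exist only in the form of a uniform Taylor estimate, which is
  again stable under pointwise limits and parameter integrals.\<close>

primrec bes :: "real \<Rightarrow> (nat \<Rightarrow> real) set \<Rightarrow> nat \<Rightarrow> real \<Rightarrow> ('a::euclidean_space \<Rightarrow> real) \<Rightarrow> bool" where
  "bes \<gamma> Y 0 = (\<lambda>K f. bes0 \<gamma> Y K f)"
| "bes \<gamma> Y (Suc n) = (\<lambda>K f. bes0 \<gamma> Y K f \<and>
     (\<exists>g. (\<forall>x h. \<bar>f (x + h) - f x - g x \<bullet> h\<bar> \<le> K * norm h powr (1 + \<gamma>)) \<and>
          (\<forall>i\<in>Basis. bes \<gamma> Y n K (\<lambda>x. g x \<bullet> i))))"

declare bes.simps [simp del]

lemma bes_0 [simp]: "bes \<gamma> Y 0 K f \<longleftrightarrow>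
    (\<forall>x. \<bar>f x\<bar> \<le> K) \<and> (\<forall>x y. \<bar>f x - f y\<bar> \<le> K * norm (x - y) powr \<gamma>) \<and> zyg_le Y K f"
  by (simp add: bes.simps bes0_def)

lemma bes_Suc: "bes \<gamma> Y (Suc n) K f \<longleftrightarrow> bes \<gamma> Y 0 K f \<and>
    (\<exists>g. (\<forall>x h. \<bar>f (x + h) - f x - g x \<bullet> h\<bar> \<le> K * norm h powr (1 + \<gamma>)) \<and>
         (\<forall>i\<in>Basis. bes \<gamma> Y n K (\<lambda>x. g x \<bullet> i)))"
  by (simp only: bes.simps)

lemma bes_SucI:
  assumes "bes \<gamma> Y 0 K f"
    and "\<And>x h. \<bar>f (x + h) - f x - g x \<bullet> h\<bar> \<le> K * norm h powr (1 + \<gamma>)"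
    and "\<And>i. i \<in> Basis \<Longrightarrow> bes \<gamma> Y n K (\<lambda>x. g x \<bullet> i)"
  shows "bes \<gamma> Y (Suc n) K f"
  unfolding bes_Suc using assms by (intro conjI exI[of _ g]) auto

lemma bes_SucE:
  assumes "bes \<gamma> Y (Suc n) K f"
  obtains g where "\<And>x h. \<bar>f (x + h) - f x - g x \<bullet> h\<bar> \<le> K * norm h powr (1 + \<gamma>)"
    and "\<And>i. i \<in> Basis \<Longrightarrow> bes \<gamma> Y n K (\<lambda>x. g x \<bullet> i)"
  using assms unfolding bes_Suc by blast

section \<open>Elementary consequences of the class conditions\<close>

lemma zyg_leD:
  assumes "zyg_le Y K f" "y \<in> Y" "\<And>j. j < J \<Longrightarrow> norm (h j) \<le> (1/2)^j"
  shows "(\<Sum>j<J. y j * \<bar>sdiff f (x j) (h j)\<bar>) \<le> K"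
  using assms unfolding zyg_le_def by blast

lemma abs_inner_le_basis:
  fixes v h :: "'a::euclidean_space" and K :: real
  assumes "\<And>i. i \<in> Basis \<Longrightarrow> \<bar>v \<bullet> i\<bar> \<le> K"
  shows "\<bar>v \<bullet> h\<bar> \<le> DIM('a) * K * norm h"
proof -
  have "\<bar>v \<bullet> h\<bar> = \<bar>\<Sum>i\<in>Basis. (v \<bullet> i) * (h \<bullet> i)\<bar>"
    by (subst euclidean_inner) simp
  also have "\<dots> \<le> (\<Sum>i\<in>Basis. \<bar>v \<bullet> i\<bar> * \<bar>h \<bullet> i\<bar>)"
    by (rule order_trans[OF sum_abs]) (simp add: abs_mult)
  also have "\<dots> \<le> (\<Sum>i\<in>(Basis::'a set). K * norm h)"
    by (intro sum_mono mult_mono assms) (auto simp: Basis_le_norm intro: order_trans[OF abs_ge_zero assms])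
  finally show ?thesis by simp
qed

lemma bes_level0: "bes \<gamma> Y n K f \<Longrightarrow> bes \<gamma> Y 0 K f"
  by (cases n) (auto simp: bes_Suc simp del: bes_0)

lemma bes_bound: "bes \<gamma> Y n K f \<Longrightarrow> \<bar>f x\<bar> \<le> K"
  by (drule bes_level0) simp

lemma bes_nonneg: "bes \<gamma> Y n K f \<Longrightarrow> 0 \<le> K"
  using bes_bound[of \<gamma> Y n K f undefined] by linarith

lemma bes_holder: "bes \<gamma> Y n K f \<Longrightarrow> \<bar>f x - f y\<bar> \<le> K * norm (x - y) powr \<gamma>"
  by (drule bes_level0) simp

lemma bes_zyg: "bes \<gamma> Y n K f \<Longrightarrow> zyg_le Y K f"
  by (drule bes_level0) simp

lemma bes_Suc_imp: "bes \<gamma> Y (Suc n) K f \<Longrightarrow> bes \<gamma> Y n K f"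
proof (induction n arbitrary: f)
  case 0 then show ?case by (simp only: bes_Suc)
next
  case (Suc n)
  then obtain g where g: "\<forall>x h. \<bar>f (x + h) - f x - g x \<bullet> h\<bar> \<le> K * norm h powr (1 + \<gamma>)"
    "\<forall>i\<in>Basis. bes \<gamma> Y (Suc n) K (\<lambda>x. g x \<bullet> i)" and 0: "bes \<gamma> Y 0 K f"
    unfolding bes_Suc[of _ _ "Suc n"] by blast
  show ?case unfolding bes_Suc[of _ _ "n"] using 0 g Suc.IH by blast
qed

lemma bes0_mono:
  assumes "bes \<gamma> Y 0 K f" "K \<le> L"
  shows "bes \<gamma> Y 0 L f"
  unfolding bes_0
proof (intro conjI allI)
  show "\<bar>f x\<bar> \<le> L" for x using assms by (auto intro: order_trans)
  show "\<bar>f x - f y\<bar> \<le> L * norm (x - y) powr \<gamma>" for x y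
    by (rule order_trans[OF bes_holder[OF assms(1)]]) (simp add: assms(2) mult_right_mono)
  show "zyg_le Y L f" using bes_zyg[OF assms(1)] assms(2) unfolding zyg_le_def by (meson order_trans)
qed

lemma bes_mono:
  assumes "bes \<gamma> Y n K f" "K \<le> L"
  shows "bes \<gamma> Y n L f"
  using assms(1)
proof (induction n arbitrary: f)
  case 0
  then show ?case using assms(2) by (rule bes0_mono)
next
  case (Suc n)
  obtain g where g: "\<forall>x h. \<bar>f (x + h) - f x - g x \<bullet> h\<bar> \<le> K * norm h powr (1 + \<gamma>)"
    "\<forall>i\<in>Basis. bes \<gamma> Y n K (\<lambda>x. g x \<bullet> i)" using bes_SucE[OF Suc.prems] by metis
  have "\<bar>f (x + h) - f x - g x \<bullet> h\<bar> \<le> L * norm h powr (1 + \<gamma>)" for x h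
    by (rule order_trans[OF g(1)[rule_format]]) (simp add: assms(2) mult_right_mono)
  then show ?case unfolding bes_Suc
    using bes0_mono[OF bes_level0[OF Suc.prems] assms(2)] g(2) Suc.IH by blast
qed

text \<open>At distance at most 1 the Taylor remainder of order 1 + \<gamma> is dominated by the
  distance itself; at larger distance the sup bound 2 K suffices.\<close>

lemma bes_Suc_lipschitz:
  fixes f :: "'a::euclidean_space \<Rightarrow> real" and K :: real
  assumes "bes \<gamma> Y (Suc n) K f" "0 < \<gamma>"
  shows "\<bar>f x - f y\<bar> \<le> (DIM('a) + 2) * K * norm (x - y)"
proof -
  obtain g where g: "\<And>x h. \<bar>f (x + h) - f x - g x \<bullet> h\<bar> \<le> K * norm h powr (1 + \<gamma>)"
    "\<And>i. i \<in> Basis \<Longrightarrow> bes \<gamma> Y n K (\<lambda>x. g x \<bullet> i)"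
    using bes_SucE[OF assms(1)] by metis
  have K: "0 \<le> K" using bes_nonneg assms by blast
  show ?thesis
  proof (cases "norm (x - y) \<le> 1")
    case True
    have "\<bar>f (y + (x - y)) - f y - g y \<bullet> (x - y)\<bar> \<le> K * norm (x - y) powr (1 + \<gamma>)" by (rule g)
    also have "\<dots> \<le> K * norm (x - y)"
    proof -
      have "norm (x - y) powr (1 + \<gamma>) \<le> norm (x - y) powr 1"
        by (rule powr_mono') (use True assms in auto)
      then show ?thesis using K by (intro mult_left_mono) auto
    qed
    finally have 1: "\<bar>f x - f y - g y \<bullet> (x - y)\<bar> \<le> K * norm (x - y)" by simp
    have "\<bar>g y \<bullet> (x - y)\<bar> \<le> DIM('a) * K * norm (x - y)"
      using abs_inner_le_basis[OF bes_bound[OF g(2)]] by simp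
    with 1 have "\<bar>f x - f y\<bar> \<le> DIM('a) * K * norm (x - y) + K * norm (x - y)" by linarith
    also have "\<dots> \<le> (DIM('a) + 2) * K * norm (x - y)" using K by (simp add: algebra_simps)
    finally show ?thesis .
  next
    case False
    have "\<bar>f x - f y\<bar> \<le> 2 * K" using bes_bound[OF assms(1), of x] bes_bound[OF assms(1), of y] by linarith
    also have "\<dots> \<le> 2 * K * norm (x - y)" using False K mult_left_mono[of 1 "norm (x-y)" "2*K"] by simp
    also have "\<dots> \<le> (DIM('a) + 2) * K * norm (x - y)" using K by (simp add: algebra_simps)
    finally show ?thesis .
  qed
qed

section \<open>Sums and products in the scalar classes\<close>

lemma sdiff_add: "sdiff (\<lambda>x. f x + g x) x h = sdiff f x h + sdiff g x h"
  by (simp add: sdiff_def algebra_simps)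

text \<open>\<open>Y_sum\<close> is the only quantitative fact about the weights that the calculus
  needs: it converts a pointwise error of order \<gamma> + \<gamma>^2 in the step into the constant
  S. With Y = {} and S = 0 the locale describes Hoelder classes.\<close>

locale besov_scale =
  fixes \<gamma> S :: real and Y :: "(nat \<Rightarrow> real) set"
  assumes gamma_pos: "0 < \<gamma>" and gamma_le: "\<gamma> \<le> 1" and S_nonneg: "0 \<le> S"
    and Y_nonneg: "y \<in> Y \<Longrightarrow> 0 \<le> y j"
    and Y_sum: "y \<in> Y \<Longrightarrow> (\<Sum>j<J. y j * ((1/2)^j) powr (\<gamma> + \<gamma> * \<gamma>)) \<le> S"
begin

abbreviation bb where "bb \<equiv> bes \<gamma> Y"

lemma half_powr_le:
  assumes "norm h \<le> (1/2)^j" "\<gamma> + \<gamma> * \<gamma> \<le> \<beta>"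
  shows "norm h powr \<beta> \<le> ((1/2)^j) powr (\<gamma> + \<gamma> * \<gamma>)"
proof -
  have "0 < \<gamma> + \<gamma> * \<gamma>" using gamma_pos by (simp add: add_pos_pos)
  then have "norm h powr \<beta> \<le> ((1/2)^j) powr \<beta>" using assms by (intro powr_mono2) auto
  also have "\<dots> \<le> ((1/2)^j) powr (\<gamma> + \<gamma> * \<gamma>)"
    using assms(2) by (intro powr_mono') (auto simp: power_le_one)
  finally show ?thesis .
qed

text \<open>All remainders of the calculus pass through here: \<beta> is 2 \<gamma> for products,
  \<gamma> + \<gamma>^2 for compositions and 1 + \<gamma> for Taylor estimates.\<close>

lemma sum_remainder_le:
  assumes "y \<in> Y" "\<And>j. j < J \<Longrightarrow> norm (h j) \<le> (1/2)^j" "\<gamma> + \<gamma> * \<gamma> \<le> \<beta>"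
  shows "(\<Sum>j<J. y j * norm (h j) powr \<beta>) \<le> S"
  by (rule order_trans[OF sum_mono Y_sum[OF assms(1)]])
    (use assms half_powr_le Y_nonneg in \<open>auto intro!: mult_left_mono\<close>)

lemma zyg_le_add:
  fixes f g :: "'a::real_normed_vector \<Rightarrow> real"
  assumes "zyg_le Y K f" "zyg_le Y L g"
  shows "zyg_le Y (K + L) (\<lambda>x. f x + g x)"
  unfolding zyg_le_def
proof (intro ballI allI impI)
  fix y J and x h :: "nat \<Rightarrow> 'a" assume y: "y \<in> Y" and h: "\<forall>j<J. norm (h j) \<le> (1/2)^j"
  have "(\<Sum>j<J. y j * \<bar>sdiff (\<lambda>x. f x + g x) (x j) (h j)\<bar>)
      \<le> (\<Sum>j<J. y j * \<bar>sdiff f (x j) (h j)\<bar> + y j * \<bar>sdiff g (x j) (h j)\<bar>)"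
    unfolding sdiff_add using Y_nonneg[OF y]
    by (intro sum_mono) (metis distrib_left abs_triangle_ineq mult_left_mono)
  also have "\<dots> \<le> K + L"
    unfolding sum.distrib using y h by (intro add_mono zyg_leD[OF assms(1)] zyg_leD[OF assms(2)]) auto
  finally show "(\<Sum>j<J. y j * \<bar>sdiff (\<lambda>x. f x + g x) (x j) (h j)\<bar>) \<le> K + L" .
qed

lemma bes0_add:
  assumes "bb 0 K f" "bb 0 L g"
  shows "bb 0 (K + L) (\<lambda>x. f x + g x)"
proof -
  have "\<bar>f x + g x - (f y + g y)\<bar> \<le> (K + L) * norm (x - y) powr \<gamma>" for x y
    using bes_holder[OF assms(1), of x y] bes_holder[OF assms(2), of x y] by (simp only: distrib_right)
  moreover have "\<bar>f x + g x\<bar> \<le> K + L" for x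
    using bes_bound[OF assms(1), of x] bes_bound[OF assms(2), of x] by linarith
  ultimately show ?thesis using assms zyg_le_add by auto
qed

lemma bes_add:
  assumes "bb n K f" "bb n L g"
  shows "bb n (K + L) (\<lambda>x. f x + g x)"
  using assms
proof (induction n arbitrary: f g)
  case 0
  then show ?case by (rule bes0_add)
next
  case (Suc n)
  obtain F where F: "\<And>x h. \<bar>f (x + h) - f x - F x \<bullet> h\<bar> \<le> K * norm h powr (1 + \<gamma>)"
    "\<And>i. i \<in> Basis \<Longrightarrow> bb n K (\<lambda>x. F x \<bullet> i)"
    using bes_SucE[OF Suc.prems(1)] by metis
  obtain G where G: "\<And>x h. \<bar>g (x + h) - g x - G x \<bullet> h\<bar> \<le> L * norm h powr (1 + \<gamma>)"
    "\<And>i. i \<in> Basis \<Longrightarrow> bb n L (\<lambda>x. G x \<bullet> i)"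
    using bes_SucE[OF Suc.prems(2)] by metis
  have "bb 0 (K + L) (\<lambda>x. f x + g x)"
    using Suc.prems[THEN bes_level0] by (rule bes0_add)
  moreover have "\<bar>f (x + h) + g (x + h) - (f x + g x) - (F x + G x) \<bullet> h\<bar> \<le> (K + L) * norm h powr (1 + \<gamma>)" for x h
    using F(1)[of x h] G(1)[of x h] by (simp only: distrib_right inner_left_distrib)
  moreover have "bb n (K + L) (\<lambda>x. (F x + G x) \<bullet> i)" if "i \<in> Basis" for i
    using Suc.IH[OF F(2)[OF that] G(2)[OF that]] by (simp add: inner_left_distrib)
  ultimately show ?case by (rule bes_SucI)
qed

lemma bes_const: "\<bar>c\<bar> \<le> K \<Longrightarrow> bb n K (\<lambda>x::'a::euclidean_space. c)"
proof (induction n arbitrary: c)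
  case 0 then have "0 \<le> K" by linarith
  then show ?case using 0 by (auto simp: zyg_le_def sdiff_def)
next
  case (Suc n)
  then have K: "0 \<le> K" by linarith
  have "bb 0 K (\<lambda>x::'a. c)" using K Suc.prems by (auto simp: zyg_le_def sdiff_def)
  moreover have "bb n K (\<lambda>x::'a. 0 \<bullet> i)" for i :: 'a using Suc.IH[of 0] K by simp
  ultimately show ?case unfolding bes_Suc using K by (intro conjI exI[of _ "\<lambda>x. 0"]) auto
qed

lemma bes_sum:
  assumes "finite I" "\<And>i. i \<in> I \<Longrightarrow> bb n (K i) (f i)"
  shows "bb n (\<Sum>i\<in>I. K i) (\<lambda>x. \<Sum>i\<in>I. f i x)"
  using assms by (induction I) (auto intro!: bes_add bes_const)

lemma bes0_mult:
  fixes f g :: "'a::euclidean_space \<Rightarrow> real"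
  assumes f: "bb 0 K f" and g: "bb 0 L g"
  shows "bb 0 ((2 + 2 * S) * K * L) (\<lambda>x. f x * g x)"
proof -
  have K: "0 \<le> K" "0 \<le> L" using bes_nonneg f g by blast+
  have KL: "\<bar>f x * g y\<bar> \<le> K * L" for x y
    unfolding abs_mult using bes_bound[OF f] bes_bound[OF g] K by (intro mult_mono) auto
  have 1: "2 * K * L \<le> (2 + 2 * S) * K * L" using S_nonneg K by (intro mult_right_mono) auto
  have H: "\<bar>f x * g x - f y * g y\<bar> \<le> 2 * K * L * norm (x - y) powr \<gamma>" for x y
  proof -
    have "\<bar>f x * g x - f y * g y\<bar> = \<bar>f x * (g x - g y) + (f x - f y) * g y\<bar>" by (simp add: algebra_simps)
    also have "\<dots> \<le> \<bar>f x\<bar> * \<bar>g x - g y\<bar> + \<bar>f x - f y\<bar> * \<bar>g y\<bar>"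
      by (rule order_trans[OF abs_triangle_ineq]) (simp add: abs_mult)
    also have "\<dots> \<le> K * (L * norm (x - y) powr \<gamma>) + (K * norm (x - y) powr \<gamma>) * L"
      using K by (intro add_mono mult_mono bes_bound[OF f] bes_bound[OF g] bes_holder[OF f] bes_holder[OF g]) auto
    finally show ?thesis by (simp add: algebra_simps)
  qed
  have sdiff: "\<bar>sdiff (\<lambda>x. f x * g x) x h\<bar> \<le> L * \<bar>sdiff f x h\<bar> + K * \<bar>sdiff g x h\<bar> + 2 * K * L * norm h powr (2 * \<gamma>)" for x h
  proof -
    \<comment> \<open>Leibniz rule for second differences, expanded at the midpoint x + h. The last
      two terms are products of two first differences, hence of order 2 \<gamma>.\<close>
    have eq: "sdiff (\<lambda>x. f x * g x) x h = g (x + h) * sdiff f x h + f (x + h) * sdiff g x h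
       + (f (x + 2 *\<^sub>R h) - f (x + h)) * (g (x + 2 *\<^sub>R h) - g (x + h)) + (f x - f (x + h)) * (g x - g (x + h))"
      unfolding sdiff_def by (simp add: algebra_simps)
    have d1: "\<bar>f (x + 2 *\<^sub>R h) - f (x + h)\<bar> \<le> K * norm h powr \<gamma>" "\<bar>g (x + 2 *\<^sub>R h) - g (x + h)\<bar> \<le> L * norm h powr \<gamma>"
      using bes_holder[OF f, of "x + 2 *\<^sub>R h" "x + h"] bes_holder[OF g, of "x + 2 *\<^sub>R h" "x + h"] by (simp_all add: scaleR_2)
    have d2: "\<bar>f x - f (x + h)\<bar> \<le> K * norm h powr \<gamma>" "\<bar>g x - g (x + h)\<bar> \<le> L * norm h powr \<gamma>"
      using bes_holder[OF f, of x "x + h"] bes_holder[OF g, of x "x + h"] by simp_all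
    have p: "(K * norm h powr \<gamma>) * (L * norm h powr \<gamma>) = K * L * norm h powr (2 * \<gamma>)"
      by (simp add: powr_add[symmetric] algebra_simps flip: mult_2)
    have a: "\<bar>(f (x + 2 *\<^sub>R h) - f (x + h)) * (g (x + 2 *\<^sub>R h) - g (x + h))\<bar> \<le> K * L * norm h powr (2 * \<gamma>)"
      unfolding abs_mult p[symmetric] using d1 K by (intro mult_mono) auto
    have b: "\<bar>(f x - f (x + h)) * (g x - g (x + h))\<bar> \<le> K * L * norm h powr (2 * \<gamma>)"
      unfolding abs_mult p[symmetric] using d2 K by (intro mult_mono) auto
    have c: "\<bar>g (x + h) * sdiff f x h\<bar> \<le> L * \<bar>sdiff f x h\<bar>" "\<bar>f (x + h) * sdiff g x h\<bar> \<le> K * \<bar>sdiff g x h\<bar>"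
      unfolding abs_mult using bes_bound[OF f] bes_bound[OF g] by (auto intro!: mult_right_mono)
    show ?thesis unfolding eq using a b c by (simp add: algebra_simps)
  qed
  have "zyg_le Y ((2 + 2 * S) * K * L) (\<lambda>x. f x * g x)"
    unfolding zyg_le_def
  proof (intro ballI allI impI)
    fix y J and x h :: "nat \<Rightarrow> 'a" assume y: "y \<in> Y" and h: "\<forall>j<J. norm (h j) \<le> (1/2)^j"
    have "(\<Sum>j<J. y j * \<bar>sdiff (\<lambda>x. f x * g x) (x j) (h j)\<bar>) \<le>
       (\<Sum>j<J. y j * (L * \<bar>sdiff f (x j) (h j)\<bar> + K * \<bar>sdiff g (x j) (h j)\<bar> + 2 * K * L * norm (h j) powr (2 * \<gamma>)))"
      using Y_nonneg[OF y] by (intro sum_mono mult_left_mono sdiff) auto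
    also have "\<dots> = L * (\<Sum>j<J. y j * \<bar>sdiff f (x j) (h j)\<bar>) + K * (\<Sum>j<J. y j * \<bar>sdiff g (x j) (h j)\<bar>)
       + 2 * K * L * (\<Sum>j<J. y j * norm (h j) powr (2 * \<gamma>))"
      by (simp add: sum.distrib sum_distrib_left algebra_simps)
    also have "\<dots> \<le> L * K + K * L + 2 * K * L * S"
      using y h K gamma_pos gamma_le mult_left_mono[OF gamma_le, of \<gamma>]
      by (intro add_mono mult_left_mono zyg_leD[OF bes_zyg[OF f]] zyg_leD[OF bes_zyg[OF g]] sum_remainder_le)
        auto
    finally show "(\<Sum>j<J. y j * \<bar>sdiff (\<lambda>x. f x * g x) (x j) (h j)\<bar>) \<le> (2 + 2 * S) * K * L"
      by (simp add: algebra_simps)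
  qed
  moreover have "\<bar>f x * g x\<bar> \<le> (2 + 2 * S) * K * L" for x
    using KL[of x x] 1 mult_nonneg_nonneg[OF K] by linarith
  moreover have "\<bar>f x * g x - f y * g y\<bar> \<le> (2 + 2 * S) * K * L * norm (x - y) powr \<gamma>" for x y
    by (rule order_trans[OF H]) (use 1 in \<open>auto intro: mult_right_mono\<close>)
  ultimately show ?thesis by auto
qed

text \<open>The summands pay, in this order, for the two Leibniz terms of the gradient, for the
  product at level 0 and for the Taylor remainder of the product.\<close>

primrec mult_const :: "'a::euclidean_space itself \<Rightarrow> nat \<Rightarrow> real" where
  "mult_const t 0 = 2 + 2 * S"
| "mult_const t (Suc n) = 2 * mult_const t n + (2 + 2 * S) + (DIM('a) + 4)"

lemma mult_const_nonneg: "0 \<le> mult_const t n"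
  using S_nonneg by (induction n) auto

text \<open>The gradient is given by the Leibniz rule. The Taylor remainder contains the product of
  both increments, which has order 1 + \<gamma> because one factor is bounded by its Lipschitz
  constant and the other by its Hoelder constant.\<close>

lemma bes_mult:
  fixes f g :: "'a::euclidean_space \<Rightarrow> real"
  assumes "bb n K f" "bb n L g"
  shows "bb n (mult_const TYPE('a) n * K * L) (\<lambda>x. f x * g x)"
  using assms
proof (induction n arbitrary: f g)
  case 0 then show ?case unfolding mult_const.simps by (rule bes0_mult)
next
  case (Suc n)
  let ?C = "mult_const TYPE('a)"
  obtain F where F: "\<And>x h. \<bar>f (x + h) - f x - F x \<bullet> h\<bar> \<le> K * norm h powr (1 + \<gamma>)"
    "\<And>i. i \<in> Basis \<Longrightarrow> bb n K (\<lambda>x. F x \<bullet> i)"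
    using bes_SucE[OF Suc.prems(1)] by metis
  obtain G where G: "\<And>x h. \<bar>g (x + h) - g x - G x \<bullet> h\<bar> \<le> L * norm h powr (1 + \<gamma>)"
    "\<And>i. i \<in> Basis \<Longrightarrow> bb n L (\<lambda>x. G x \<bullet> i)"
    using bes_SucE[OF Suc.prems(2)] by metis
  have K: "0 \<le> K" "0 \<le> L" and KL: "0 \<le> K * L" using bes_nonneg Suc.prems by (blast, blast, simp add: bes_nonneg[OF Suc.prems(1)] bes_nonneg[OF Suc.prems(2)])
  have 0: "bb 0 (?C (Suc n) * K * L) (\<lambda>x. f x * g x)"
    by (rule bes_mono[OF bes0_mult[OF Suc.prems[THEN bes_level0]]])
      (use K mult_const_nonneg[of "TYPE('a)" n] in \<open>auto intro!: mult_right_mono\<close>)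
  have T: "\<bar>f (x + h) * g (x + h) - f x * g x - (f x *\<^sub>R G x + g x *\<^sub>R F x) \<bullet> h\<bar>
     \<le> ?C (Suc n) * K * L * norm h powr (1 + \<gamma>)" for x h
  proof -
    have eq: "f (x + h) * g (x + h) - f x * g x - (f x *\<^sub>R G x + g x *\<^sub>R F x) \<bullet> h
       = f x * (g (x + h) - g x - G x \<bullet> h) + g x * (f (x + h) - f x - F x \<bullet> h) + (f (x + h) - f x) * (g (x + h) - g x)"
      by (simp add: algebra_simps inner_left_distrib)
    have a: "\<bar>f x * (g (x + h) - g x - G x \<bullet> h)\<bar> \<le> K * (L * norm h powr (1 + \<gamma>))"
      unfolding abs_mult using K by (intro mult_mono G bes_bound[OF Suc.prems(1)]) auto
    have b: "\<bar>g x * (f (x + h) - f x - F x \<bullet> h)\<bar> \<le> L * (K * norm h powr (1 + \<gamma>))"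
      unfolding abs_mult using K by (intro mult_mono F bes_bound[OF Suc.prems(2)]) auto
    have "\<bar>(f (x + h) - f x) * (g (x + h) - g x)\<bar> \<le> ((DIM('a) + 2) * K * norm h) * (L * norm h powr \<gamma>)"
      unfolding abs_mult using K bes_Suc_lipschitz[OF Suc.prems(1) gamma_pos, of "x + h" x] bes_holder[OF Suc.prems(2), of "x + h" x]
      by (intro mult_mono) auto
    also have "\<dots> = (DIM('a) + 2) * (K * L * norm h powr (1 + \<gamma>))"
      by (simp add: powr_add algebra_simps)
    finally have "\<bar>f (x + h) * g (x + h) - f x * g x - (f x *\<^sub>R G x + g x *\<^sub>R F x) \<bullet> h\<bar>
      \<le> (DIM('a) + 4) * (K * L * norm h powr (1 + \<gamma>))" unfolding eq using a b by (simp add: algebra_simps)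
    also have "\<dots> \<le> ?C (Suc n) * (K * L * norm h powr (1 + \<gamma>))"
      using K S_nonneg mult_const_nonneg[of "TYPE('a)" n] by (intro mult_right_mono) auto
    finally show ?thesis by (simp add: algebra_simps)
  qed
  have D: "bb n (?C (Suc n) * K * L) (\<lambda>x. (f x *\<^sub>R G x + g x *\<^sub>R F x) \<bullet> i)" if "i \<in> Basis" for i
  proof -
    have "bb n (?C n * K * L + ?C n * K * L) (\<lambda>x. f x * (G x \<bullet> i) + (F x \<bullet> i) * g x)"
      using that by (intro bes_add Suc.IH F G Suc.prems[THEN bes_Suc_imp])
    then have b: "bb n (?C n * K * L + ?C n * K * L) (\<lambda>x. (f x *\<^sub>R G x + g x *\<^sub>R F x) \<bullet> i)"
      by (simp add: inner_left_distrib mult.commute)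
    have "?C n * K * L + ?C n * K * L = (2 * ?C n) * (K * L)" by (simp add: algebra_simps)
    also have "\<dots> \<le> ?C (Suc n) * (K * L)"
      using KL S_nonneg by (intro mult_right_mono) auto
    finally show ?thesis by (intro bes_mono[OF b]) (simp add: mult.assoc)
  qed
  show ?case using 0 T D by (rule bes_SucI)
qed

end

section \<open>Pointwise limits and parameter integrals\<close>

text \<open>The gradient enters \<open>bes\<close> through an existential only. Its representation
  by difference quotients along a fixed sequence shows that it is measurable in a parameter whenever
  f is.\<close>

lemma bes_gradient_limit:
  fixes f :: "'a::euclidean_space \<Rightarrow> real"
  assumes g: "\<And>x h. \<bar>f (x + h) - f x - g x \<bullet> h\<bar> \<le> K * norm h powr (1 + \<gamma>)" and "0 < \<gamma>"
  shows "(\<lambda>k. real (Suc k) * (f (x + (1 / real (Suc k)) *\<^sub>R v) - f x)) \<longlonglongrightarrow> g x \<bullet> v"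
proof -
  define C where "C = \<bar>K\<bar> * norm v powr (1 + \<gamma>)"
  have "\<bar>real (Suc k) * (f (x + (1 / real (Suc k)) *\<^sub>R v) - f x) - g x \<bullet> v\<bar> \<le> C * (1 / real (Suc k)) powr \<gamma>" for k
  proof -
    let ?t = "1 / real (Suc k)"
    have "\<bar>f (x + ?t *\<^sub>R v) - f x - g x \<bullet> (?t *\<^sub>R v)\<bar> \<le> K * norm (?t *\<^sub>R v) powr (1 + \<gamma>)" by (rule g)
    also have "\<dots> \<le> C * ?t powr (1 + \<gamma>)"
      unfolding C_def by (simp add: powr_divide powr_mult divide_right_mono mult_right_mono)
    finally have "real (Suc k) * \<bar>f (x + ?t *\<^sub>R v) - f x - g x \<bullet> (?t *\<^sub>R v)\<bar> \<le> real (Suc k) * (C * ?t powr (1 + \<gamma>))"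
      by (intro mult_left_mono) auto
    also have "real (Suc k) * (C * ?t powr (1 + \<gamma>)) = C * ?t powr \<gamma>"
      by (simp add: powr_add field_simps)
    also have "real (Suc k) * \<bar>f (x + ?t *\<^sub>R v) - f x - g x \<bullet> (?t *\<^sub>R v)\<bar>
       = \<bar>real (Suc k) * (f (x + ?t *\<^sub>R v) - f x - g x \<bullet> (?t *\<^sub>R v))\<bar>" by (simp add: abs_mult)
    also have "real (Suc k) * (f (x + ?t *\<^sub>R v) - f x - g x \<bullet> (?t *\<^sub>R v)) = real (Suc k) * (f (x + ?t *\<^sub>R v) - f x) - g x \<bullet> v"
      by (simp only: right_diff_distrib) simp
    finally show ?thesis .
  qed
  moreover have "(\<lambda>k. C * (1 / real (Suc k)) powr \<gamma>) \<longlonglongrightarrow> 0"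
  proof -
    have "(\<lambda>k. (1 / real (Suc k)) powr \<gamma>) \<longlonglongrightarrow> 0 powr \<gamma>"
      by (intro tendsto_powr' LIMSEQ_Suc[OF lim_1_over_n] tendsto_const) (use assms in auto)
    then show ?thesis by (auto intro: tendsto_mult_right_zero)
  qed
  ultimately have "(\<lambda>k. real (Suc k) * (f (x + (1 / real (Suc k)) *\<^sub>R v) - f x) - g x \<bullet> v) \<longlonglongrightarrow> 0"
    unfolding real_norm_def[symmetric] by (rule Lim_null_comparison[OF always_eventually[OF allI]])
  then show ?thesis by (rule LIM_zero_cancel)
qed

text \<open>The Taylor constant is common to all k, so one difference quotient of step t
  approximates every gradient up to C t^\<gamma>. The step is fixed first, in terms of e; after
  that, convergence of f k at the two points x and x + t v is enough.\<close>

lemma bes_gradient_cauchy: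
  fixes f :: "nat \<Rightarrow> 'a::euclidean_space \<Rightarrow> real"
  assumes g: "\<And>k x h. \<bar>f k (x + h) - f k x - g k x \<bullet> h\<bar> \<le> K * norm h powr (1 + \<gamma>)" and \<gamma>: "0 < \<gamma>"
    and lim: "\<And>x. (\<lambda>k. f k x) \<longlonglongrightarrow> F x"
  shows "convergent (\<lambda>k. g k x \<bullet> v)"
proof -
  define C where "C = \<bar>K\<bar> * norm v powr (1 + \<gamma>)"
  have C: "0 \<le> C" by (simp add: C_def)
  have T: "\<bar>f k (x + t *\<^sub>R v) - f k x - t * (g k x \<bullet> v)\<bar> \<le> C * t powr (1 + \<gamma>)" if "0 < t" for t k
  proof -
    have "\<bar>f k (x + t *\<^sub>R v) - f k x - t * (g k x \<bullet> v)\<bar> \<le> K * norm (t *\<^sub>R v) powr (1 + \<gamma>)"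
      using g[of k x "t *\<^sub>R v"] by simp
    also have "\<dots> \<le> C * t powr (1 + \<gamma>)"
      using that unfolding C_def by (simp add: powr_mult mult_right_mono mult.commute mult.left_commute)
    finally show ?thesis .
  qed
  have "Cauchy (\<lambda>k. g k x \<bullet> v)"
    unfolding Cauchy_def
  proof (intro allI impI)
    fix e :: real assume e: "0 < e"
    have "((\<lambda>t. 2 * C * t powr \<gamma>) \<longlongrightarrow> 2 * C * 0 powr \<gamma>) (at_right 0)"
      by (intro tendsto_intros tendsto_powr') (use \<gamma> in \<open>auto simp: eventually_at_filter\<close>)
    then have "\<forall>\<^sub>F t in at_right 0. 2 * C * t powr \<gamma> < e / 2"
      using e by (intro order_tendstoD(2)[of _ 0]) auto
    then obtain b where b: "b > 0" "\<And>y. 0 < y \<Longrightarrow> y < b \<Longrightarrow> 2 * C * y powr \<gamma> < e / 2"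
      unfolding eventually_at_right_field by auto
    define t where "t = b / 2"
    have t: "0 < t" "2 * C * t powr \<gamma> < e / 2" using b by (auto simp: t_def)
    have "convergent (\<lambda>k. f k (x + t *\<^sub>R v) - f k x)"
      using tendsto_diff[OF lim lim] unfolding convergent_def by blast
    then have "Cauchy (\<lambda>k. f k (x + t *\<^sub>R v) - f k x)" by (rule convergent_Cauchy)
    then obtain N where N: "\<And>m n. m \<ge> N \<Longrightarrow> n \<ge> N \<Longrightarrow>
        \<bar>(f m (x + t *\<^sub>R v) - f m x) - (f n (x + t *\<^sub>R v) - f n x)\<bar> < t * (e / 2)"
      using e t unfolding Cauchy_def dist_real_def by (metis half_gt_zero mult_pos_pos)
    have "dist (g m x \<bullet> v) (g n x \<bullet> v) < e" if "m \<ge> N" "n \<ge> N" for m n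
    proof -
      have "\<bar>t * (g m x \<bullet> v - g n x \<bullet> v)\<bar> < t * (e / 2) + 2 * (C * t powr (1 + \<gamma>))"
        using T[OF t(1), of m] T[OF t(1), of n] N[OF that] by (simp only: right_diff_distrib)
      also have "\<dots> = t * (e / 2 + 2 * C * t powr \<gamma>)" using t by (simp add: powr_add algebra_simps)
      also have "\<dots> \<le> t * e" using t by (intro mult_left_mono) auto
      finally show ?thesis using t by (simp add: abs_mult dist_real_def)
    qed
    then show "\<exists>N. \<forall>m\<ge>N. \<forall>n\<ge>N. dist (g m x \<bullet> v) (g n x \<bullet> v) < e" by blast
  qed
  then show ?thesis by (rule Cauchy_convergent)
qed

context besov_scale
begin

lemma bes0_limit:
  fixes f :: "nat \<Rightarrow> 'a::euclidean_space \<Rightarrow> real"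
  assumes f: "\<And>k. bb 0 K (f k)" and lim: "\<And>x. (\<lambda>k. f k x) \<longlonglongrightarrow> F x"
  shows "bb 0 K F"
  unfolding bes_0
proof (intro conjI allI)
  show "\<bar>F x\<bar> \<le> K" for x
    by (rule Lim_bounded[OF tendsto_rabs[OF lim]]) (use bes_bound[OF f] in auto)
  show "\<bar>F x - F y\<bar> \<le> K * norm (x - y) powr \<gamma>" for x y
    by (rule Lim_bounded[OF tendsto_rabs[OF tendsto_diff[OF lim lim]]]) (use bes_holder[OF f] in auto)
  show "zyg_le Y K F"
    unfolding zyg_le_def
  proof (intro ballI allI impI)
    fix y J and x h :: "nat \<Rightarrow> 'a" assume y: "y \<in> Y" and h: "\<forall>j<J. norm (h j) \<le> (1/2)^j"
    have "(\<lambda>k. \<Sum>j<J. y j * \<bar>sdiff (f k) (x j) (h j)\<bar>) \<longlonglongrightarrow> (\<Sum>j<J. y j * \<bar>sdiff F (x j) (h j)\<bar>)"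
      unfolding sdiff_def by (intro tendsto_intros lim)
    then show "(\<Sum>j<J. y j * \<bar>sdiff F (x j) (h j)\<bar>) \<le> K"
      by (rule Lim_bounded) (use y h in \<open>auto intro!: zyg_leD[OF bes_zyg[OF f]]\<close>)
  qed
qed

text \<open>Pointwise convergence of the functions forces convergence of the gradients by
  \<open>bes_gradient_cauchy\<close>, so the induction runs on the whole sequence without
  compactness or subsequences.\<close>

lemma bes_limit:
  fixes f :: "nat \<Rightarrow> 'a::euclidean_space \<Rightarrow> real"
  assumes "\<And>k. bb n K (f k)" "\<And>x. (\<lambda>k. f k x) \<longlonglongrightarrow> F x"
  shows "bb n K F"
  using assms
proof (induction n arbitrary: f F)
  case 0
  then show ?case by (rule bes0_limit)
next
  case (Suc n)
  have "\<exists>g. (\<forall>x h. \<bar>f k (x + h) - f k x - g x \<bullet> h\<bar> \<le> K * norm h powr (1 + \<gamma>)) \<and>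
       (\<forall>i\<in>Basis. bb n K (\<lambda>x. g x \<bullet> i))" for k
    using bes_SucE[OF Suc.prems(1)] by metis
  then obtain g where g: "\<And>k x h. \<bar>f k (x + h) - f k x - g k x \<bullet> h\<bar> \<le> K * norm h powr (1 + \<gamma>)"
    "\<And>k i. i \<in> Basis \<Longrightarrow> bb n K (\<lambda>x. g k x \<bullet> i)" by metis
  define G where "G x = (\<Sum>i\<in>Basis. lim (\<lambda>k. g k x \<bullet> i) *\<^sub>R i)" for x
  have lim: "(\<lambda>k. g k x \<bullet> i) \<longlonglongrightarrow> G x \<bullet> i" if "i \<in> Basis" for x i
    using bes_gradient_cauchy[OF g(1) gamma_pos Suc.prems(2), of x i] that
    by (simp add: G_def convergent_LIMSEQ_iff)
  have lim': "(\<lambda>k. g k x \<bullet> h) \<longlonglongrightarrow> G x \<bullet> h" for x h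
    by (subst (1 2) euclidean_inner) (intro tendsto_intros lim)
  show ?case
  proof (rule bes_SucI)
    show "bb 0 K F" using Suc.prems by (blast intro: bes0_limit bes_level0)
    show "\<bar>F (x + h) - F x - G x \<bullet> h\<bar> \<le> K * norm h powr (1 + \<gamma>)" for x h
      by (rule Lim_bounded[OF tendsto_rabs[OF tendsto_diff[OF tendsto_diff[OF Suc.prems(2) Suc.prems(2)] lim']]])
        (use g(1) in auto)
    show "bb n K (\<lambda>x. G x \<bullet> i)" if "i \<in> Basis" for i
      by (rule Suc.IH[OF g(2)[OF that] lim[OF that]])
  qed
qed

text \<open>Minkowski's inequality in dual form. For fixed weights, points and steps the Zygmund sum
  is a finite sum, so it commutes with the integral, and the bound \<open>m s\<close> is integrated
  afterwards.\<close>

lemma bes0_integral: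
  fixes f :: "'s \<Rightarrow> 'a::euclidean_space \<Rightarrow> real"
  assumes f: "\<And>s. s \<in> space M \<Longrightarrow> bb 0 (m s) (f s)" and m: "integrable M m"
    and int: "\<And>x. integrable M (\<lambda>s. f s x)"
  shows "bb 0 (\<integral>s. m s \<partial>M) (\<lambda>x. \<integral>s. f s x \<partial>M)"
  unfolding bes_0
proof (intro conjI allI)
  show "\<bar>\<integral>s. f s x \<partial>M\<bar> \<le> (\<integral>s. m s \<partial>M)" for x
    by (rule order_trans[OF integral_abs_bound integral_mono]) (use int m bes_bound[OF f] in auto)
  show "\<bar>(\<integral>s. f s x \<partial>M) - (\<integral>s. f s y \<partial>M)\<bar> \<le> (\<integral>s. m s \<partial>M) * norm (x - y) powr \<gamma>" for x y
  proof -
    have "\<bar>(\<integral>s. f s x \<partial>M) - (\<integral>s. f s y \<partial>M)\<bar> = \<bar>\<integral>s. f s x - f s y \<partial>M\<bar>" using int by simp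
    also have "\<dots> \<le> (\<integral>s. m s * norm (x - y) powr \<gamma> \<partial>M)"
      by (rule order_trans[OF integral_abs_bound integral_mono]) (use int m bes_holder[OF f] in auto)
    finally show ?thesis using m by simp
  qed
  show "zyg_le Y (\<integral>s. m s \<partial>M) (\<lambda>x. \<integral>s. f s x \<partial>M)"
    unfolding zyg_le_def
  proof (intro ballI allI impI)
    fix y J and x h :: "nat \<Rightarrow> 'a" assume y: "y \<in> Y" and h: "\<forall>j<J. norm (h j) \<le> (1/2)^j"
    have isd: "integrable M (\<lambda>s. sdiff (f s) (x j) (h j))" for j
      unfolding sdiff_def using int by simp
    have "(\<Sum>j<J. y j * \<bar>sdiff (\<lambda>x. \<integral>s. f s x \<partial>M) (x j) (h j)\<bar>) \<le> (\<Sum>j<J. y j * (\<integral>s. \<bar>sdiff (f s) (x j) (h j)\<bar> \<partial>M))"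
    proof (intro sum_mono mult_left_mono Y_nonneg[OF y])
      fix j
      have "sdiff (\<lambda>x. \<integral>s. f s x \<partial>M) (x j) (h j) = (\<integral>s. sdiff (f s) (x j) (h j) \<partial>M)"
        unfolding sdiff_def using int by simp
      then show "\<bar>sdiff (\<lambda>x. \<integral>s. f s x \<partial>M) (x j) (h j)\<bar> \<le> (\<integral>s. \<bar>sdiff (f s) (x j) (h j)\<bar> \<partial>M)"
        by (metis integral_abs_bound)
    qed
    also have "\<dots> = (\<integral>s. (\<Sum>j<J. y j * \<bar>sdiff (f s) (x j) (h j)\<bar>) \<partial>M)"
      using isd by (simp add: Bochner_Integration.integral_sum)
    also have "\<dots> \<le> (\<integral>s. m s \<partial>M)"
      using isd m y h by (intro integral_mono zyg_leD[OF bes_zyg[OF f]]) auto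
    finally show "(\<Sum>j<J. y j * \<bar>sdiff (\<lambda>x. \<integral>s. f s x \<partial>M) (x j) (h j)\<bar>) \<le> (\<integral>s. m s \<partial>M)" .
  qed
qed

lemma bes_integral:
  fixes f :: "'s \<Rightarrow> 'a::euclidean_space \<Rightarrow> real"
  assumes "\<And>s. s \<in> space M \<Longrightarrow> bb n (m s) (f s)" and m: "integrable M m"
    and "\<And>x. (\<lambda>s. f s x) \<in> borel_measurable M"
  shows "bb n (\<integral>s. m s \<partial>M) (\<lambda>x. \<integral>s. f s x \<partial>M)"
  using assms(1,3)
proof (induction n arbitrary: f)
  case 0
  have "integrable M (\<lambda>s. f s x)" for x
    by (rule Bochner_Integration.integrable_bound[OF m 0(2)])
      (use bes_bound[OF 0(1)] in \<open>auto intro!: AE_I2 intro: order_trans[OF _ abs_ge_self]\<close>)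
  then show ?case using 0(1) m by (intro bes0_integral)
next
  case (Suc n)
  have int: "integrable M (\<lambda>s. f s x)" for x
    by (rule Bochner_Integration.integrable_bound[OF m Suc.prems(2)])
      (use bes_bound[OF Suc.prems(1)] in \<open>auto intro!: AE_I2 intro: order_trans[OF _ abs_ge_self]\<close>)
  have "\<forall>s\<in>space M. \<exists>g. (\<forall>x h. \<bar>f s (x + h) - f s x - g x \<bullet> h\<bar> \<le> m s * norm h powr (1 + \<gamma>)) \<and>
       (\<forall>i\<in>Basis. bb n (m s) (\<lambda>x. g x \<bullet> i))"
    using bes_SucE[OF Suc.prems(1)] by metis
  then obtain g where g: "\<And>s x h. s \<in> space M \<Longrightarrow> \<bar>f s (x + h) - f s x - g s x \<bullet> h\<bar> \<le> m s * norm h powr (1 + \<gamma>)"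
    "\<And>s i. s \<in> space M \<Longrightarrow> i \<in> Basis \<Longrightarrow> bb n (m s) (\<lambda>x. g s x \<bullet> i)" unfolding bchoice_iff by metis
  \<comment> \<open>The gradients were chosen separately for each s. Measurability holds
    nevertheless, because they are limits of difference quotients of f.\<close>
  have meas: "(\<lambda>s. g s x \<bullet> v) \<in> borel_measurable M" for x v
    by (rule borel_measurable_LIMSEQ_real[OF bes_gradient_limit[OF g(1) gamma_pos]])
      (use Suc.prems(2) in auto)
  have intg: "integrable M (\<lambda>s. g s x \<bullet> i)" if "i \<in> Basis" for x i
    by (rule Bochner_Integration.integrable_bound[OF m meas])
      (use bes_bound[OF g(2)] that in \<open>auto intro!: AE_I2 intro: order_trans[OF _ abs_ge_self]\<close>)
  define G where "G x = (\<Sum>i\<in>Basis. (\<integral>s. g s x \<bullet> i \<partial>M) *\<^sub>R i)" for x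
  have G: "G x \<bullet> h = (\<integral>s. g s x \<bullet> h \<partial>M)" "integrable M (\<lambda>s. g s x \<bullet> h)" for x h
  proof -
    have "integrable M (\<lambda>s. \<Sum>i\<in>Basis. (g s x \<bullet> i) * (h \<bullet> i))" using intg by simp
    then show "integrable M (\<lambda>s. g s x \<bullet> h)" by (subst euclidean_inner)
    have "(\<integral>s. g s x \<bullet> h \<partial>M) = (\<Sum>i\<in>Basis. (\<integral>s. g s x \<bullet> i \<partial>M) * (h \<bullet> i))"
      using intg by (subst euclidean_inner) (simp add: Bochner_Integration.integral_sum)
    then show "G x \<bullet> h = (\<integral>s. g s x \<bullet> h \<partial>M)"
      by (simp add: G_def inner_sum_left inner_commute[of h])
  qed
  show ?case
  proof (rule bes_SucI)
    show "bb 0 (\<integral>s. m s \<partial>M) (\<lambda>x. \<integral>s. f s x \<partial>M)"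
      using bes_level0[OF Suc.prems(1)] m int by (rule bes0_integral)
    show "\<bar>(\<integral>s. f s (x + h) \<partial>M) - (\<integral>s. f s x \<partial>M) - G x \<bullet> h\<bar> \<le> (\<integral>s. m s \<partial>M) * norm h powr (1 + \<gamma>)" for x h
    proof -
      have "(\<integral>s. f s (x + h) \<partial>M) - (\<integral>s. f s x \<partial>M) - G x \<bullet> h = (\<integral>s. f s (x + h) - f s x - g s x \<bullet> h \<partial>M)"
        using int G by simp
      also have "\<bar>\<dots>\<bar> \<le> (\<integral>s. m s * norm h powr (1 + \<gamma>) \<partial>M)"
        by (rule order_trans[OF integral_abs_bound integral_mono]) (use int m G g(1) in auto)
      finally show ?thesis using m by simp
    qed
    show "bb n (\<integral>s. m s \<partial>M) (\<lambda>x. G x \<bullet> i)" if "i \<in> Basis" for i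
      unfolding G(1) using g(2) that meas by (intro Suc.IH) auto
  qed
qed

end

section \<open>Composition\<close>

text \<open>The composition operator f -> f o \<Phi> has norm at most c on the level-n class. It
  acts on scalar functions so that it applies to single components of a gradient as well.\<close>

definition comp_bound :: "real \<Rightarrow> (nat \<Rightarrow> real) set \<Rightarrow> nat \<Rightarrow> real \<Rightarrow> ('a::euclidean_space \<Rightarrow> 'a) \<Rightarrow> bool" where
  "comp_bound \<gamma> Y n c \<Phi> \<longleftrightarrow> (\<forall>K f. bes \<gamma> Y n K f \<longrightarrow> bes \<gamma> Y n (c * K) (\<lambda>x. f (\<Phi> x)))"

lemma comp_boundD: "comp_bound \<gamma> Y n c \<Phi> \<Longrightarrow> bes \<gamma> Y n K f \<Longrightarrow> bes \<gamma> Y n (c * K) (\<lambda>x. f (\<Phi> x))"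
  by (simp add: comp_bound_def)

lemma comp_bound_mono:
  "comp_bound \<gamma> Y n c \<Phi> \<Longrightarrow> c \<le> c' \<Longrightarrow> comp_bound \<gamma> Y n c' \<Phi>"
  unfolding comp_bound_def by (meson bes_mono bes_nonneg mult_right_mono)

context besov_scale
begin

text \<open>A second difference of step 2 k is a combination of second differences of step k with
  coefficients 1, 2, 1. Each halving of the steps therefore costs the factor 4.\<close>

lemma zyg_le_dyadic:
  fixes f :: "'a::real_normed_vector \<Rightarrow> real"
  assumes f: "zyg_le Y K f" and y: "y \<in> Y" and h: "\<And>j. j < J \<Longrightarrow> norm (h j) \<le> 2 ^ l * (1/2)^j"
  shows "(\<Sum>j<J. y j * \<bar>sdiff f (x j) (h j)\<bar>) \<le> 4 ^ l * K"
  using h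
proof (induction l arbitrary: x h)
  case 0
  then show ?case using f y by (auto intro: zyg_leD)
next
  case (Suc l)
  define k where "k j = (1/2) *\<^sub>R h j" for j
  have k: "norm (k j) \<le> 2 ^ l * (1/2)^j" if "j < J" for j
    using Suc.prems[OF that] by (simp add: k_def)
  have eq: "sdiff f (x j) (h j) = sdiff f (x j + h j) (k j) + 2 * sdiff f (x j + k j) (k j) + sdiff f (x j) (k j)" for j
  proof -
    have "h j = k j + k j" by (simp add: k_def flip: scaleR_left_distrib)
    then show ?thesis by (simp add: sdiff_def scaleR_2 algebra_simps)
  qed
  have "(\<Sum>j<J. y j * \<bar>sdiff f (x j) (h j)\<bar>) \<le> (\<Sum>j<J. y j * \<bar>sdiff f (x j + h j) (k j)\<bar>
     + 2 * (y j * \<bar>sdiff f (x j + k j) (k j)\<bar>) + y j * \<bar>sdiff f (x j) (k j)\<bar>)"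
  proof (intro sum_mono)
    fix j
    have "y j * \<bar>sdiff f (x j) (h j)\<bar> \<le> y j * (\<bar>sdiff f (x j + h j) (k j)\<bar> + 2 * \<bar>sdiff f (x j + k j) (k j)\<bar> + \<bar>sdiff f (x j) (k j)\<bar>)"
      unfolding eq[of j] by (intro mult_left_mono Y_nonneg[OF y]) linarith
    then show "y j * \<bar>sdiff f (x j) (h j)\<bar> \<le> y j * \<bar>sdiff f (x j + h j) (k j)\<bar>
     + 2 * (y j * \<bar>sdiff f (x j + k j) (k j)\<bar>) + y j * \<bar>sdiff f (x j) (k j)\<bar>" by (simp add: algebra_simps)
  qed
  also have "\<dots> \<le> 4 ^ l * K + 2 * (4 ^ l * K) + 4 ^ l * K"
    unfolding sum.distrib sum_distrib_left[symmetric]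
    by (intro add_mono mult_left_mono Suc.IH k) auto
  finally show ?case by (simp add: algebra_simps)
qed

text \<open>The second difference is the sum of the Taylor remainders at x + h in the directions h
  and -h; the linear terms cancel.\<close>

lemma taylor_second_diff:
  fixes f :: "'a::real_inner \<Rightarrow> real"
  assumes "\<And>x h. \<bar>f (x + h) - f x - g x \<bullet> h\<bar> \<le> K * norm h powr \<beta>"
  shows "\<bar>sdiff f x h\<bar> \<le> 2 * K * norm h powr \<beta>"
proof -
  have "\<bar>f (x + h + h) - f (x + h) - g (x + h) \<bullet> h\<bar> \<le> K * norm h powr \<beta>" by (rule assms)
  moreover have "\<bar>f (x + h + - h) - f (x + h) - g (x + h) \<bullet> (- h)\<bar> \<le> K * norm (- h) powr \<beta>" by (rule assms)
  ultimately show ?thesis by (simp add: sdiff_def scaleR_2 add.assoc)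
qed

text \<open>The classical estimate \<open>\<Delta>\<^sup>2(f \<circ> \<Phi>) = \<Delta>\<^sup>2\<^sub>k f + O(\<bar>\<Delta>\<^sup>2\<Phi>\<bar>\<^sup>\<gamma>)\<close> with \<open>k = \<Delta>\<Phi>\<close>, where
  \<open>\<bar>\<Delta>\<^sup>2\<Phi>\<bar>\<^sup>\<gamma> = O(\<bar>h\<bar>\<^sup>\<gamma>\<^sup>+\<^sup>\<gamma>\<^sup>\<gamma>)\<close> because \<open>\<Phi>\<close> is of class \<open>C\<^sup>1\<^sup>,\<^sup>\<gamma>\<close>.\<close>

lemma comp_bound_0:
  fixes \<Phi> :: "'a::euclidean_space \<Rightarrow> 'a"
  assumes Lip: "\<And>x y. norm (\<Phi> x - \<Phi> y) \<le> 2 ^ l * norm (x - y)"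
    and sec: "\<And>x h. norm (\<Phi> (x + 2 *\<^sub>R h) - 2 *\<^sub>R \<Phi> (x + h) + \<Phi> x) \<le> E * norm h powr (1 + \<gamma>)"
  shows "comp_bound \<gamma> Y 0 (4 ^ l + E powr \<gamma> * S) \<Phi>"
  unfolding comp_bound_def
proof (intro allI impI)
  fix K and f :: "'a \<Rightarrow> real" assume f: "bb 0 K f"
  have K: "0 \<le> K" using bes_nonneg f by blast
  obtain b :: 'a where b: "b \<in> Basis" using nonempty_Basis by blast
  have E: "0 \<le> E" using order_trans[OF norm_ge_zero sec[of 0 b]] b by simp
  have l: "(1::real) \<le> 2 ^ l" "(2::real) ^ l \<le> 4 ^ l" by (auto intro: power_mono)
  let ?c = "4 ^ l + E powr \<gamma> * S"
  have c: "2 ^ l * K \<le> ?c * K" using K S_nonneg l by (intro mult_right_mono add_increasing2) auto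
  have H: "\<bar>f (\<Phi> x) - f (\<Phi> y)\<bar> \<le> 2 ^ l * K * norm (x - y) powr \<gamma>" for x y
  proof -
    have "\<bar>f (\<Phi> x) - f (\<Phi> y)\<bar> \<le> K * norm (\<Phi> x - \<Phi> y) powr \<gamma>" by (rule bes_holder[OF f])
    also have "\<dots> \<le> K * (2 ^ l * norm (x - y)) powr \<gamma>"
      using gamma_pos by (intro mult_left_mono powr_mono2 Lip K) auto
    also have "\<dots> = K * ((2 ^ l) powr \<gamma> * norm (x - y) powr \<gamma>)" by (simp add: powr_mult)
    also have "\<dots> \<le> K * ((2 ^ l) powr 1 * norm (x - y) powr \<gamma>)"
      using l by (intro mult_left_mono mult_right_mono powr_mono K gamma_le) auto
    finally show ?thesis by (simp add: algebra_simps)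
  qed
  have sdiff: "\<bar>sdiff (\<lambda>x. f (\<Phi> x)) x h\<bar> \<le> \<bar>sdiff f (\<Phi> x) (\<Phi> (x + h) - \<Phi> x)\<bar> + K * E powr \<gamma> * norm h powr (\<gamma> + \<gamma> * \<gamma>)" for x h
  proof -
    let ?k = "\<Phi> (x + h) - \<Phi> x" and ?e = "\<Phi> (x + 2 *\<^sub>R h) - 2 *\<^sub>R \<Phi> (x + h) + \<Phi> x"
    have "\<bar>f (\<Phi> (x + 2 *\<^sub>R h)) - f (\<Phi> x + 2 *\<^sub>R ?k)\<bar> \<le> K * norm (\<Phi> (x + 2 *\<^sub>R h) - (\<Phi> x + 2 *\<^sub>R ?k)) powr \<gamma>"
      by (rule bes_holder[OF f])
    also have "\<Phi> (x + 2 *\<^sub>R h) - (\<Phi> x + 2 *\<^sub>R ?k) = ?e" by (simp add: scaleR_2 algebra_simps)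
    also have "K * norm ?e powr \<gamma> \<le> K * (E * norm h powr (1 + \<gamma>)) powr \<gamma>"
      using gamma_pos by (intro mult_left_mono powr_mono2 sec K) auto
    also have "\<dots> = K * E powr \<gamma> * norm h powr (\<gamma> + \<gamma> * \<gamma>)"
      using E by (simp add: powr_mult powr_powr algebra_simps)
    finally show ?thesis unfolding sdiff_def by simp
  qed
  have "zyg_le Y (?c * K) (\<lambda>x. f (\<Phi> x))"
    unfolding zyg_le_def
  proof (intro ballI allI impI)
    fix y J and x h :: "nat \<Rightarrow> 'a" assume y: "y \<in> Y" and h: "\<forall>j<J. norm (h j) \<le> (1/2)^j"
    have "(\<Sum>j<J. y j * \<bar>sdiff (\<lambda>x. f (\<Phi> x)) (x j) (h j)\<bar>)
      \<le> (\<Sum>j<J. y j * (\<bar>sdiff f (\<Phi> (x j)) (\<Phi> (x j + h j) - \<Phi> (x j))\<bar> + K * E powr \<gamma> * norm (h j) powr (\<gamma> + \<gamma> * \<gamma>)))"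
      by (intro sum_mono mult_left_mono sdiff Y_nonneg[OF y])
    also have "\<dots> = (\<Sum>j<J. y j * \<bar>sdiff f (\<Phi> (x j)) (\<Phi> (x j + h j) - \<Phi> (x j))\<bar>)
       + K * E powr \<gamma> * (\<Sum>j<J. y j * norm (h j) powr (\<gamma> + \<gamma> * \<gamma>))"
      by (simp add: sum.distrib sum_distrib_left algebra_simps)
    also have "\<dots> \<le> 4 ^ l * K + K * E powr \<gamma> * S"
    proof (intro add_mono mult_left_mono zyg_le_dyadic[OF bes_zyg[OF f] y] sum_remainder_le[OF y])
      fix j assume j: "j < J"
      show "norm (\<Phi> (x j + h j) - \<Phi> (x j)) \<le> 2 ^ l * (1 / 2) ^ j"
        using Lip[of "x j + h j" "x j"] h j by (auto intro: order_trans)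
    qed (use h K gamma_pos in auto)
    finally show "(\<Sum>j<J. y j * \<bar>sdiff (\<lambda>x. f (\<Phi> x)) (x j) (h j)\<bar>) \<le> ?c * K" by (simp add: algebra_simps)
  qed
  moreover have "\<bar>f (\<Phi> x)\<bar> \<le> ?c * K" for x
    using c bes_bound[OF f, of "\<Phi> x"] l K mult_right_mono[OF l(1) K] by linarith
  moreover have "\<bar>f (\<Phi> x) - f (\<Phi> y)\<bar> \<le> ?c * K * norm (x - y) powr \<gamma>" for x y
    by (rule order_trans[OF H]) (use c in \<open>auto intro: mult_right_mono\<close>)
  ultimately show "bb 0 (?c * K) (\<lambda>x. f (\<Phi> x))" by auto
qed

text \<open>Each term of the chain rule is a product of one component of the gradient of f composed
  with \<Phi>, of norm c K at level n, and one component of the derivative of \<Phi>, of norm at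
  most 1 + Q. The constant c depends on lower orders only, so Q occurs to the first power.\<close>

lemma comp_bound_Suc:
  fixes \<Phi> :: "'a::euclidean_space \<Rightarrow> 'a"
  assumes n: "comp_bound \<gamma> Y n c \<Phi>" and 0: "comp_bound \<gamma> Y 0 c \<Phi>" and c: "0 \<le> c" and Q: "0 \<le> Q"
    and Lip: "\<And>x y. norm (\<Phi> x - \<Phi> y) \<le> L * norm (x - y)"
    and \<Phi>: "\<And>i. i \<in> Basis \<Longrightarrow> bb (Suc n) Q (\<lambda>x. (\<Phi> x - x) \<bullet> i)"
  shows "comp_bound \<gamma> Y (Suc n) ((mult_const TYPE('a) n * c * DIM('a) + c + L powr (1 + \<gamma>) + DIM('a)) * (1 + Q)) \<Phi>"
    (is "comp_bound _ _ _ (?C * (1 + Q)) _")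
  unfolding comp_bound_def
proof (intro allI impI)
  fix K and f :: "'a \<Rightarrow> real" assume f: "bb (Suc n) K f"
  have K: "0 \<le> K" using bes_nonneg f by blast
  have mc: "0 \<le> mult_const TYPE('a) n" by (rule mult_const_nonneg)
  obtain g where g: "\<And>x h. \<bar>f (x + h) - f x - g x \<bullet> h\<bar> \<le> K * norm h powr (1 + \<gamma>)"
    "\<And>i. i \<in> Basis \<Longrightarrow> bb n K (\<lambda>x. g x \<bullet> i)" using bes_SucE[OF f] by metis
  have "\<forall>i\<in>Basis. \<exists>p. (\<forall>x h. \<bar>(\<Phi> (x + h) - (x + h)) \<bullet> i - (\<Phi> x - x) \<bullet> i - p x \<bullet> h\<bar> \<le> Q * norm h powr (1 + \<gamma>)) \<and>
       (\<forall>j\<in>Basis. bb n Q (\<lambda>x. p x \<bullet> j))"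
    using bes_SucE[OF \<Phi>] by metis
  then obtain p where p: "\<And>i x h. i \<in> Basis \<Longrightarrow> \<bar>(\<Phi> (x + h) - (x + h)) \<bullet> i - (\<Phi> x - x) \<bullet> i - p i x \<bullet> h\<bar> \<le> Q * norm h powr (1 + \<gamma>)"
    "\<And>i j. i \<in> Basis \<Longrightarrow> j \<in> Basis \<Longrightarrow> bb n Q (\<lambda>x. p i x \<bullet> j)" unfolding bchoice_iff by metis
  \<comment> \<open>Chain rule: i + p i x is the gradient of the i-th component of \<Phi>, the
    summand i coming from the identity.\<close>
  define G where "G x = (\<Sum>i\<in>Basis. (g (\<Phi> x) \<bullet> i) *\<^sub>R (i + p i x))" for x
  show "bb (Suc n) (?C * (1 + Q) * K) (\<lambda>x. f (\<Phi> x))"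
  proof (rule bes_SucI)
    have "c \<le> ?C * (1 + Q)"
    proof -
      have "c * 1 \<le> ?C * (1 + Q)" using c Q mc by (intro mult_mono) auto
      then show ?thesis by simp
    qed
    then show "bb 0 (?C * (1 + Q) * K) (\<lambda>x. f (\<Phi> x))"
      by (intro bes_mono[OF comp_boundD[OF 0 bes_level0[OF f]]] mult_right_mono K)
  next
    fix x h
    have a: "\<bar>f (\<Phi> x + (\<Phi> (x + h) - \<Phi> x)) - f (\<Phi> x) - g (\<Phi> x) \<bullet> (\<Phi> (x + h) - \<Phi> x)\<bar>
      \<le> K * L powr (1 + \<gamma>) * norm h powr (1 + \<gamma>)"
    proof (rule order_trans[OF g(1)])
      have L: "norm (\<Phi> (x + h) - \<Phi> x) \<le> L * norm h" using Lip[of "x + h" x] by simp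
      have "norm (\<Phi> (x + h) - \<Phi> x) powr (1 + \<gamma>) \<le> (L * norm h) powr (1 + \<gamma>)"
        using gamma_pos L by (intro powr_mono2) auto
      also have "\<dots> = L powr (1 + \<gamma>) * norm h powr (1 + \<gamma>)"
      proof (cases "h = 0")
        case False
        have "L \<ge> 0" using order_trans[OF norm_ge_zero L] False by (auto simp: zero_le_mult_iff)
        then show ?thesis by (simp add: powr_mult)
      qed auto
      finally show "K * norm (\<Phi> (x + h) - \<Phi> x) powr (1 + \<gamma>) \<le> K * L powr (1 + \<gamma>) * norm h powr (1 + \<gamma>)"
        using K by (simp add: mult.assoc mult_left_mono)
    qed
    \<comment> \<open>The identity has no Taylor remainder, so only the remainders of the components
      of \<Phi> - id are left.\<close>
    have eq: "g (\<Phi> x) \<bullet> (\<Phi> (x + h) - \<Phi> x) - G x \<bullet> h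
       = (\<Sum>i\<in>Basis. (g (\<Phi> x) \<bullet> i) * ((\<Phi> (x + h) - (x + h)) \<bullet> i - (\<Phi> x - x) \<bullet> i - p i x \<bullet> h))"
      unfolding G_def inner_sum_left
      by (subst euclidean_inner) (simp add: sum_subtractf[symmetric] inner_diff_left inner_add_left algebra_simps inner_commute)
    have b: "\<bar>g (\<Phi> x) \<bullet> (\<Phi> (x + h) - \<Phi> x) - G x \<bullet> h\<bar> \<le> DIM('a) * (K * (Q * norm h powr (1 + \<gamma>)))"
      unfolding eq
      by (rule order_trans[OF sum_abs sum_bounded_above], unfold abs_mult)
        (intro mult_mono p bes_bound[OF g(2)] K, auto)
    have "\<bar>f (\<Phi> (x + h)) - f (\<Phi> x) - G x \<bullet> h\<bar>
      \<le> (L powr (1 + \<gamma>) + DIM('a) * Q) * (K * norm h powr (1 + \<gamma>))"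
      using a b by (simp add: algebra_simps)
    also have "\<dots> \<le> (?C * (1 + Q)) * (K * norm h powr (1 + \<gamma>))"
    proof (intro mult_right_mono)
      have "0 \<le> (mult_const TYPE('a) n * c * DIM('a) + c) * (1 + Q)" "0 \<le> L powr (1 + \<gamma>) * Q" 
        using c Q mc by auto
      then show "L powr (1 + \<gamma>) + DIM('a) * Q \<le> ?C * (1 + Q)"
        by (simp add: algebra_simps)
    qed (use K in auto)
    finally show "\<bar>f (\<Phi> (x + h)) - f (\<Phi> x) - G x \<bullet> h\<bar> \<le> ?C * (1 + Q) * K * norm h powr (1 + \<gamma>)"
      by (simp add: mult.assoc)
  next
    fix j :: 'a assume j: "j \<in> Basis"
    have "bb n (\<Sum>i\<in>(Basis::'a set). mult_const TYPE('a) n * (c * K) * (1 + Q))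
       (\<lambda>x. \<Sum>i\<in>Basis. (g (\<Phi> x) \<bullet> i) * (i \<bullet> j + p i x \<bullet> j))"
      by (intro bes_sum bes_mult bes_add comp_boundD[OF n g(2)] p bes_const)
        (use j in \<open>auto simp: inner_Basis\<close>)
    then have "bb n (mult_const TYPE('a) n * c * DIM('a) * ((1 + Q) * K)) (\<lambda>x. G x \<bullet> j)"
      by (simp add: G_def inner_sum_left inner_add_left algebra_simps)
    then show "bb n (?C * (1 + Q) * K) (\<lambda>x. G x \<bullet> j)"
      unfolding mult.assoc[of _ "1 + Q" K]
      by (rule bes_mono, intro mult_right_mono) (use c Q K in auto)
  qed
qed

text \<open>One constant serves the whole family, since the constant of
  \<open>comp_bound_Suc\<close> depends on a member only through L, Q and the constants of lower
  levels.\<close>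

lemma comp_bound_upto:
  fixes F :: "('a::euclidean_space \<Rightarrow> 'a) set" and c L Q :: real
  assumes c: "0 \<le> c" "\<And>\<Phi>. \<Phi> \<in> F \<Longrightarrow> comp_bound \<gamma> Y 0 c \<Phi>"
    and Lip: "\<And>\<Phi> x y. \<Phi> \<in> F \<Longrightarrow> norm (\<Phi> x - \<Phi> y) \<le> L * norm (x - y)"
    and Q: "\<And>\<Phi> i. \<Phi> \<in> F \<Longrightarrow> i \<in> Basis \<Longrightarrow> bb n Q (\<lambda>x. (\<Phi> x - x) \<bullet> i)"
  shows "\<exists>c'\<ge>0. \<forall>\<Phi>\<in>F. comp_bound \<gamma> Y n c' \<Phi>"
  using Q
proof (induction n)
  case 0 then show ?case using c by blast
next
  case (Suc n)
  then obtain c' where c': "0 \<le> c'" "\<And>\<Phi>. \<Phi> \<in> F \<Longrightarrow> comp_bound \<gamma> Y n c' \<Phi>"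
    using bes_Suc_imp by metis
  show ?case
  \<comment> \<open>Nonnegativity of Q is read off from a member of the family.\<close>
  proof (cases "F = {}")
    case False
    then have "0 \<le> Q" using Suc.prems bes_nonneg SOME_Basis by blast
    let ?m = "max c c'"
    have "comp_bound \<gamma> Y (Suc n) ((mult_const TYPE('a) n * ?m * DIM('a) + ?m + L powr (1 + \<gamma>) + DIM('a)) * (1 + Q)) \<Phi>"
      if "\<Phi> \<in> F" for \<Phi>
    proof (rule comp_bound_Suc)
      show "comp_bound \<gamma> Y n ?m \<Phi>" "comp_bound \<gamma> Y 0 ?m \<Phi>"
        by (rule comp_bound_mono, rule c' c, rule that, simp)+
    qed (use that c \<open>0 \<le> Q\<close> Lip Suc.prems in auto)
    moreover have "0 \<le> (mult_const TYPE('a) n * ?m * DIM('a) + ?m + L powr (1 + \<gamma>) + DIM('a)) * (1 + Q)"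
      using \<open>0 \<le> Q\<close> c mult_const_nonneg[of "TYPE('a)" n] by (intro mult_nonneg_nonneg add_nonneg_nonneg) auto
    ultimately show ?thesis by blast
  qed auto
qed

end

text \<open>For Y = {} only the sup and Hoelder bounds have to be transported, and L^\<gamma> is at
  most L because L is at least 1. No second difference of \<Phi> is involved, which is what breaks
  the circle between composition bounds and bounds on the iterates.\<close>

lemma comp_bound_0_lipschitz:
  fixes \<Phi> :: "'a::euclidean_space \<Rightarrow> 'a"
  assumes "0 < \<gamma>" "\<gamma> \<le> 1" and Lip: "\<And>x y. norm (\<Phi> x - \<Phi> y) \<le> L * norm (x - y)" and L: "1 \<le> L"
  shows "comp_bound \<gamma> {} 0 L \<Phi>"
  unfolding comp_bound_def
proof (intro allI impI)
  fix K and f :: "'a \<Rightarrow> real" assume f: "bes \<gamma> {} 0 K f"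
  have K: "0 \<le> K" using bes_nonneg f by blast
  have "\<bar>f (\<Phi> x) - f (\<Phi> y)\<bar> \<le> L * K * norm (x - y) powr \<gamma>" for x y
  proof -
    have "\<bar>f (\<Phi> x) - f (\<Phi> y)\<bar> \<le> K * norm (\<Phi> x - \<Phi> y) powr \<gamma>" by (rule bes_holder[OF f])
    also have "\<dots> \<le> K * (L * norm (x - y)) powr \<gamma>"
      using assms by (intro mult_left_mono powr_mono2 Lip K) auto
    also have "\<dots> = K * (L powr \<gamma> * norm (x - y) powr \<gamma>)" using L by (simp add: powr_mult)
    also have "\<dots> \<le> K * (L powr 1 * norm (x - y) powr \<gamma>)"
      using L assms by (intro mult_left_mono mult_right_mono powr_mono K) auto
    finally show ?thesis using L by (simp add: algebra_simps)
  qed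
  moreover have "\<bar>f (\<Phi> x)\<bar> \<le> L * K" for x
    using bes_bound[OF f, of "\<Phi> x"] mult_right_mono[OF L K] by linarith
  ultimately show "bes \<gamma> {} 0 (L * K) (\<lambda>x. f (\<Phi> x))" by (auto simp: zyg_le_def)
qed

section \<open>Integrals over subintervals of the unit interval\<close>

abbreviation \<mu> :: "real measure" where "\<mu> \<equiv> lebesgue_on {0..1}"

lemma sets_unit_interval [simp]:
  "0 \<le> a \<Longrightarrow> b \<le> 1 \<Longrightarrow> {a..b} \<in> sets \<mu>" "0 \<le> a \<Longrightarrow> b \<le> 1 \<Longrightarrow> {a<..b} \<in> sets \<mu>"
  by (auto simp: sets_restrict_space_iff)

lemma integrable_on_subinterval_unit:
  fixes F :: "real \<Rightarrow> 'b::{banach, second_countable_topology}"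
  assumes "integrable \<mu> F" "0 \<le> a" "b \<le> 1"
  shows "integrable \<mu> (\<lambda>s. indicator {a..b} s *\<^sub>R F s)" "integrable \<mu> (\<lambda>s. indicator {a<..b} s *\<^sub>R F s)"
  using assms by (auto intro: integrable_mult_indicator)

lemma integrable_real_on_subinterval_unit:
  fixes F :: "real \<Rightarrow> real"
  assumes "integrable \<mu> F" "0 \<le> a" "b \<le> 1"
  shows "integrable \<mu> (\<lambda>s. indicator {a..b} s * F s)" "integrable \<mu> (\<lambda>s. indicator {a<..b} s * F s)"
  using integrable_on_subinterval_unit[OF assms] by simp_all

lemma finite_measure_unit: "finite_measure \<mu>"
  by (rule finite_measureI) (simp add: emeasure_restrict_space)

text \<open>Absolute continuity of the integral: f is split into its truncation at height k and an
  excess of integral below e / 2.\<close>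

lemma (in finite_measure) integral_small_sets:
  fixes f :: "'a \<Rightarrow> real"
  assumes f: "integrable M f" "\<And>x. x \<in> space M \<Longrightarrow> 0 \<le> f x" and e: "0 < e"
  obtains d where "0 < d" "\<And>A. A \<in> sets M \<Longrightarrow> measure M A < d \<Longrightarrow> (\<integral>x. indicator A x * f x \<partial>M) < e"
proof -
  have "(\<lambda>k. \<integral>x. f x - min (f x) (real k) \<partial>M) \<longlonglongrightarrow> (\<integral>x. 0 \<partial>M)"
  proof (rule integral_dominated_convergence[where w = f])
    show "AE x in M. (\<lambda>k. f x - min (f x) (real k)) \<longlonglongrightarrow> 0"
    proof (rule AE_I2)
      fix x
      have "\<forall>\<^sub>F k in sequentially. f x - min (f x) (real k) = 0"
        using eventually_ge_at_top[of "nat \<lceil>f x\<rceil>"]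
        by eventually_elim (simp add: min_absorb1 nat_ceiling_le_eq)
      then show "(\<lambda>k. f x - min (f x) (real k)) \<longlonglongrightarrow> 0" by (rule tendsto_eventually)
    qed
  qed (use f in \<open>auto intro!: AE_I2\<close>)
  then have "\<forall>\<^sub>F k in sequentially. (\<integral>x. f x - min (f x) (real k) \<partial>M) < e / 2"
    using e by (intro order_tendstoD(2)[of _ 0]) auto
  then obtain k where k: "(\<integral>x. f x - min (f x) (real k) \<partial>M) < e / 2"
    by (auto simp: eventually_sequentially)
  have int: "integrable M (\<lambda>x. min (f x) (real k))"
    using f by (intro Bochner_Integration.integrable_bound[OF f(1)]) (auto intro!: AE_I2)
  show thesis
  proof (rule that)
    \<comment> \<open>The truncated part costs at most k times the measure; k + 1 avoids division by
      zero.\<close>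
    show "0 < e / (2 * (real k + 1))" using e by simp
  next
    fix A assume A: "A \<in> sets M" "measure M A < e / (2 * (real k + 1))"
    have i1: "integrable M (\<lambda>x. f x - min (f x) (real k))" using f(1) int by simp
    have i2: "integrable M (\<lambda>x. indicator A x * real k)"
      using A by (intro integrable_mult_left integrable_real_indicator) (auto simp: emeasure_eq_measure)
    have "(\<integral>x. indicator A x * f x \<partial>M) \<le> (\<integral>x. (f x - min (f x) (real k)) + indicator A x * real k \<partial>M)"
    proof (rule integral_mono)
      show "integrable M (\<lambda>x. indicator A x * f x)"
        using integrable_mult_indicator[OF A(1) f(1)] by simp
      show "integrable M (\<lambda>x. f x - min (f x) (real k) + indicator A x * real k)"
        using i1 i2 by (rule Bochner_Integration.integrable_add)
    qed (use f in \<open>auto simp: indicator_def min_def\<close>)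
    also have "\<dots> = (\<integral>x. f x - min (f x) (real k) \<partial>M) + (\<integral>x. indicator A x * real k \<partial>M)"
      using i1 i2 by (rule Bochner_Integration.integral_add)
    also have "(\<integral>x. indicator A x * real k \<partial>M) = measure M A * real k"
      using A by simp
    also have "(\<integral>x. f x - min (f x) (real k) \<partial>M) + measure M A * real k < e"
    proof -
      have "measure M A * real k \<le> measure M A * (real k + 1)" by (intro mult_left_mono) auto
      also have "\<dots> < e / 2" using A(2) by (simp add: field_simps)
      finally show ?thesis using k by linarith
    qed
    finally show "(\<integral>x. indicator A x * f x \<partial>M) < e" .
  qed
qed

text \<open>The integral from 0 to t, written with an indicator over the fixed measure
  \<open>\<mu>\<close>, so that integrands for different t live on one measure space.\<close>

definition upto_int :: "(real \<Rightarrow> 'b::{banach, second_countable_topology}) \<Rightarrow> real \<Rightarrow> 'b" where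
  "upto_int F t = (\<integral>s. indicator {0..t} s *\<^sub>R F s \<partial>\<mu>)"

lemma upto_int_diff:
  assumes "integrable \<mu> F" "0 \<le> r" "r \<le> t" "t \<le> 1"
  shows "upto_int F t - upto_int F r = (\<integral>s. indicator {r<..t} s *\<^sub>R F s \<partial>\<mu>)"
proof -
  have "upto_int F t - upto_int F r = (\<integral>s. indicator {0..t} s *\<^sub>R F s - indicator {0..r} s *\<^sub>R F s \<partial>\<mu>)"
    unfolding upto_int_def using integrable_on_subinterval_unit[OF assms(1)] assms
    by (intro Bochner_Integration.integral_diff[symmetric]) auto
  also have "\<dots> = (\<integral>s. indicator {r<..t} s *\<^sub>R F s \<partial>\<mu>)"
    using assms by (intro Bochner_Integration.integral_cong) (auto simp: indicator_def)
  finally show ?thesis .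
qed


lemma upto_int_0:
  assumes "integrable \<mu> F"
  shows "upto_int F 0 = 0"
proof -
  have "upto_int F 0 = (\<integral>s. 0 \<partial>\<mu>)"
    unfolding upto_int_def
  proof (rule integral_cong_AE)
    have "AE s in lebesgue. s \<noteq> (0::real)"
      by (rule AE_completion[OF AE_lborel_singleton])
    then show "AE s in \<mu>. indicator {0..0} s *\<^sub>R F s = 0"
      by (subst AE_restrict_space_iff) (auto simp: indicator_def elim!: eventually_mono)
  qed (use borel_measurable_integrable[OF integrable_on_subinterval_unit(1)[OF assms, of 0 0]] in auto)
  then show ?thesis by simp
qed

lemma norm_upto_int_le:
  fixes F :: "real \<Rightarrow> 'b::{banach, second_countable_topology}"
  assumes "integrable \<mu> F" "integrable \<mu> l" "\<And>s. s \<in> {0..1} \<Longrightarrow> norm (F s) \<le> l s" "0 \<le> t" "t \<le> 1"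
  shows "norm (upto_int F t) \<le> upto_int l t"
  unfolding upto_int_def
  by (rule order_trans[OF integral_norm_bound integral_mono])
    (use assms in \<open>auto intro!: integrable_norm integrable_real_on_subinterval_unit mult_left_mono\<close>)

lemma upto_int_mono_time:
  fixes F :: "real \<Rightarrow> real"
  assumes "integrable \<mu> F" "\<And>s. s \<in> {0..1} \<Longrightarrow> 0 \<le> F s" "0 \<le> r" "r \<le> t" "t \<le> 1"
  shows "upto_int F r \<le> upto_int F t"
  unfolding upto_int_def
  by (rule integral_mono)
    (use assms in \<open>auto intro!: integrable_real_on_subinterval_unit mult_right_mono split: split_indicator\<close>)

lemma continuous_upto_int:
  fixes F :: "real \<Rightarrow> 'b::{banach, second_countable_topology}"
  assumes F: "integrable \<mu> F"
  shows "uniformly_continuous_on {0..1} (upto_int F)"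
proof -
  interpret finite_measure \<mu> by (rule finite_measure_unit)
  have main: "\<exists>d>0. \<forall>r t. 0 \<le> r \<and> r \<le> t \<and> t \<le> 1 \<and> t - r < d \<longrightarrow> norm (upto_int F t - upto_int F r) < e" if e: "0 < e" for e
  proof -
    obtain d where d: "0 < d" "\<And>A. A \<in> sets \<mu> \<Longrightarrow> measure \<mu> A < d \<Longrightarrow> (\<integral>x. indicator A x * norm (F x) \<partial>\<mu>) < e"
      using integral_small_sets[OF integrable_norm[OF F] _ e] by auto
    have "norm (upto_int F t - upto_int F r) < e" if "0 \<le> r" "r \<le> t" "t \<le> 1" "t - r < d" for r t
    proof -
      have "norm (upto_int F t - upto_int F r) \<le> (\<integral>s. norm (indicator {r<..t} s *\<^sub>R F s) \<partial>\<mu>)"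
        unfolding upto_int_diff[OF F that(1-3)] by (rule integral_norm_bound)
      also have "\<dots> = (\<integral>s. indicator {r<..t} s * norm (F s) \<partial>\<mu>)" by simp
      also have "\<dots> < e"
        using that by (intro d(2)) (auto simp: measure_restrict_space Int_absorb1 subset_iff)
      finally show ?thesis .
    qed
    then show ?thesis using d(1) by blast
  qed
  show ?thesis
    unfolding uniformly_continuous_on_def
  proof (intro allI impI)
    fix e :: real assume "0 < e"
    then obtain d where d: "d > 0" "\<forall>r t. 0 \<le> r \<and> r \<le> t \<and> t \<le> 1 \<and> t - r < d \<longrightarrow> norm (upto_int F t - upto_int F r) < e"
      using main by blast
    have "dist (upto_int F t) (upto_int F r) < e" if "r \<in> {0..1}" "t \<in> {0..1}" "dist t r < d" for r t
    proof (cases "r \<le> t")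
      case True then show ?thesis using d(2) that by (auto simp: dist_norm)
    next
      case False then show ?thesis using d(2)[rule_format, of t r] that by (auto simp: dist_norm norm_minus_commute)
    qed
    then show "\<exists>d>0. \<forall>x\<in>{0..1}. \<forall>x'\<in>{0..1}. dist x' x < d \<longrightarrow> dist (upto_int F x') (upto_int F x) < e"
      using d(1) by blast
  qed
qed

lemma measurable_upto_int:
  fixes F :: "real \<Rightarrow> 'b::euclidean_space"
  assumes "integrable \<mu> F"
  shows "upto_int F \<in> borel_measurable \<mu>"
  by (rule continuous_imp_measurable_on_sets_lebesgue)
    (use continuous_upto_int[OF assms] in \<open>auto intro: uniformly_continuous_imp_continuous\<close>)

text \<open>A substitute for the exponential weight \<open>exp (\<integral>\<^sub>0\<^sup>t m)\<close> of Bielecki: on a mesh so fine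
  that \<open>m\<close> has mass at most \<open>1/2\<close> on each cell, let the weight double from one cell to the next.\<close>

lemma bielecki_weight:
  fixes m :: "real \<Rightarrow> real"
  assumes m: "integrable \<mu> m" "\<And>s. s \<in> {0..1} \<Longrightarrow> 0 \<le> m s"
  obtains w W where "w \<in> borel_measurable \<mu>" "\<And>t. t \<in> {0..1} \<Longrightarrow> 1 \<le> w t" "\<And>t. t \<in> {0..1} \<Longrightarrow> w t \<le> W"
    "\<And>t. t \<in> {0..1} \<Longrightarrow> upto_int (\<lambda>s. m s * w s) t \<le> w t - 1"
proof -
  obtain d where d: "0 < d" "\<And>r t. r \<in> {0..1} \<Longrightarrow> t \<in> {0..1} \<Longrightarrow> dist r t < d \<Longrightarrow> dist (upto_int m r) (upto_int m t) < 1/2"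
    using continuous_upto_int[OF m(1)] unfolding uniformly_continuous_on_def by (metis half_gt_zero_iff zero_less_one)
  obtain k where k: "inverse (real (Suc k)) < d" using reals_Archimedean[OF d(1)] by blast
  define N where "N = Suc k"
  have N: "N > 0" "1 / real N < d" using k unfolding N_def inverse_eq_divide by simp_all
  define w :: "real \<Rightarrow> real" where "w t = 2 ^ nat \<lceil>real N * t\<rceil>" for t :: real
  have "mono w" unfolding w_def
    by (intro monoI power_increasing nat_mono ceiling_mono mult_left_mono) auto
  then have w_meas: "w \<in> borel_measurable \<mu>"
    by (intro measurable_restrict_space1 measurable_completion) (auto intro: borel_measurable_mono)
  have W: "w t \<le> 2 ^ N" if "t \<in> {0..1}" for t
  proof -
    have "real N * t \<le> real N * 1" using that by (intro mult_left_mono) auto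
    then show ?thesis unfolding w_def by (intro power_increasing) (auto simp: ceiling_le_iff nat_le_iff)
  qed
  have int: "integrable \<mu> (\<lambda>s. m s * w s)"
  proof (rule Bochner_Integration.integrable_bound)
    show "integrable \<mu> (\<lambda>s. m s * 2 ^ N)" using m(1) by simp
    show "(\<lambda>s. m s * w s) \<in> borel_measurable \<mu>" using m(1) w_meas by measurable
    show "AE s in \<mu>. norm (m s * w s) \<le> norm (m s * 2 ^ N)"
      using W by (intro AE_I2) (auto simp: abs_mult w_def intro!: mult_left_mono)
  qed
  have key: "upto_int (\<lambda>s. m s * w s) t \<le> w t - 1" if "t \<in> {0..1}" "nat \<lceil>real N * t\<rceil> = j" for t j
    using that
  proof (induction j arbitrary: t)
    case 0
    then have "real N * t \<le> 0" by simp
    then have "t = 0" using 0 N by (auto simp: mult_le_0_iff)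
    then show ?case using upto_int_0[OF int] by (simp add: w_def)
  next
    case (Suc j)
    \<comment> \<open>The cells are half open on the left: t lies in (j / N, (j + 1) / N], and r is
      the left end, which belongs to the preceding cell and has half the weight.\<close>
    define r where "r = real j / real N"
    have c: "\<lceil>real N * t\<rceil> = int j + 1" using Suc.prems by linarith
    then have "real j < real N * t" "real N * t \<le> real j + 1" by linarith+
    moreover have "real N * t \<le> real N * 1" using Suc.prems by (intro mult_left_mono) auto
    moreover from calculation have "j < N" by linarith
    moreover have "t \<le> (real j + 1) / real N" "real j / real N < t"
      using calculation N by (simp_all add: field_simps)
    ultimately have r: "r \<in> {0..1}" "r \<le> t" "t - r \<le> 1 / real N" "nat \<lceil>real N * r\<rceil> = j"
      using N by (auto simp: r_def add_divide_distrib)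
    have wr: "w r = 2 ^ j" "w t = 2 * 2 ^ j" using Suc.prems(2) r(4) by (auto simp: w_def)
    have "upto_int (\<lambda>s. m s * w s) t - upto_int (\<lambda>s. m s * w s) r = (\<integral>s. indicator {r<..t} s *\<^sub>R (m s * w s) \<partial>\<mu>)"
      by (rule upto_int_diff) (use int r Suc.prems in auto)
    also have "\<dots> \<le> (\<integral>s. (indicator {r<..t} s *\<^sub>R m s) * w t \<partial>\<mu>)"
    proof (rule integral_mono)
      show "indicator {r<..t} s *\<^sub>R (m s * w s) \<le> (indicator {r<..t} s *\<^sub>R m s) * w t" if "s \<in> space \<mu>" for s
        using \<open>mono w\<close> m(2) that by (auto simp: indicator_def mono_def mult_left_mono)
    qed (use int m r Suc.prems in \<open>auto intro!: integrable_on_subinterval_unit integrable_mult_left simp del: real_scaleR_def\<close>)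
    also have "\<dots> = (upto_int m t - upto_int m r) * w t"
      using m r Suc.prems by (subst upto_int_diff) auto
    \<comment> \<open>Half of \<open>w t\<close> equals \<open>w r\<close>. Added to the bound
      \<open>w r - 1\<close> from the induction hypothesis this gives exactly
      \<open>w t - 1\<close>.\<close>
    also have "\<dots> \<le> 1/2 * w t"
    proof (rule mult_right_mono)
      have "dist (upto_int m t) (upto_int m r) < 1/2"
        using r Suc.prems N by (intro d(2)) (auto simp: dist_real_def)
      then show "upto_int m t - upto_int m r \<le> 1/2" unfolding dist_real_def by linarith
    qed (simp add: w_def)
    finally show ?case using Suc.IH[OF r(1,4)] wr by simp
  qed
  show thesis by (rule that[OF w_meas _ W key]) (auto simp: w_def)
qed

text \<open>Along a simple function with finitely many values the composition is glued from the
  measurable sections u s x. Continuity in the second variable carries this over to the limit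
  g.\<close>

lemma measurable_caratheodory:
  fixes u :: "'s \<Rightarrow> 'a::{metric_space, second_countable_topology} \<Rightarrow> 'b::metric_space"
  assumes u: "\<And>x. (\<lambda>s. u s x) \<in> borel_measurable M" and cont: "\<And>s. s \<in> space M \<Longrightarrow> continuous_on UNIV (u s)"
    and g: "g \<in> borel_measurable M"
  shows "(\<lambda>s. u s (g s)) \<in> borel_measurable M"
proof -
  obtain F where F: "\<And>i. simple_function M (F i)" "\<And>x. x \<in> space M \<Longrightarrow> (\<lambda>i. F i x) \<longlonglongrightarrow> g x"
    using borel_measurable_implies_sequence_metric[OF g, of undefined] by metis
  have "(\<lambda>s. u s (F i s)) \<in> borel_measurable M" for i
  proof (rule measurable_compose_countable'[where I = "F i ` space M"])
    show "F i \<in> measurable M (count_space (F i ` space M))"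
      using F(1)[of i] by (auto simp: simple_function_def measurable_count_space_eq2)
    show "countable (F i ` space M)" using F(1)[of i] by (auto simp: simple_function_def countable_finite)
  qed (rule u)
  then show ?thesis
  proof (rule borel_measurable_LIMSEQ_metric)
    fix s assume s: "s \<in> space M"
    show "(\<lambda>i. u s (F i s)) \<longlonglongrightarrow> u s (g s)"
      by (rule continuous_on_tendsto_compose[OF cont[OF s] F(2)[OF s]]) auto
  qed
qed

section \<open>Picard iteration\<close>

primrec picard :: "(real \<Rightarrow> 'a::euclidean_space \<Rightarrow> 'a) \<Rightarrow> nat \<Rightarrow> 'a \<Rightarrow> real \<Rightarrow> 'a" where
  "picard u 0 x = (\<lambda>t. x)"
| "picard u (Suc k) x = (\<lambda>t. x + upto_int (\<lambda>s. u s (picard u k x s)) t)"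

section \<open>Global Caratheodory theory under an integrable Lipschitz bound\<close>

lemma convergent_geometric_increments:
  fixes f :: "nat \<Rightarrow> 'a::banach"
  assumes "\<And>k. norm (f (Suc k) - f k) \<le> C * (1/2) ^ k"
  shows "convergent f"
proof -
  have "summable (\<lambda>k. f (Suc k) - f k)"
    by (rule summable_comparison_test'[of "\<lambda>k. C * (1/2) ^ k"]) (use assms in \<open>auto intro: summable_mult\<close>)
  then have "convergent (\<lambda>n. f 0 + (\<Sum>k<n. f (Suc k) - f k))"
    unfolding summable_iff_convergent by (intro convergent_add convergent_const)
  then show ?thesis by (simp add: sum_lessThan_telescope)
qed

locale lipschitz_field =
  fixes u :: "real \<Rightarrow> 'a::euclidean_space \<Rightarrow> 'a" and l :: "real \<Rightarrow> real"
  assumes u_meas: "\<And>x. (\<lambda>s. u s x) \<in> borel_measurable \<mu>"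
    and l_int: "integrable \<mu> l"
    and u_bound: "\<And>s x. s \<in> {0..1} \<Longrightarrow> norm (u s x) \<le> l s"
    and u_lip: "\<And>s x y. s \<in> {0..1} \<Longrightarrow> norm (u s x - u s y) \<le> l s * norm (x - y)"
begin

lemma l_nonneg: "s \<in> {0..1} \<Longrightarrow> 0 \<le> l s"
  using u_bound norm_ge_zero order_trans by blast

lemma u_continuous: "s \<in> {0..1} \<Longrightarrow> continuous_on UNIV (u s)"
  by (rule lipschitz_on_continuous_on[of "l s"])
    (auto simp: lipschitz_on_def dist_norm l_nonneg u_lip)

lemma integrable_along:
  assumes "g \<in> borel_measurable \<mu>"
  shows "integrable \<mu> (\<lambda>s. u s (g s))"
  by (rule Bochner_Integration.integrable_bound[OF l_int measurable_caratheodory[OF u_meas _ assms]])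
    (use u_continuous u_bound in \<open>auto intro!: AE_I2 intro: order_trans[OF _ abs_ge_self]\<close>)

lemma picard_measurable: "picard u k x \<in> borel_measurable \<mu>"
proof (induction k)
  case (Suc k)
  show ?case using measurable_upto_int[OF integrable_along[OF Suc]] by simp
qed simp

lemma picard_integrable: "integrable \<mu> (\<lambda>s. u s (picard u k x s))"
  by (rule integrable_along[OF picard_measurable])

text \<open>The common estimate behind convergence, Lipschitz dependence on the starting point and
  uniqueness: a distance below B w is replaced by B times the integral of l w.\<close>

lemma norm_upto_int_diff_le:
  assumes "integrable \<mu> (\<lambda>s. u s (g s))" "integrable \<mu> (\<lambda>s. u s (h s))" and w: "integrable \<mu> (\<lambda>s. l s * w s)"
    and le: "\<And>s. s \<in> {0..1} \<Longrightarrow> norm (g s - h s) \<le> B * w s" and t: "t \<in> {0..1}"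
  shows "norm (upto_int (\<lambda>s. u s (g s)) t - upto_int (\<lambda>s. u s (h s)) t) \<le> B * upto_int (\<lambda>s. l s * w s) t"
proof -
  have "upto_int (\<lambda>s. u s (g s)) t - upto_int (\<lambda>s. u s (h s)) t = upto_int (\<lambda>s. u s (g s) - u s (h s)) t"
    unfolding upto_int_def scaleR_diff_right
    by (rule Bochner_Integration.integral_diff[symmetric]) (use assms in \<open>auto intro: integrable_on_subinterval_unit\<close>)
  also have "norm \<dots> \<le> upto_int (\<lambda>s. B * (l s * w s)) t"
  proof (rule norm_upto_int_le)
    fix s :: real assume s: "s \<in> {0..1}"
    have "norm (u s (g s) - u s (h s)) \<le> l s * (B * w s)"
      by (rule order_trans[OF u_lip[OF s] mult_left_mono[OF le[OF s] l_nonneg[OF s]]])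
    then show "norm (u s (g s) - u s (h s)) \<le> B * (l s * w s)" by (simp add: algebra_simps)
  qed (use assms in auto)
  also have "\<dots> = B * upto_int (\<lambda>s. l s * w s) t"
    by (simp add: upto_int_def mult.left_commute)
  finally show ?thesis .
qed

text \<open>The last condition makes the Picard map a contraction with factor 1/2 in the norm sup |g
  t| / w t on the entire unit interval. The term -1 leaves room for a displacement of the starting
  point.\<close>

definition is_weight :: "(real \<Rightarrow> real) \<Rightarrow> real \<Rightarrow> bool" where
  "is_weight w W \<longleftrightarrow> integrable \<mu> (\<lambda>s. l s * w s) \<and>
    (\<forall>t\<in>{0..1}. 1 \<le> w t \<and> w t \<le> W \<and> upto_int (\<lambda>s. l s * w s) t \<le> (w t - 1) / 2)"

lemma is_weight_exists: "\<exists>w W. is_weight w W"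
proof -
  obtain w W where w: "w \<in> borel_measurable \<mu>" "\<And>t. t \<in> {0..1} \<Longrightarrow> 1 \<le> w t" "\<And>t. t \<in> {0..1} \<Longrightarrow> w t \<le> W"
    "\<And>t. t \<in> {0..1} \<Longrightarrow> upto_int (\<lambda>s. 2 * l s * w s) t \<le> w t - 1"
    using bielecki_weight[of "\<lambda>s. 2 * l s"] l_int l_nonneg by auto
  have int: "integrable \<mu> (\<lambda>s. l s * w s)"
  proof (rule Bochner_Integration.integrable_bound)
    show "integrable \<mu> (\<lambda>s. l s * W)" using l_int by simp
    show "(\<lambda>s. l s * w s) \<in> borel_measurable \<mu>" using l_int w by measurable
    show "AE s in \<mu>. norm (l s * w s) \<le> norm (l s * W)"
      using w(2,3) by (intro AE_I2) (force simp: abs_mult intro!: mult_left_mono)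
  qed
  have "upto_int (\<lambda>s. 2 * l s * w s) t = 2 * upto_int (\<lambda>s. l s * w s) t" for t
    by (simp add: upto_int_def mult.assoc mult.left_commute[of _ 2])
  then have "upto_int (\<lambda>s. l s * w s) t \<le> (w t - 1) / 2" if "t \<in> {0..1}" for t
    using w(4)[OF that] by simp
  then show ?thesis using w(2,3) int unfolding is_weight_def by blast
qed

text \<open>The bound \<open>norm (x - y) * w t\<close> reproduces itself under iteration: the
  starting points contribute \<open>norm (x - y)\<close> and the integral at most
  \<open>norm (x - y) * (w t - 1)\<close>. Hence L does not depend on k.\<close>

lemma picard_lipschitz:
  obtains L where "1 \<le> L" "\<And>k t x y. t \<in> {0..1} \<Longrightarrow> norm (picard u k x t - picard u k y t) \<le> L * norm (x - y)"
proof -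
  obtain w W where "is_weight w W" using is_weight_exists by blast
  then have w: "\<And>t. t \<in> {0..1} \<Longrightarrow> 1 \<le> w t" "\<And>t. t \<in> {0..1} \<Longrightarrow> w t \<le> W"
    "integrable \<mu> (\<lambda>s. l s * w s)" "\<And>t. t \<in> {0..1} \<Longrightarrow> upto_int (\<lambda>s. l s * w s) t \<le> (w t - 1) / 2"
    by (auto simp: is_weight_def)
  have W: "1 \<le> W" using w(1,2)[of 0] by simp
  have main: "norm (picard u k x t - picard u k y t) \<le> norm (x - y) * w t" if "t \<in> {0..1}" for k x y t
    using that
  proof (induction k arbitrary: t)
    case 0 then show ?case using w(1)[OF 0] by (simp add: mult_le_cancel_left1)
  next
    case (Suc k)
    have "norm (upto_int (\<lambda>s. u s (picard u k x s)) t - upto_int (\<lambda>s. u s (picard u k y s)) t)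
       \<le> norm (x - y) * upto_int (\<lambda>s. l s * w s) t"
      by (rule norm_upto_int_diff_le[OF picard_integrable picard_integrable w(3) Suc.IH Suc.prems])
    also have "\<dots> \<le> norm (x - y) * (w t - 1)"
      using w(1,4)[OF Suc.prems] by (intro mult_left_mono) auto
    finally have "norm (upto_int (\<lambda>s. u s (picard u k x s)) t - upto_int (\<lambda>s. u s (picard u k y s)) t)
       \<le> norm (x - y) * w t - norm (x - y)" by (simp add: algebra_simps)
    then show ?case
      using norm_triangle_ineq[of "x - y" "upto_int (\<lambda>s. u s (picard u k x s)) t - upto_int (\<lambda>s. u s (picard u k y s)) t"]
      by (simp add: algebra_simps)
  qed
  show thesis
  proof (rule that[OF W])
    fix k t x y assume t: "t \<in> {0..1::real}"
    show "norm (picard u k x t - picard u k y t) \<le> W * norm (x - y)"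
      using order_trans[OF main[OF t] mult_left_mono[OF w(2)[OF t] norm_ge_zero]] by (simp add: mult.commute)
  qed
qed

definition solution :: "real \<Rightarrow> 'a \<Rightarrow> 'a" where
  "solution t x = lim (\<lambda>k. picard u k x t)"

text \<open>The first increment is at most A, the full integral of l, and each iteration halves the
  weighted bound; the increments are thus summable.\<close>

lemma picard_tendsto:
  assumes "t \<in> {0..1}"
  shows "(\<lambda>k. picard u k x t) \<longlonglongrightarrow> solution t x"
proof -
  obtain w W where "is_weight w W" using is_weight_exists by blast
  then have w: "\<And>t. t \<in> {0..1} \<Longrightarrow> 1 \<le> w t" "\<And>t. t \<in> {0..1} \<Longrightarrow> w t \<le> W"
    "integrable \<mu> (\<lambda>s. l s * w s)" "\<And>t. t \<in> {0..1} \<Longrightarrow> upto_int (\<lambda>s. l s * w s) t \<le> (w t - 1) / 2"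
    by (auto simp: is_weight_def)
  define A where "A = upto_int l 1"
  have A: "norm (upto_int (\<lambda>s. u s x) t) \<le> A" if "t \<in> {0..1}" for t
  proof -
    have "norm (upto_int (\<lambda>s. u s x) t) \<le> upto_int l t"
      using that l_int u_bound by (intro norm_upto_int_le integrable_along) auto
    also have "\<dots> \<le> A"
      unfolding A_def using that l_int l_nonneg by (intro upto_int_mono_time) auto
    finally show ?thesis .
  qed
  have A0: "0 \<le> A" using order_trans[OF norm_ge_zero A[OF assms]] .
  have main: "norm (picard u (Suc k) x t - picard u k x t) \<le> (A * (1/2) ^ k) * w t" if "t \<in> {0..1}" for k t
    using that
  proof (induction k arbitrary: t)
    case 0
    have "A * 1 \<le> A * w t" using w(1)[OF 0] A0 by (intro mult_left_mono) auto
    then show ?case using A[OF 0] by simp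
  next
    case (Suc k)
    have "picard u (Suc (Suc k)) x t - picard u (Suc k) x t
      = upto_int (\<lambda>s. u s (picard u (Suc k) x s)) t - upto_int (\<lambda>s. u s (picard u k x s)) t" by simp
    also have "norm \<dots> \<le> (A * (1/2) ^ k) * upto_int (\<lambda>s. l s * w s) t"
      by (rule norm_upto_int_diff_le[OF picard_integrable picard_integrable w(3) Suc.IH Suc.prems])
    also have "\<dots> \<le> (A * (1/2) ^ k) * (w t / 2)"
      using w(4)[OF Suc.prems] A0 by (intro mult_left_mono) auto
    finally show ?case by simp
  qed
  have "norm (picard u (Suc k) x t - picard u k x t) \<le> (A * w t) * (1/2) ^ k" for k
    using main[OF assms, of k] by (simp add: mult.commute mult.left_commute)
  then have "convergent (\<lambda>k. picard u k x t)" by (rule convergent_geometric_increments)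
  then show ?thesis by (simp add: solution_def convergent_LIMSEQ_iff)
qed

lemma solution_measurable: "(\<lambda>t. solution t x) \<in> borel_measurable \<mu>"
  by (rule borel_measurable_LIMSEQ_metric[OF picard_measurable]) (auto intro: picard_tendsto)

lemma solution_integrable: "integrable \<mu> (\<lambda>s. u s (solution s x))"
  by (rule integrable_along[OF solution_measurable])

text \<open>Dominated convergence with majorant l passes to the limit in the recursion.\<close>

lemma solution_eq:
  assumes t: "t \<in> {0..1}"
  shows "solution t x = x + upto_int (\<lambda>s. u s (solution s x)) t"
proof -
  have "(\<lambda>k. upto_int (\<lambda>s. u s (picard u k x s)) t) \<longlonglongrightarrow> upto_int (\<lambda>s. u s (solution s x)) t"
    unfolding upto_int_def
  proof (rule integral_dominated_convergence[where w = l])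
    show "AE s in \<mu>. (\<lambda>k. indicator {0..t} s *\<^sub>R u s (picard u k x s)) \<longlonglongrightarrow> indicator {0..t} s *\<^sub>R u s (solution s x)"
    proof (intro AE_I2 tendsto_scaleR tendsto_const)
      fix s assume "s \<in> space \<mu>"
      then have s: "s \<in> {0..1}" by simp
      show "(\<lambda>k. u s (picard u k x s)) \<longlonglongrightarrow> u s (solution s x)"
        by (rule continuous_on_tendsto_compose[OF u_continuous[OF s] picard_tendsto[OF s]]) auto
    qed
    show "AE s in \<mu>. norm (indicator {0..t} s *\<^sub>R u s (picard u k x s)) \<le> l s" for k
      using u_bound l_nonneg by (intro AE_I2) (auto simp: indicator_def)
  qed (use t l_int solution_integrable picard_integrable in
      \<open>auto intro!: borel_measurable_integrable integrable_on_subinterval_unit\<close>)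
  then have "(\<lambda>k. picard u (Suc k) x t) \<longlonglongrightarrow> x + upto_int (\<lambda>s. u s (solution s x)) t"
    by (simp add: tendsto_add)
  then show ?thesis using LIMSEQ_Suc[OF picard_tendsto[OF t]] LIMSEQ_unique by blast
qed

text \<open>Two solutions are at distance at most 2 A by the integral equation alone. Each further
  substitution into the equation halves the weighted bound.\<close>

lemma solution_unique:
  assumes \<Psi>: "integrable \<mu> (\<lambda>s. u s (\<Psi> s))" "\<And>t. t \<in> {0..1} \<Longrightarrow> \<Psi> t = x + upto_int (\<lambda>s. u s (\<Psi> s)) t"
    and t: "t \<in> {0..1}"
  shows "\<Psi> t = solution t x"
proof -
  obtain w W where "is_weight w W" using is_weight_exists by blast
  then have w: "\<And>t. t \<in> {0..1} \<Longrightarrow> 1 \<le> w t" "\<And>t. t \<in> {0..1} \<Longrightarrow> w t \<le> W"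
    "integrable \<mu> (\<lambda>s. l s * w s)" "\<And>t. t \<in> {0..1} \<Longrightarrow> upto_int (\<lambda>s. l s * w s) t \<le> (w t - 1) / 2"
    by (auto simp: is_weight_def)
  define A where "A = upto_int l 1"
  have A: "norm (upto_int F t) \<le> A" if "t \<in> {0..1}" "integrable \<mu> F" "\<And>s. s \<in> {0..1} \<Longrightarrow> norm (F s) \<le> l s" 
    for t and F :: "real \<Rightarrow> 'a"
  proof -
    have "norm (upto_int F t) \<le> upto_int l t"
      using that l_int by (intro norm_upto_int_le) auto
    also have "\<dots> \<le> A"
      unfolding A_def using that l_int l_nonneg by (intro upto_int_mono_time) auto
    finally show ?thesis .
  qed
  have A0: "0 \<le> A" using order_trans[OF norm_ge_zero A[OF t \<Psi>(1) u_bound]] .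
  have main: "norm (\<Psi> t - solution t x) \<le> (2 * A * (1/2) ^ k) * w t" if "t \<in> {0..1}" for k t
    using that
  proof (induction k arbitrary: t)
    case 0
    have "norm (\<Psi> t - solution t x) \<le> norm (upto_int (\<lambda>s. u s (\<Psi> s)) t) + norm (upto_int (\<lambda>s. u s (solution s x)) t)"
      unfolding \<Psi>(2)[OF 0] solution_eq[OF 0] using norm_triangle_ineq4 by (simp add: algebra_simps)
    also have "\<dots> \<le> A + A" by (intro add_mono A 0 \<Psi>(1) solution_integrable u_bound)
    also have "\<dots> \<le> (2 * A) * w t" using w(1)[OF 0] A0 by (simp add: mult_le_cancel_left1)
    finally show ?case by simp
  next
    case (Suc k)
    have "\<Psi> t - solution t x = upto_int (\<lambda>s. u s (\<Psi> s)) t - upto_int (\<lambda>s. u s (solution s x)) t"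
      unfolding \<Psi>(2)[OF Suc.prems] solution_eq[OF Suc.prems] by simp
    also have "norm \<dots> \<le> (2 * A * (1/2) ^ k) * upto_int (\<lambda>s. l s * w s) t"
      by (rule norm_upto_int_diff_le[OF \<Psi>(1) solution_integrable w(3) Suc.IH Suc.prems])
    also have "\<dots> \<le> (2 * A * (1/2) ^ k) * (w t / 2)"
      using w(4)[OF Suc.prems] A0 by (intro mult_left_mono) auto
    finally show ?case by simp
  qed
  have "(\<lambda>k. (2 * A * (1/2) ^ k) * w t) \<longlonglongrightarrow> (2 * A * 0) * w t"
    by (intro tendsto_intros LIMSEQ_power_zero) auto
  then have "norm (\<Psi> t - solution t x) \<le> (2 * A * 0) * w t"
    by (rule LIMSEQ_le_const) (use main[OF t] in auto)
  then show ?thesis by simp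
qed

end

section \<open>Besov bounds for the flow\<close>

lemma bes_le: "bes \<gamma> Y n K f \<Longrightarrow> j \<le> n \<Longrightarrow> bes \<gamma> Y j K f"
  by (induction n) (auto simp: le_Suc_eq simp del: bes_0 dest: bes_Suc_imp)

lemma bes_empty: "bes \<gamma> Y n K f \<Longrightarrow> bes \<gamma> {} n K f"
proof (induction n arbitrary: f)
  case 0 then show ?case by (simp add: zyg_le_def)
next
  case (Suc n)
  obtain g where g: "\<And>x h. \<bar>f (x + h) - f x - g x \<bullet> h\<bar> \<le> K * norm h powr (1 + \<gamma>)"
    "\<And>i. i \<in> Basis \<Longrightarrow> bes \<gamma> Y n K (\<lambda>x. g x \<bullet> i)" using bes_SucE[OF Suc.prems] by metis
  show ?case
    by (rule bes_SucI[OF _ g(1) Suc.IH[OF g(2)]])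
      (use bes_level0[OF Suc.prems] in \<open>auto simp: zyg_le_def\<close>)
qed

lemma (in besov_scale) bes_indicator_integral:
  fixes f :: "real \<Rightarrow> 'a::euclidean_space \<Rightarrow> real"
  assumes f: "\<And>s. s \<in> {0..1} \<Longrightarrow> bb n (b s) (f s)" and b: "integrable \<mu> b"
    and meas: "\<And>x. (\<lambda>s. f s x) \<in> borel_measurable \<mu>" and A: "A \<in> sets \<mu>"
  shows "bb n (\<integral>s. indicator A s *\<^sub>R b s \<partial>\<mu>) (\<lambda>x. \<integral>s. indicator A s *\<^sub>R f s x \<partial>\<mu>)"
proof (rule bes_integral)
  show "bb n (indicator A s *\<^sub>R b s) (\<lambda>x. indicator A s *\<^sub>R f s x)" if "s \<in> space \<mu>" for s
    using f[of s] that by (cases "s \<in> A") (auto intro: bes_const)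
  show "integrable \<mu> (\<lambda>s. indicator A s *\<^sub>R b s)" using A b by (rule integrable_mult_indicator)
  show "(\<lambda>s. indicator A s *\<^sub>R f s x) \<in> borel_measurable \<mu>" for x
    using A meas by measurable
qed

text \<open>The bound \<open>comp0\<close> is assumed because it has two sources: for Y = {} the
  Lipschitz constant of the iterates, and for the polar set a bound on their second differences,
  which is itself a consequence of the case Y = {}.\<close>

locale besov_picard = besov_scale \<gamma> S Y + lipschitz_field u l
  for \<gamma> S :: real and Y and u :: "real \<Rightarrow> 'a::euclidean_space \<Rightarrow> 'a" and l +
  fixes n :: nat and m :: "real \<Rightarrow> real" and c :: real
  assumes m_int: "integrable \<mu> m"
    and u_bes: "\<And>s e. s \<in> {0..1} \<Longrightarrow> e \<in> Basis \<Longrightarrow> bes \<gamma> Y n (m s) (\<lambda>x. u s x \<bullet> e)"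
    and c_nonneg: "0 \<le> c"
    and comp0: "\<And>k t. t \<in> {0..1} \<Longrightarrow> comp_bound \<gamma> Y 0 c (\<lambda>x. picard u k x t)"
begin

lemma m_nonneg: "s \<in> {0..1} \<Longrightarrow> 0 \<le> m s"
  using bes_nonneg[OF u_bes] nonempty_Basis by blast

lemma inner_upto_int:
  "integrable \<mu> F \<Longrightarrow> t \<in> {0..1} \<Longrightarrow> upto_int F t \<bullet> e = upto_int (\<lambda>s. F s \<bullet> e) t"
  unfolding upto_int_def
  by (subst integral_inner_left[symmetric]) (auto intro: integrable_on_subinterval_unit)

lemma picard_step_bes:
  assumes b: "integrable \<mu> b" and t: "t \<in> {0..1}" and e: "e \<in> Basis"
    and step: "\<And>s. s \<in> {0..1} \<Longrightarrow> bb j (b s) (\<lambda>x. u s (picard u k x s) \<bullet> e)"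
  shows "bb j (upto_int b t) (\<lambda>x. (picard u (Suc k) x t - x) \<bullet> e)"
proof -
  have "bb j (upto_int b t) (\<lambda>x. upto_int (\<lambda>s. u s (picard u k x s) \<bullet> e) t)"
    unfolding upto_int_def
    by (rule bes_indicator_integral[OF step b])
      (use t borel_measurable_integrable[OF picard_integrable] in auto)
  then show ?thesis using picard_integrable t by (simp add: inner_upto_int)
qed

text \<open>Induction on the level, and inside it on the iteration. Level j bounds composition at
  level j uniformly in k; at level j + 1 an iteration step then turns the bound Q w into the
  integral of C1 (1 + Q w) m, and Q and w are chosen so that this is again at most Q w.\<close>

lemma picard_bes:
  assumes "j \<le> n"
  shows "\<exists>K. \<forall>k. \<forall>t\<in>{0..1}. \<forall>e\<in>Basis. bb j K (\<lambda>x. (picard u k x t - x) \<bullet> e)"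
  using assms
proof (induction j)
  case 0
  have "bb 0 (upto_int (\<lambda>s. c * m s) 1) (\<lambda>x. (picard u k x t - x) \<bullet> e)"
    if t: "t \<in> {0..1}" and e: "e \<in> Basis" for k t e
  proof (cases k)
    case 0
    have "0 \<le> upto_int (\<lambda>s. c * m s) 1"
      unfolding upto_int_def using m_nonneg c_nonneg
      by (intro integral_nonneg_AE AE_I2) auto
    then show ?thesis using 0 by (simp del: bes_0 add: bes_const)
  next
    case (Suc k')
    have "bb 0 (upto_int (\<lambda>s. c * m s) t) (\<lambda>x. (picard u (Suc k') x t - x) \<bullet> e)"
      using m_int t e u_bes by (intro picard_step_bes comp_boundD[OF comp0] bes_level0) auto
    moreover have "upto_int (\<lambda>s. c * m s) t \<le> upto_int (\<lambda>s. c * m s) 1"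
      using m_int m_nonneg c_nonneg t by (intro upto_int_mono_time) auto
    ultimately show ?thesis unfolding Suc by (rule bes_mono)
  qed
  then show ?case by blast
next
  case (Suc j)
  note jn = Suc.prems
  obtain K where K: "\<And>k t e. t \<in> {0..1} \<Longrightarrow> e \<in> Basis \<Longrightarrow> bb j K (\<lambda>x. (picard u k x t - x) \<bullet> e)"
    using Suc by fastforce
  obtain L where L: "1 \<le> L" "\<And>k t x y. t \<in> {0..1} \<Longrightarrow> norm (picard u k x t - picard u k y t) \<le> L * norm (x - y)"
    using picard_lipschitz by blast
  have "\<exists>c'\<ge>0. \<forall>\<Phi>\<in>{\<lambda>x. picard u k x t |k t. t \<in> {0..1}}. comp_bound \<gamma> Y j c' \<Phi>"
    by (rule comp_bound_upto[OF c_nonneg, where L = L and Q = K]) (use comp0 L K in auto)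
  then obtain c' where c': "0 \<le> c'" "\<And>k t. t \<in> {0..1} \<Longrightarrow> comp_bound \<gamma> Y j c' (\<lambda>x. picard u k x t)"
    by blast
  define C where "C = max c c'"
  have C: "0 \<le> C" "\<And>k t. t \<in> {0..1} \<Longrightarrow> comp_bound \<gamma> Y j C (\<lambda>x. picard u k x t)"
    "\<And>k t. t \<in> {0..1} \<Longrightarrow> comp_bound \<gamma> Y 0 C (\<lambda>x. picard u k x t)"
    using c_nonneg comp_bound_mono[OF c'(2), of _ C] comp_bound_mono[OF comp0, of _ C] by (auto simp: C_def)
  define C1 where "C1 = mult_const TYPE('a) j * C * DIM('a) + C + L powr (1 + \<gamma>) + DIM('a)"
  have C1: "0 \<le> C1" unfolding C1_def using C(1) mult_const_nonneg[of "TYPE('a)" j] by (intro add_nonneg_nonneg mult_nonneg_nonneg) auto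
  obtain w W where w: "w \<in> borel_measurable \<mu>" "\<And>t. t \<in> {0..1} \<Longrightarrow> 1 \<le> w t" "\<And>t. t \<in> {0..1} \<Longrightarrow> w t \<le> W"
    "\<And>t. t \<in> {0..1} \<Longrightarrow> upto_int (\<lambda>s. 2 * C1 * m s * w s) t \<le> w t - 1"
    using bielecki_weight[of "\<lambda>s. 2 * C1 * m s"] m_int m_nonneg C1 by auto
  have int: "integrable \<mu> (\<lambda>s. m s * w s)"
  proof (rule Bochner_Integration.integrable_bound)
    show "integrable \<mu> (\<lambda>s. m s * W)" using m_int by simp
    show "(\<lambda>s. m s * w s) \<in> borel_measurable \<mu>" using m_int w by measurable
    show "AE s in \<mu>. norm (m s * w s) \<le> norm (m s * W)"
      using w(2,3) by (intro AE_I2) (force simp: abs_mult intro!: mult_left_mono)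
  qed
  \<comment> \<open>The inhomogeneous part C1 m contributes at most Q / 2. The weight belongs to 2
    C1 m, so the remaining part contributes at most Q (w t - 1) / 2.\<close>
  define Q where "Q = 2 * C1 * upto_int m 1"
  have Q: "0 \<le> Q" unfolding Q_def upto_int_def using m_nonneg C1
    by (intro mult_nonneg_nonneg integral_nonneg_AE AE_I2) auto
  have main: "bb (Suc j) (Q * w t) (\<lambda>x. (picard u k x t - x) \<bullet> e)"
    if "t \<in> {0..1}" "e \<in> Basis" for k t e
    using that
  proof (induction k arbitrary: t e)
    case 0
    have "0 \<le> Q * w t" using Q w(2)[OF 0(1)] by simp
    then show ?case using bes_const[of 0 "Q * w t" "Suc j"] by simp
  next
    case (Suc k)
    let ?b = "\<lambda>s. C1 * (1 + Q * w s) * m s"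
    have b_eq: "?b s = C1 * m s + Q * C1 * (m s * w s)" for s by (simp add: algebra_simps)
    have b: "integrable \<mu> ?b" unfolding b_eq using m_int int by simp
    have "bb (Suc j) (upto_int ?b t) (\<lambda>x. (picard u (Suc k) x t - x) \<bullet> e)"
    proof (rule picard_step_bes[OF b Suc.prems])
      fix s :: real assume s: "s \<in> {0..1}"
      have cb: "comp_bound \<gamma> Y (Suc j) (C1 * (1 + Q * w s)) (\<lambda>x. picard u k x s)"
        unfolding C1_def
        using C Q w(2)[OF s] s L Suc.IH by (intro comp_bound_Suc) auto
      show "bb (Suc j) (?b s) (\<lambda>x. u s (picard u k x s) \<bullet> e)"
        by (rule comp_boundD[OF cb bes_le[OF u_bes[OF s Suc.prems(2)] jn]])
    qed
    moreover have "upto_int ?b t \<le> Q * w t"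
    proof -
      have "upto_int (\<lambda>s. 2 * C1 * m s * w s) t = 2 * (C1 * upto_int (\<lambda>s. m s * w s) t)"
        unfolding upto_int_def by (simp add: mult.assoc mult.left_commute[of "indicator _ _"])
      then have "C1 * upto_int (\<lambda>s. m s * w s) t \<le> (w t - 1) / 2"
        using w(4)[OF Suc.prems(1)] by simp
      then have "Q * (C1 * upto_int (\<lambda>s. m s * w s) t) \<le> Q * ((w t - 1) / 2)" using Q by (rule mult_left_mono)
      moreover have "C1 * upto_int m t \<le> Q / 2"
        unfolding Q_def using m_int m_nonneg C1 Suc.prems upto_int_mono_time[of m t 1] by (simp add: mult_left_mono)
      moreover have "0 \<le> Q * w t" using Q w(2)[OF Suc.prems(1)] by simp
      moreover have "upto_int ?b t = C1 * upto_int m t + Q * (C1 * upto_int (\<lambda>s. m s * w s) t)"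
        unfolding b_eq upto_int_def using integrable_real_on_subinterval_unit(1)[OF m_int, of 0 t]
          integrable_real_on_subinterval_unit(1)[OF int, of 0 t] Suc.prems
        by (simp add: distrib_left mult.left_commute[of "indicator _ _"])
      ultimately show ?thesis by (simp add: algebra_simps)
    qed
    ultimately show ?case by (rule bes_mono)
  qed
  have "bb (Suc j) (Q * W) (\<lambda>x. (picard u k x t - x) \<bullet> e)" if "t \<in> {0..1}" "e \<in> Basis" for k t e
    using main[OF that] w(3)[OF that(1)] Q by (blast intro: bes_mono mult_left_mono)
  then show ?case by blast
qed

text \<open>The composition bound is proved for the iterates, and \<open>bes_limit\<close> asks for
  pointwise convergence only; derivatives of \<open>solution\<close> are never formed.\<close>

lemma solution_comp_bes:
  "\<exists>C\<ge>0. \<forall>s\<in>{0..1}. \<forall>e\<in>Basis. bb n (C * m s) (\<lambda>x. u s (solution s x) \<bullet> e)"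
proof -
  obtain K where K: "\<And>k t e. t \<in> {0..1} \<Longrightarrow> e \<in> Basis \<Longrightarrow> bb n K (\<lambda>x. (picard u k x t - x) \<bullet> e)"
    using picard_bes[of n] by fastforce
  obtain L where L: "1 \<le> L" "\<And>k t x y. t \<in> {0..1} \<Longrightarrow> norm (picard u k x t - picard u k y t) \<le> L * norm (x - y)"
    using picard_lipschitz by blast
  have "\<exists>c'\<ge>0. \<forall>\<Phi>\<in>{\<lambda>x. picard u k x t |k t. t \<in> {0..1}}. comp_bound \<gamma> Y n c' \<Phi>"
    by (rule comp_bound_upto[OF c_nonneg, where L = L and Q = K]) (use comp0 L K in auto)
  then obtain c' where c': "0 \<le> c'" "\<And>k t. t \<in> {0..1} \<Longrightarrow> comp_bound \<gamma> Y n c' (\<lambda>x. picard u k x t)"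
    by blast
  have "bb n (c' * m s) (\<lambda>x. u s (solution s x) \<bullet> e)" if s: "s \<in> {0..1}" and e: "e \<in> Basis" for s e
  proof (rule bes_limit)
    show "bb n (c' * m s) (\<lambda>x. u s (picard u k x s) \<bullet> e)" for k
      using c'(2)[OF s] u_bes[OF s e] by (rule comp_boundD)
    show "(\<lambda>k. u s (picard u k x s) \<bullet> e) \<longlonglongrightarrow> u s (solution s x) \<bullet> e" for x
      by (intro tendsto_inner tendsto_const continuous_on_tendsto_compose[OF u_continuous[OF s] picard_tendsto[OF s]]) auto
  qed
  then show ?thesis using c'(1) by blast
qed

end

locale besov_field = besov_scale \<gamma> S Y
  for \<gamma> S :: real and Y +
  fixes u :: "real \<Rightarrow> 'a::euclidean_space \<Rightarrow> 'a" and n :: nat and m :: "real \<Rightarrow> real"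
  assumes n_pos: "1 \<le> n"
    and m_int: "integrable \<mu> m"
    and u_meas: "\<And>x. (\<lambda>s. u s x) \<in> borel_measurable \<mu>"
    and u_bes: "\<And>s e. s \<in> {0..1} \<Longrightarrow> e \<in> Basis \<Longrightarrow> bes \<gamma> Y n (m s) (\<lambda>x. u s x \<bullet> e)"
begin

lemma m_nonneg: "s \<in> {0..1} \<Longrightarrow> 0 \<le> m s"
  using bes_nonneg[OF u_bes] nonempty_Basis by blast

text \<open>Since n is at least 1, every component has Lipschitz constant (DIM + 2) m by
  \<open>bes_Suc_lipschitz\<close>; the l1 norm adds up DIM components.\<close>

sublocale lipschitz_field u "\<lambda>s. real DIM('a) * (real DIM('a) + 2) * m s"
proof
  fix s :: real and x y :: 'a assume s: "s \<in> {0..1}"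
  note 1 = bes_le[OF u_bes[OF s] n_pos]
  have m: "0 \<le> m s" by (rule m_nonneg[OF s])
  have "norm (u s x) \<le> (\<Sum>e\<in>Basis. \<bar>u s x \<bullet> e\<bar>)" by (rule norm_le_l1)
  also have "\<dots> \<le> DIM('a) * m s"
    by (rule sum_bounded_above) (rule bes_bound[OF 1])
  also have "\<dots> = DIM('a) * 1 * m s" by simp
  also have "\<dots> \<le> DIM('a) * (DIM('a) + 2) * m s" using m by (intro mult_right_mono mult_left_mono) auto
  finally show "norm (u s x) \<le> real DIM('a) * (real DIM('a) + 2) * m s" by (simp add: algebra_simps)
  have "norm (u s x - u s y) \<le> (\<Sum>e\<in>Basis. \<bar>(u s x - u s y) \<bullet> e\<bar>)" by (rule norm_le_l1)
  also have "\<dots> \<le> DIM('a) * ((DIM('a) + 2) * m s * norm (x - y))"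
    unfolding inner_diff_left
    by (rule sum_bounded_above) (rule bes_Suc_lipschitz[OF 1[unfolded One_nat_def] gamma_pos])
  finally show "norm (u s x - u s y) \<le> real DIM('a) * (real DIM('a) + 2) * m s * norm (x - y)"
    by (simp add: algebra_simps)
qed (use u_meas m_int in auto)

text \<open>The iteration is run with Y = {}, S = 0 and level 1, where the Lipschitz constant L
  bounds composition. The outcome is a Taylor estimate for the displacements with a constant
  independent of k and t, hence the second-difference bound that \<open>comp_bound_0\<close> needs
  for the actual Y.\<close>

lemma picard_comp_bound_0:
  "\<exists>c\<ge>0. \<forall>k. \<forall>t\<in>{0..1}. comp_bound \<gamma> Y 0 c (\<lambda>x. picard u k x t)"
proof -
  obtain L where L: "1 \<le> L" "\<And>k t x y. t \<in> {0..1} \<Longrightarrow> norm (picard u k x t - picard u k y t) \<le> L * norm (x - y)"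
    using picard_lipschitz by blast
  interpret holder: besov_picard \<gamma> 0 "{}" u "\<lambda>s. real DIM('a) * (real DIM('a) + 2) * m s" 1 m L
  proof
    show "bes \<gamma> {} 1 (m s) (\<lambda>x. u s x \<bullet> e)" if "s \<in> {0..1}" "e \<in> Basis" for s e
      using bes_empty[OF bes_le[OF u_bes[OF that] n_pos]] .
    show "comp_bound \<gamma> {} 0 L (\<lambda>x. picard u k x t)" if "t \<in> {0..1}" for k t
      by (rule comp_bound_0_lipschitz) (use gamma_pos gamma_le L that in auto)
  qed (use gamma_pos gamma_le m_int L in auto)
  obtain K where K: "\<And>k t e. t \<in> {0..1} \<Longrightarrow> e \<in> Basis \<Longrightarrow> bes \<gamma> {} (Suc 0) K (\<lambda>x. (picard u k x t - x) \<bullet> e)"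
    using holder.picard_bes[of 1] by fastforce
  have sec: "norm (picard u k (x + 2 *\<^sub>R h) t - 2 *\<^sub>R picard u k (x + h) t + picard u k x t) \<le> DIM('a) * (2 * K) * norm h powr (1 + \<gamma>)"
    if t: "t \<in> {0..1}" for k t x h
  proof -
    let ?v = "picard u k (x + 2 *\<^sub>R h) t - 2 *\<^sub>R picard u k (x + h) t + picard u k x t"
    have "\<bar>?v \<bullet> e\<bar> \<le> 2 * K * norm h powr (1 + \<gamma>)" if e: "e \<in> Basis" for e
    proof -
      obtain g where "\<And>x h. \<bar>(picard u k (x + h) t - (x + h)) \<bullet> e - (picard u k x t - x) \<bullet> e - g x \<bullet> h\<bar> \<le> K * norm h powr (1 + \<gamma>)"
        using bes_SucE[OF K[OF t e]] by metis
      then have "\<bar>sdiff (\<lambda>x. (picard u k x t - x) \<bullet> e) x h\<bar> \<le> 2 * K * norm h powr (1 + \<gamma>)"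
        by (rule taylor_second_diff)
      \<comment> \<open>The identity is affine and drops out of the second difference.\<close>
      also have "sdiff (\<lambda>x. (picard u k x t - x) \<bullet> e) x h = ?v \<bullet> e"
        by (simp add: sdiff_def algebra_simps scaleR_2)
      finally show ?thesis .
    qed
    then have "(\<Sum>e\<in>Basis. \<bar>?v \<bullet> e\<bar>) \<le> DIM('a) * (2 * K * norm h powr (1 + \<gamma>))"
      by (rule sum_bounded_above)
    then show ?thesis using norm_le_l1[of ?v] by (simp add: mult.assoc)
  qed
  \<comment> \<open>The Lipschitz constant is rounded up to a power of two, because steps are
    compared with dyadic radii by repeated halving.\<close>
  obtain q where q: "L \<le> 2 ^ q" using real_arch_pow[of 2 L] by (auto intro: less_imp_le)
  have "comp_bound \<gamma> Y 0 (4 ^ q + (DIM('a) * (2 * K)) powr \<gamma> * S) (\<lambda>x. picard u k x t)" if t: "t \<in> {0..1}" for k t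
  proof (rule comp_bound_0[OF _ sec[OF t]])
    show "norm (picard u k x t - picard u k y t) \<le> 2 ^ q * norm (x - y)" for x y
      using order_trans[OF L(2)[OF t] mult_right_mono[OF q norm_ge_zero]] .
  qed
  then show ?thesis using S_nonneg by (intro exI[of _ "4 ^ q + (DIM('a) * (2 * K)) powr \<gamma> * S"]) auto
qed

lemma solution_increment_bes:
  "\<exists>C\<ge>0. \<forall>r t. 0 \<le> r \<longrightarrow> r \<le> t \<longrightarrow> t \<le> 1 \<longrightarrow>
     (\<forall>e\<in>Basis. bb n (C * (upto_int m t - upto_int m r)) (\<lambda>x. (solution t x - solution r x) \<bullet> e))"
proof -
  obtain c where c: "0 \<le> c" "\<And>k t. t \<in> {0..1} \<Longrightarrow> comp_bound \<gamma> Y 0 c (\<lambda>x. picard u k x t)"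
    using picard_comp_bound_0 by blast
  interpret besov_picard \<gamma> S Y u "\<lambda>s. real DIM('a) * (real DIM('a) + 2) * m s" n m c
    by standard (use m_int u_bes c in auto)
  obtain C where C: "0 \<le> C" "\<And>s e. s \<in> {0..1} \<Longrightarrow> e \<in> Basis \<Longrightarrow> bb n (C * m s) (\<lambda>x. u s (solution s x) \<bullet> e)"
    using solution_comp_bes by blast
  have "bb n (C * (upto_int m t - upto_int m r)) (\<lambda>x. (solution t x - solution r x) \<bullet> e)"
    if rt: "0 \<le> r" "r \<le> t" "t \<le> 1" and e: "e \<in> Basis" for r t e
  proof -
    have "bb n (\<integral>s. indicator {r<..t} s *\<^sub>R (C * m s) \<partial>\<mu>) (\<lambda>x. \<integral>s. indicator {r<..t} s *\<^sub>R (u s (solution s x) \<bullet> e) \<partial>\<mu>)"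
      using rt m_int borel_measurable_integrable[OF solution_integrable]
      by (intro bes_indicator_integral C e) auto
    moreover have "(\<integral>s. indicator {r<..t} s *\<^sub>R (u s (solution s x) \<bullet> e) \<partial>\<mu>) = (solution t x - solution r x) \<bullet> e" for x
    proof -
      have "(\<integral>s. indicator {r<..t} s *\<^sub>R (u s (solution s x) \<bullet> e) \<partial>\<mu>)
        = upto_int (\<lambda>s. u s (solution s x) \<bullet> e) t - upto_int (\<lambda>s. u s (solution s x) \<bullet> e) r"
        by (rule upto_int_diff[symmetric]) (use rt solution_integrable in auto)
      also have "\<dots> = (solution t x - solution r x) \<bullet> e"
        using rt solution_integrable by (simp add: solution_eq[of t] solution_eq[of r] inner_upto_int[symmetric] inner_diff_left inner_add_left)
      finally show ?thesis .
    qed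
    moreover have "(\<integral>s. indicator {r<..t} s *\<^sub>R (C * m s) \<partial>\<mu>) = C * (upto_int m t - upto_int m r)"
      using m_int rt by (simp add: upto_int_diff mult.left_commute)
    ultimately show ?thesis by simp
  qed
  then show ?thesis using C(1) by blast
qed

end

section \<open>Duality for weighted sequence norms\<close>

text \<open>Discrete counterpart of Z^(\<alpha>,p) <= 1, with a j in the role of the smoothness
  modulus at 2^(-j).\<close>

definition lp_ball :: "real \<Rightarrow> ennreal \<Rightarrow> nat \<Rightarrow> (nat \<Rightarrow> real) \<Rightarrow> bool" where
  "lp_ball \<alpha> p J a \<longleftrightarrow> (if p = \<infinity> then \<forall>j<J. 2 powr (j * \<alpha>) * a j \<le> 1
     else (\<Sum>j<J. (2 powr (j * \<alpha>) * a j) powr enn2real p) \<le> 1)"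

text \<open>The nonnegative part of the polar of that ball. All truncations J are tested, so only
  finite sums occur and one weight serves every length.\<close>

definition lp_polar :: "real \<Rightarrow> ennreal \<Rightarrow> (nat \<Rightarrow> real) set" where
  "lp_polar \<alpha> p = {y. (\<forall>j. 0 \<le> y j) \<and>
     (\<forall>J a. (\<forall>j. 0 \<le> a j) \<longrightarrow> lp_ball \<alpha> p J a \<longrightarrow> (\<Sum>j<J. y j * a j) \<le> 1)}"

lemma lp_polar_nonneg: "y \<in> lp_polar \<alpha> p \<Longrightarrow> 0 \<le> y j"
  by (simp add: lp_polar_def)

lemma lp_polarD: "y \<in> lp_polar \<alpha> p \<Longrightarrow> (\<And>j. 0 \<le> a j) \<Longrightarrow> lp_ball \<alpha> p J a \<Longrightarrow> (\<Sum>j<J. y j * a j) \<le> 1"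
  by (simp add: lp_polar_def)

lemma enn2real_ge_1: "1 \<le> p \<Longrightarrow> p \<noteq> \<infinity> \<Longrightarrow> 1 \<le> enn2real p"
  by (metis enn2real_1 enn2real_mono infinity_ennreal_def less_top)

lemma half_power_powr: "((1/2::real)^j) powr \<beta> = 2 powr (- (j * \<beta>))"
proof -
  have "(1/2::real)^j = 2 powr (- real j)"
    by (simp add: powr_minus powr_realpow power_one_over inverse_eq_divide)
  then show ?thesis by (simp add: powr_powr)
qed

lemma lp_ball_component:
  fixes \<alpha> :: real
  assumes "lp_ball \<alpha> p J a" "\<And>j. 0 \<le> a j" "1 \<le> p" "j < J"
  shows "2 powr (j * \<alpha>) * a j \<le> 1"
proof (cases "p = \<infinity>")
  case False
  let ?p = "enn2real p"
  have p: "1 \<le> ?p" using assms False by (intro enn2real_ge_1)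
  have "(2 powr (j * \<alpha>) * a j) powr ?p \<le> (\<Sum>j<J. (2 powr (j * \<alpha>) * a j) powr ?p)"
    using assms(4) by (intro member_le_sum) auto
  also have "\<dots> \<le> 1" using assms(1) False by (simp add: lp_ball_def)
  finally have 1: "(2 powr (j * \<alpha>) * a j) powr ?p \<le> 1" .
  show ?thesis
  proof (rule ccontr)
    assume "\<not> ?thesis"
    then have "1 < (2 powr (j * \<alpha>) * a j) powr ?p" using p by (intro gr_one_powr) auto
    with 1 show False by simp
  qed
qed (use assms in \<open>auto simp: lp_ball_def\<close>)

text \<open>Testing with a weight on a single scale recovers the pointwise estimate at that scale.
  This settles p = \<infinity> and yields the Hoelder bound for every p.\<close>

lemma unit_in_lp_polar:
  fixes \<alpha> :: real
  assumes "1 \<le> p"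
  shows "(\<lambda>i. if i = j then 2 powr (j * \<alpha>) else 0) \<in> lp_polar \<alpha> p"
  unfolding lp_polar_def
proof (intro CollectI conjI allI impI)
  fix J a assume a: "\<forall>j. 0 \<le> a j" "lp_ball \<alpha> p J a"
  have "(\<Sum>i<J. (if i = j then 2 powr (j * \<alpha>) else 0) * a i) = (if j < J then 2 powr (j * \<alpha>) * a j else 0)"
    by (simp add: if_distrib[of "\<lambda>x. x * _"] if_distribR sum.delta' cong: if_cong)
  also have "\<dots> \<le> 1" using lp_ball_component[OF a(2) _ assms] a(1) by auto
  finally show "(\<Sum>i<J. (if i = j then 2 powr (j * \<alpha>) else 0) * a i) \<le> 1" .
qed auto

text \<open>The test sequence (1 - q) 2^(-j \<beta>) with q = 2^(\<alpha> - \<beta>) becomes (1 - q)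
  q^j after weighting. Its sum is at most 1 and its terms are at most 1, so it lies in the ball for
  every p.\<close>

lemma lp_polar_sum:
  assumes y: "y \<in> lp_polar \<alpha> p" and "\<alpha> < \<beta>" "1 \<le> p"
  shows "(\<Sum>j<J. y j * ((1/2)^j) powr \<beta>) \<le> 1 / (1 - 2 powr (\<alpha> - \<beta>))"
proof -
  define q :: real where "q = 2 powr (\<alpha> - \<beta>)"
  have "2 powr (\<alpha> - \<beta>) < 2 powr (0::real)" using assms(2) by (intro powr_less_mono) auto
  then have q: "0 < q" "q < 1" by (auto simp: q_def)
  define a where "a j = (1 - q) * ((1/2)^j) powr \<beta>" for j :: nat
  have "2 powr (j * \<alpha>) * a j = (1 - q) * q ^ j" for j
    unfolding a_def half_power_powr q_def by (simp add: powr_power powr_add[symmetric] algebra_simps)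
  moreover have geo: "(\<Sum>j<J. (1 - q) * q ^ j) \<le> 1"
    using q by (simp add: sum_distrib_left[symmetric] sum_gp_strict)
  moreover have le1: "(1 - q) * q ^ j \<le> 1" for j
    using q by (intro mult_le_one) (auto simp: power_le_one)
  moreover have "(\<Sum>j<J. ((1 - q) * q ^ j) powr enn2real p) \<le> 1" if "p \<noteq> \<infinity>"
  proof (rule order_trans[OF sum_mono geo])
    fix j
    have "((1 - q) * q ^ j) powr enn2real p \<le> ((1 - q) * q ^ j) powr 1"
      using q le1 enn2real_ge_1[OF assms(3) that] by (intro powr_mono') auto
    then show "((1 - q) * q ^ j) powr enn2real p \<le> (1 - q) * q ^ j" using q by simp
  qed
  ultimately have "lp_ball \<alpha> p J a" by (simp add: lp_ball_def)
  then have "(\<Sum>j<J. y j * a j) \<le> 1" using q by (intro lp_polarD[OF y, of a]) (auto simp: a_def)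
  also have "(\<Sum>j<J. y j * a j) = (1 - q) * (\<Sum>j<J. y j * ((1/2)^j) powr \<beta>)"
    by (simp add: a_def sum_distrib_left algebra_simps)
  finally show ?thesis using q by (simp add: field_simps q_def[symmetric])
qed

text \<open>Young's inequality without the conjugate exponent, so that p = 1 is included; there
  \<open>0 powr 0 = 0\<close> calls for a case distinction.\<close>

lemma young_powr:
  fixes c b p :: real
  assumes "0 \<le> c" "0 \<le> b" "1 \<le> p"
  shows "c powr (p - 1) * b \<le> (p - 1) / p * c powr p + b powr p / p"
proof (cases "p = 1")
  case True then show ?thesis using assms by (cases "c = 0") auto
next
  case False
  then have p: "1 < p" using assms by simp
  let ?q = "p / (p - 1)"
  have q: "1 < ?q" using p by simp
  have "b * c powr (p - 1) \<le> b powr p / p + (c powr (p - 1)) powr ?q / ?q"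
    by (rule Youngs_inequality) (use p q assms in \<open>auto simp: field_simps\<close>)
  also have "(c powr (p - 1)) powr ?q = c powr p" using p by (simp add: powr_powr)
  finally show ?thesis by (simp add: algebra_simps)
qed

text \<open>The converse of Hoelder's inequality. With b j = 2^(j \<alpha>) a j, s its l^P norm and
  c = b / s, the extremal weight is 2^(j \<alpha>) c j^(P - 1): it lies in the polar by Young's
  inequality, and its pairing with a is exactly s.\<close>

lemma lp_polar_dual:
  fixes a :: "nat \<Rightarrow> real" and J :: nat and K \<alpha> :: real
  assumes a: "\<And>j. 0 \<le> a j" and p: "1 \<le> p" "p \<noteq> \<infinity>" and K: "0 \<le> K"
    and le: "\<And>y. y \<in> lp_polar \<alpha> p \<Longrightarrow> (\<Sum>j<J. y j * a j) \<le> K"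
  shows "(\<Sum>j<J. (2 powr (j * \<alpha>) * a j) powr enn2real p) \<le> K powr enn2real p"
proof -
  define P where "P = enn2real p"
  have P: "1 \<le> P" unfolding P_def using p by (rule enn2real_ge_1)
  define b where "b j = 2 powr (j * \<alpha>) * a j" for j :: nat
  have b: "0 \<le> b j" for j using a by (simp add: b_def)
  define T where "T = (\<Sum>j<J. b j powr P)"
  show ?thesis
  proof (cases "T = 0")
    case True then show ?thesis by (simp add: T_def b_def P_def)
  next
    case False
    then have T: "0 < T" by (simp add: T_def sum_nonneg less_le)
    define s where "s = T powr (1 / P)"
    have s: "0 < s" "s powr P = T" using T P by (auto simp: s_def powr_powr)
    define c where "c j = b j / s" for j
    have c: "0 \<le> c j" for j using b s by (simp add: c_def)
    have c_sum: "(\<Sum>j<J. c j powr P) = 1"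
    proof -
      have "(\<Sum>j<J. c j powr P) = (\<Sum>j<J. b j powr P) / s powr P"
        using b s by (simp add: c_def powr_divide sum_divide_distrib)
      then show ?thesis using s T by (simp add: T_def[symmetric])
    qed
    define y where "y j = (if j < J then 2 powr (j * \<alpha>) * c j powr (P - 1) else 0)" for j
    have "y \<in> lp_polar \<alpha> p"
      unfolding lp_polar_def
    proof (intro CollectI conjI allI impI)
      fix J' a' assume a': "\<forall>j. 0 \<le> a' j" "lp_ball \<alpha> p J' a'"
      have "(\<Sum>j<J'. y j * a' j) \<le> (\<Sum>j<J'. (P - 1) / P * (if j < J then c j powr P else 0) + (2 powr (j * \<alpha>) * a' j) powr P / P)"
      proof (rule sum_mono)
        fix j
        have "c j powr (P - 1) * (2 powr (j * \<alpha>) * a' j) \<le> (P - 1) / P * c j powr P + (2 powr (j * \<alpha>) * a' j) powr P / P"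
          using a' c P by (intro young_powr) auto
        then show "y j * a' j \<le> (P - 1) / P * (if j < J then c j powr P else 0) + (2 powr (j * \<alpha>) * a' j) powr P / P"
          using P by (simp add: y_def mult.commute mult.left_commute)
      qed
      also have "\<dots> = (P - 1) / P * (\<Sum>j<J'. if j < J then c j powr P else 0) + (\<Sum>j<J'. (2 powr (j * \<alpha>) * a' j) powr P) / P"
        by (simp add: sum.distrib sum_distrib_left sum_divide_distrib)
      also have "\<dots> \<le> (P - 1) / P * 1 + 1 / P"
      proof (intro add_mono mult_left_mono divide_right_mono)
        have "(\<Sum>j<J'. if j < J then c j powr P else 0) = (\<Sum>j\<in>{..<J'} \<inter> {..<J}. c j powr P)"
          by (simp add: sum.inter_restrict)
        also have "\<dots> \<le> (\<Sum>j<J. c j powr P)" by (rule sum_mono2) auto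
        finally show "(\<Sum>j<J'. if j < J then c j powr P else 0) \<le> 1" using c_sum by simp
        show "(\<Sum>j<J'. (2 powr (j * \<alpha>) * a' j) powr P) \<le> 1" using a'(2) p by (simp add: lp_ball_def P_def)
      qed (use P in auto)
      also have "\<dots> = 1" using P by (simp add: field_simps)
      finally show "(\<Sum>j<J'. y j * a' j) \<le> 1" .
    qed (simp add: y_def)
    then have "(\<Sum>j<J. y j * a j) \<le> K" by (rule le)
    also have "(\<Sum>j<J. y j * a j) = (\<Sum>j<J. s * c j powr P)"
    proof (rule sum.cong)
      fix j assume "j \<in> {..<J}"
      have "y j * a j = c j powr (P - 1) * b j" using \<open>j \<in> {..<J}\<close> by (simp add: y_def b_def)
      also have "b j = s * c j" using s by (simp add: c_def)
      also have "c j powr (P - 1) * (s * c j) = s * c j powr P"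
        using c[of j] by (cases "c j = 0") (auto simp: powr_diff)
      finally show "y j * a j = s * c j powr P" .
    qed simp
    also have "\<dots> = s" using c_sum by (simp add: sum_distrib_left[symmetric])
    finally have "s powr P \<le> K powr P" using s P by (intro powr_mono2) auto
    then show ?thesis using s by (simp add: T_def b_def P_def)
  qed
qed

section \<open>Comparison of the Zygmund integral with dyadic sums\<close>

lemma superadditive_powr:
  fixes x y p :: real
  assumes "0 \<le> x" "0 \<le> y" "1 \<le> p"
  shows "x powr p + y powr p \<le> (x + y) powr p"
proof -
  have e: "z powr p = z * z powr (p - 1)" if "0 \<le> z" for z :: real
    using that by (cases "z = 0") (auto simp: powr_diff)
  have "x powr p + y powr p = x * x powr (p - 1) + y * y powr (p - 1)" using assms e by simp
  also have "\<dots> \<le> x * (x + y) powr (p - 1) + y * (x + y) powr (p - 1)"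
    using assms by (intro add_mono mult_left_mono powr_mono2) auto
  also have "\<dots> = (x + y) powr p" using e[of "x + y"] assms by (simp add: algebra_simps)
  finally show ?thesis .
qed

lemma ennreal_powr_mono: "x \<le> y \<Longrightarrow> 0 \<le> a \<Longrightarrow> ennreal_powr x a \<le> ennreal_powr y a"
  by (auto simp: ennreal_powr_def top_unique less_top[symmetric] intro!: ennreal_leI powr_mono2 enn2real_mono)

lemma ennreal_powr_ennreal: "0 \<le> x \<Longrightarrow> ennreal_powr (ennreal x) a = ennreal (x powr a)"
  by (simp add: ennreal_powr_def)

lemma smoothness_modulus_mono: "s \<le> t \<Longrightarrow> smoothness_modulus k G s \<le> smoothness_modulus k G t"
  unfolding smoothness_modulus_def by (intro SUP_mono' SUP_subset_mono) auto


text \<open>Removes the root in \<open>zygmund\<close>, so that later estimates compare integrals of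
  p-th powers.\<close>

lemma zygmund_finite_exponent_le_iff:
  assumes "1 \<le> p" "p \<noteq> \<infinity>" "0 \<le> m"
  shows "zygmund k \<alpha> p G \<le> ennreal m \<longleftrightarrow>
    (\<integral>\<^sup>+t\<in>{0<..}. (ennreal_powr (smoothness_modulus k G t / ennreal (t powr \<alpha>)) (enn2real p) / ennreal t) \<partial>lborel)
     \<le> ennreal (m powr enn2real p)" (is "_ \<longleftrightarrow> ?N \<le> _")
proof -
  have P: "1 \<le> enn2real p" using assms by (intro enn2real_ge_1)
  show ?thesis
  proof (cases ?N rule: ennreal_cases)
    case (real r)
    have "r powr (1 / enn2real p) \<le> m \<longleftrightarrow> r \<le> m powr enn2real p"
    proof
      assume "r powr (1 / enn2real p) \<le> m"
      then have "(r powr (1 / enn2real p)) powr enn2real p \<le> m powr enn2real p"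
        using P by (intro powr_mono2) auto
      then show "r \<le> m powr enn2real p" using P real by (simp add: powr_powr)
    next
      assume "r \<le> m powr enn2real p"
      then have "r powr (1 / enn2real p) \<le> (m powr enn2real p) powr (1 / enn2real p)"
        using P real by (intro powr_mono2) auto
      then show "r powr (1 / enn2real p) \<le> m" using P assms by (simp add: powr_powr)
    qed
    then show ?thesis using real assms by (simp add: zygmund_def ennreal_powr_ennreal)
  next
    case top
    then show ?thesis using assms by (simp add: zygmund_def ennreal_powr_def top_unique)
  qed
qed

text \<open>The modulus is monotone, so on the cell from 2^(-j) to 2^(1-j) it is at least its value
  at the left end. The disjoint cells together give a lower bound for the integral. D is any
  minorant of the modulus, since single second differences are inserted for it.\<close>

lemma zygmund_imp_lp_ball:
  assumes z: "zygmund k \<alpha> p G \<le> ennreal m" and m: "0 < m" and \<alpha>: "0 < \<alpha>" "\<alpha> \<le> 1" and p: "1 \<le> p"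
    and D0: "\<And>j. 0 \<le> D j" and D: "\<And>j. j < J \<Longrightarrow> ennreal (D j) \<le> smoothness_modulus k G ((1/2)^j)"
  shows "lp_ball \<alpha> p J (\<lambda>j. D j / (4 * m))"
proof (cases "p = \<infinity>")
  case True
  have "2 powr (j * \<alpha>) * D j \<le> m" if j: "j < J" for j
  proof -
    let ?t = "(1/2::real)^j"
    have "ennreal (D j / ?t powr \<alpha>) = ennreal (D j) / ennreal (?t powr \<alpha>)"
      using D0 by (simp add: divide_ennreal)
    also have "\<dots> \<le> smoothness_modulus k G ?t / ennreal (?t powr \<alpha>)"
      by (intro divide_right_mono_ennreal D j)
    also have "\<dots> \<le> (SUP t\<in>{0<..}. smoothness_modulus k G t / ennreal (t powr \<alpha>))"
      by (rule SUP_upper) simp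
    also have "\<dots> \<le> ennreal m" using z True by (simp add: zygmund_def)
    finally have "D j / ?t powr \<alpha> \<le> m" using m by simp
    then have "D j / 2 powr (- (j * \<alpha>)) \<le> m" unfolding half_power_powr .
    then show ?thesis by (simp add: powr_minus field_simps)
  qed
  then have "\<forall>j<J. 2 powr (j * \<alpha>) * D j \<le> 4 * m" using m by fastforce
  then show ?thesis using True m by (simp add: lp_ball_def field_simps)
next
  case False
  define P where "P = enn2real p"
  have P: "1 \<le> P" unfolding P_def using p False by (rule enn2real_ge_1)
  define F where "F t = ennreal_powr (smoothness_modulus k G t / ennreal (t powr \<alpha>)) P / ennreal t" for t
  define R where "R j = 2 * (1/2::real)^j" for j :: nat
  define c where "c j = (D j / R j powr \<alpha>) powr P / R j" for j
  define A where "A j = {(1/2::real)^j<..R j}" for j :: nat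
  have R: "0 < R j" for j by (simp add: R_def)
  have disj: "t \<notin> A i" if "t \<in> A j" "i \<noteq> j" for t i j
  proof -
    have "t \<notin> A i \<or> t \<notin> A j" if "i < j" for i j
    proof -
      have "R j \<le> (1/2)^i"
        using power_decreasing[of "Suc i" j "1/2::real"] that by (simp add: R_def)
      then show ?thesis by (auto simp: A_def)
    qed
    then show ?thesis using that by (meson linorder_neqE_nat)
  qed
  have F_ge: "ennreal (c j) \<le> F t" if j: "j < J" and t: "t \<in> A j" for j t
  proof -
    have t': "(1/2)^j < t" "t \<le> R j" "0 < t"
      using t by (auto simp: A_def intro: less_trans[of 0 "(1/2)^j"])
    have "ennreal (D j / R j powr \<alpha>) \<le> ennreal (D j / t powr \<alpha>)"
      using t' D0 \<alpha> by (intro ennreal_leI divide_left_mono powr_mono2) auto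
    also have "\<dots> = ennreal (D j) / ennreal (t powr \<alpha>)"
      using D0 t' by (simp add: divide_ennreal)
    also have "\<dots> \<le> smoothness_modulus k G t / ennreal (t powr \<alpha>)"
      using order_trans[OF D[OF j] smoothness_modulus_mono] t' by (intro divide_right_mono_ennreal) simp
    finally have "ennreal_powr (ennreal (D j / R j powr \<alpha>)) P \<le> ennreal_powr (smoothness_modulus k G t / ennreal (t powr \<alpha>)) P"
      using P by (intro ennreal_powr_mono) auto
    then have "ennreal ((D j / R j powr \<alpha>) powr P) / ennreal t \<le> F t"
      using D0 unfolding F_def by (intro divide_right_mono_ennreal) (simp add: ennreal_powr_ennreal)
    moreover have "ennreal (c j) \<le> ennreal ((D j / R j powr \<alpha>) powr P) / ennreal t"
      using t' R D0 by (simp add: c_def divide_ennreal divide_left_mono)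
    ultimately show ?thesis by (rule order_trans[rotated])
  qed
  have pointwise: "(\<Sum>j<J. ennreal (c j) * indicator (A j) t) \<le> F t * indicator {0<..} t" for t
  proof (cases "\<exists>j<J. t \<in> A j")
    case True
    then obtain j where j: "j < J" "t \<in> A j" by blast
    have "(\<Sum>i<J. ennreal (c i) * indicator (A i) t) = ennreal (c j) * indicator (A j) t + (\<Sum>i\<in>{..<J}-{j}. ennreal (c i) * indicator (A i) t)"
      using j by (intro sum.remove) auto
    also have "(\<Sum>i\<in>{..<J}-{j}. ennreal (c i) * indicator (A i) t) = 0"
      using disj[OF j(2)] by (intro sum.neutral) auto
    finally have "(\<Sum>i<J. ennreal (c i) * indicator (A i) t) = ennreal (c j)" using j by simp
    moreover have "0 < t" using j(2) by (auto simp: A_def intro: less_trans[of 0 "(1/2)^j"])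
    ultimately show ?thesis using F_ge[OF j] by simp
  next
    case False
    then have "(\<Sum>i<J. ennreal (c i) * indicator (A i) t) = 0" by (intro sum.neutral) auto
    then show ?thesis by simp
  qed
  have c0: "0 \<le> c j" for j using R by (simp add: c_def less_imp_le)
  have "ennreal (\<Sum>j<J. c j * (1/2)^j) = (\<Sum>j<J. ennreal (c j) * emeasure lborel (A j))"
    using c0 by (simp add: A_def R_def ennreal_mult flip: sum_ennreal)
  also have "\<dots> = (\<integral>\<^sup>+t. (\<Sum>j<J. ennreal (c j) * indicator (A j) t) \<partial>lborel)"
    by (subst nn_integral_sum) (auto simp: nn_integral_cmult_indicator A_def)
  also have "\<dots> \<le> (\<integral>\<^sup>+t\<in>{0<..}. F t \<partial>lborel)"
    by (intro nn_integral_mono pointwise)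
  also have "\<dots> \<le> ennreal (m powr P)"
    using z m p False unfolding F_def P_def by (subst (asm) zygmund_finite_exponent_le_iff) auto
  finally have sum_le: "(\<Sum>j<J. c j * (1/2)^j) \<le> m powr P" by simp
  \<comment> \<open>Origin of the 4: one factor 2 bounds 2^\<alpha>, lost between the two ends of a
    cell; the other, raised to the power P, absorbs the 2 from dt / t.\<close>
  have comp: "(2 powr (j * \<alpha>) * (D j / (4 * m))) powr P \<le> 2 / (2 powr P * m powr P) * (c j * (1/2)^j)" for j
  proof -
    have "R j powr \<alpha> = 2 powr \<alpha> * 2 powr (- (j * \<alpha>))"
      by (simp add: R_def powr_mult half_power_powr)
    moreover have "R j powr \<alpha> \<noteq> 0" using R[of j] by simp
    ultimately have "2 powr (j * \<alpha>) = 2 powr \<alpha> / R j powr \<alpha>" by (simp add: powr_minus field_simps)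
    then have "2 powr (j * \<alpha>) * (D j / (4 * m)) = (D j / R j powr \<alpha>) * (2 powr \<alpha> / 2) / (2 * m)"
      by (simp add: mult_ac)
    also have "\<dots> \<le> (D j / R j powr \<alpha>) * 1 / (2 * m)"
      using \<alpha> m D0 powr_mono[of \<alpha> 1 "2::real"] by (intro divide_right_mono mult_left_mono) auto
    finally have "(2 powr (j * \<alpha>) * (D j / (4 * m))) powr P \<le> ((D j / R j powr \<alpha>) / (2 * m)) powr P"
      using D0 m P by (intro powr_mono2) auto
    also have "\<dots> = (D j / R j powr \<alpha>) powr P / (2 powr P * m powr P)"
      using m D0 by (simp add: powr_divide powr_mult)
    also have "(D j / R j powr \<alpha>) powr P = 2 * (c j * (1/2)^j)"
      by (simp add: c_def R_def)
    finally show ?thesis by simp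
  qed
  have "(\<Sum>j<J. (2 powr (j * \<alpha>) * (D j / (4 * m))) powr P) \<le> 2 / (2 powr P * m powr P) * (\<Sum>j<J. c j * (1/2)^j)"
    unfolding sum_distrib_left by (intro sum_mono comp)
  also have "\<dots> \<le> 2 / (2 powr P * m powr P) * m powr P"
    using sum_le m by (intro mult_left_mono) auto
  also have "\<dots> = 2 / 2 powr P" using m by simp
  also have "\<dots> \<le> 1" using powr_mono[of 1 P "2::real"] P by simp
  finally show ?thesis using False by (simp add: lp_ball_def P_def)
qed

lemma dyadic_interval:
  fixes t :: real
  assumes "0 < t" "t \<le> 1"
  obtains j where "(1/2)^Suc j < t" "t \<le> (1/2)^j"
proof -
  obtain n where "(1/2)^n < t" using real_arch_pow_inv[of t "1/2"] assms by auto
  moreover have "\<not> (1/2)^0 < t" using assms by simp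
  ultimately obtain j where "\<not> (1/2)^j < t" "(1/2)^Suc j < t"
    using ex_least_nat_less[of "\<lambda>n. (1/2)^n < t" n] by auto
  then show thesis by (intro that[of j]) auto
qed

text \<open>T is a scalar majorant of the operator norm, for which finite dual sums can be computed.
  Scales up to 1 are recovered from the dual bound, with the loss 2^\<alpha> <= 2. Larger scales use
  only the bound K1, and the decay t^(-\<alpha>) gives a geometric series.\<close>

lemma zygmund_le_of_dual:
  fixes G :: "'a::banach \<Rightarrow> 'a list \<Rightarrow> 'b::banach"
  assumes T: "\<And>x h. multi_norm k (second_diff G h x) \<le> ennreal (T x h)" "\<And>x h. 0 \<le> T x h" "\<And>x h. T x h \<le> K1"
    and dual: "\<And>y J x h. y \<in> lp_polar \<alpha> p \<Longrightarrow> (\<And>j. j < J \<Longrightarrow> norm (h j) \<le> (1/2)^j) \<Longrightarrow> (\<Sum>j<J. y j * T (x j) (h j)) \<le> K"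
    and \<alpha>: "0 < \<alpha>" "\<alpha> \<le> 1" and p: "1 \<le> p"
  shows "zygmund k \<alpha> p G \<le> ennreal (2 * K + 1 / (1 - 2 powr (- \<alpha>)) * K1)"
proof -
  define C :: real where "C = 1 / (1 - 2 powr (- \<alpha>))"
  have q: "2 powr (- \<alpha>) < 1" "0 < 2 powr (- \<alpha>)" using \<alpha> powr_less_mono[of "-\<alpha>" 0 "2::real"] by auto
  have C: "1 \<le> C" using q by (simp add: C_def)
  have K: "0 \<le> K" using dual[OF unit_in_lp_polar[OF p], of 0 "\<lambda>_. 0"] by simp
  have K1: "0 \<le> K1" using order_trans[OF T(2,3)] .
  define a where "a j = Sup {T x h |x h. norm h \<le> (1/2)^j}" for j :: nat
  have bdd: "bdd_above {T x h |x h. norm h \<le> (1/2)^j}" for j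
    by (rule bdd_aboveI[of _ K1]) (use T(3) in auto)
  have ne: "{T x h |x h. norm h \<le> (1/2)^j} \<noteq> {}" for j
    by (auto intro!: exI[of _ 0])
  have T_le_a: "T x h \<le> a j" if "norm h \<le> (1/2)^j" for x h j
    unfolding a_def by (rule cSup_upper[OF _ bdd]) (use that in auto)
  have a0: "0 \<le> a j" for j using T_le_a[of 0 j undefined] T(2) by (auto intro: order_trans)
  have \<eta>_le: "smoothness_modulus k G t \<le> ennreal (a j)" if "t \<le> (1/2)^j" for t j
    unfolding smoothness_modulus_def
    by (intro SUP_least order_trans[OF T(1)] ennreal_leI T_le_a) (use that in auto)
  have \<eta>_le': "smoothness_modulus k G t \<le> ennreal K1" for t
    unfolding smoothness_modulus_def by (intro SUP_least order_trans[OF T(1)] ennreal_leI T(3))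
  have dual_a: "(\<Sum>j<J. y j * a j) \<le> K" if y: "y \<in> lp_polar \<alpha> p" for y J
  proof (rule field_le_epsilon)
    fix e :: real assume e: "0 < e"
    \<comment> \<open>Near-maximisers are taken at all scales at once; their total error, weighted
      by y, stays below e.\<close>
    define \<epsilon> where "\<epsilon> = e / ((\<Sum>j<J. y j) + 1)"
    have y0: "0 \<le> (\<Sum>j<J. y j)" by (intro sum_nonneg lp_polar_nonneg[OF y])
    have \<epsilon>: "0 < \<epsilon>" using e y0 by (simp add: \<epsilon>_def)
    have "\<exists>x h. norm h \<le> (1/2)^j \<and> a j - \<epsilon> \<le> T x h" for j :: nat
    proof -
      have "a j - \<epsilon> < Sup {T x h |x h. norm h \<le> (1/2)^j}" using \<epsilon> by (simp add: a_def)
      then obtain z where "z \<in> {T x h |x h. norm h \<le> (1/2)^j}" "a j - \<epsilon> < z"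
        using less_cSupD[OF ne] by blast
      then show ?thesis by (auto intro: less_imp_le)
    qed
    then obtain x h where xh: "\<And>j. norm (h j) \<le> (1/2)^j" "\<And>j. a j - \<epsilon> \<le> T (x j) (h j)" by metis
    have "(\<Sum>j<J. y j * a j) \<le> (\<Sum>j<J. y j * T (x j) (h j) + \<epsilon> * y j)"
    proof (rule sum_mono)
      fix j
      have "y j * a j \<le> y j * (T (x j) (h j) + \<epsilon>)"
        using xh(2)[of j] lp_polar_nonneg[OF y, of j] by (intro mult_left_mono) auto
      then show "y j * a j \<le> y j * T (x j) (h j) + \<epsilon> * y j" by (simp add: algebra_simps)
    qed
    also have "\<dots> = (\<Sum>j<J. y j * T (x j) (h j)) + \<epsilon> * (\<Sum>j<J. y j)"
      by (simp add: sum.distrib sum_distrib_left)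
    also have "\<dots> \<le> K + e"
    proof (rule add_mono)
      show "(\<Sum>j<J. y j * T (x j) (h j)) \<le> K" by (rule dual[OF y xh(1)])
      have "\<epsilon> * (\<Sum>j<J. y j) \<le> \<epsilon> * ((\<Sum>j<J. y j) + 1)" using \<epsilon> by (intro mult_left_mono) auto
      also have "\<dots> = e" using y0 by (simp add: \<epsilon>_def)
      finally show "\<epsilon> * (\<Sum>j<J. y j) \<le> e" .
    qed
    finally show "(\<Sum>j<J. y j * a j) \<le> K + e" .
  qed
  have half_Suc: "a j / ((1/2)^Suc j) powr \<alpha> = 2 powr \<alpha> * (2 powr (j * \<alpha>) * a j)" for j
  proof -
    have "((1/2::real)^Suc j) powr \<alpha> = 2 powr (- \<alpha>) * 2 powr (- (j * \<alpha>))"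
      by (simp only: half_power_powr powr_add[symmetric]) (simp add: algebra_simps)
    then show ?thesis by (simp add: powr_minus field_simps)
  qed
  have two\<alpha>: "2 powr \<alpha> \<le> (2::real)" using \<alpha> powr_mono[of \<alpha> 1 "2::real"] by simp
  show ?thesis
  proof (cases "p = \<infinity>")
    case True
    have "smoothness_modulus k G t / ennreal (t powr \<alpha>) \<le> ennreal (2 * K + C * K1)" if t: "0 < t" for t
    proof (cases "t \<le> 1")
      case True
      obtain j where j: "(1/2)^Suc j < t" "t \<le> (1/2)^j" using dyadic_interval[OF t True] .
      have "2 powr (j * \<alpha>) * a j = (\<Sum>i<Suc j. (if i = j then 2 powr (j * \<alpha>) else 0) * a i)"
        by simp
      also have "\<dots> \<le> K" by (rule dual_a[OF unit_in_lp_polar[OF p]])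
      finally have aK: "2 powr (j * \<alpha>) * a j \<le> K" .
      have "smoothness_modulus k G t / ennreal (t powr \<alpha>) \<le> ennreal (a j) / ennreal (t powr \<alpha>)"
        by (intro divide_right_mono_ennreal \<eta>_le j)
      also have "\<dots> = ennreal (a j / t powr \<alpha>)" using a0 t by (simp add: divide_ennreal)
      also have "\<dots> \<le> ennreal (a j / ((1/2)^Suc j) powr \<alpha>)"
        using j \<alpha> a0 t by (intro ennreal_leI divide_left_mono powr_mono2) auto
      also have "\<dots> \<le> ennreal (2 * K + C * K1)"
        unfolding half_Suc
      proof (rule ennreal_leI)
        have "2 powr \<alpha> * (2 powr (j * \<alpha>) * a j) \<le> 2 * K"
          using two\<alpha> aK a0 by (intro mult_mono) auto
        then show "2 powr \<alpha> * (2 powr (j * \<alpha>) * a j) \<le> 2 * K + C * K1"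
          using C K1 by (simp add: add_increasing2)
      qed
      finally show ?thesis .
    next
      case False
      have "smoothness_modulus k G t / ennreal (t powr \<alpha>) \<le> ennreal K1 / ennreal (t powr \<alpha>)"
        by (intro divide_right_mono_ennreal \<eta>_le')
      also have "\<dots> = ennreal (K1 / t powr \<alpha>)" using K1 t by (simp add: divide_ennreal)
      also have "\<dots> \<le> ennreal (2 * K + C * K1)"
      proof (rule ennreal_leI)
        have "K1 / t powr \<alpha> \<le> K1 / 1"
          using False \<alpha> K1 by (intro divide_left_mono ge_one_powr_ge_zero) auto
        also have "K1 / 1 \<le> C * K1" using mult_right_mono[OF C K1] by simp
        finally show "K1 / t powr \<alpha> \<le> 2 * K + C * K1" using K by simp
      qed
      finally show ?thesis .
    qed
    then show ?thesis using True by (auto simp: zygmund_def C_def intro!: SUP_least)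
  next
    case False
    define P where "P = enn2real p"
    have P: "1 \<le> P" unfolding P_def using p False by (rule enn2real_ge_1)
    define F where "F t = ennreal_powr (smoothness_modulus k G t / ennreal (t powr \<alpha>)) P / ennreal t" for t
    define c where "c j = (a j / ((1/2)^Suc j) powr \<alpha>) powr P / (1/2)^Suc j" for j :: nat
    define d where "d j = (K1 / (2^j) powr \<alpha>) powr P / 2^j" for j :: nat
    have cd0: "0 \<le> c j" "0 \<le> d j" for j by (simp_all add: c_def d_def)
    have F_le: "F t \<le> ennreal ((b / r powr \<alpha>) powr P / r)"
      if "smoothness_modulus k G t \<le> ennreal b" "0 < r" "r \<le> t" "0 \<le> b" for t b r
    proof -
      have "smoothness_modulus k G t / ennreal (t powr \<alpha>) \<le> ennreal b / ennreal (t powr \<alpha>)"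
        by (intro divide_right_mono_ennreal that)
      also have "\<dots> = ennreal (b / t powr \<alpha>)" using that by (simp add: divide_ennreal)
      also have "\<dots> \<le> ennreal (b / r powr \<alpha>)"
        using that \<alpha> by (intro ennreal_leI divide_left_mono powr_mono2) auto
      finally have "ennreal_powr (smoothness_modulus k G t / ennreal (t powr \<alpha>)) P \<le> ennreal ((b / r powr \<alpha>) powr P)"
        using P that ennreal_powr_mono[of _ "ennreal (b / r powr \<alpha>)" P] by (simp add: ennreal_powr_ennreal)
      then have "F t \<le> ennreal ((b / r powr \<alpha>) powr P) / ennreal t"
        unfolding F_def by (rule divide_right_mono_ennreal)
      also have "\<dots> = ennreal ((b / r powr \<alpha>) powr P / t)" using that by (simp add: divide_ennreal)
      also have "\<dots> \<le> ennreal ((b / r powr \<alpha>) powr P / r)"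
        using that by (intro ennreal_leI divide_left_mono) auto
      finally show ?thesis .
    qed
    \<comment> \<open>A step function above F: the j-th summand covers a cell below 1 and its mirror
      image above 1.\<close>
    define H where "H j t = ennreal (c j) * indicator {(1/2)^Suc j<..(1/2)^j} t + ennreal (d j) * indicator {2^j..<2*2^j} t"
      for j and t :: real
    have term_le: "H j t \<le> (\<Sum>i. H i t)" for j t
      using sum_le_suminf[of "\<lambda>i. H i t" "{j}"] by simp
    have H_int: "(\<integral>\<^sup>+t. H j t \<partial>lborel) = ennreal ((2 powr \<alpha> * (2 powr (j * \<alpha>) * a j)) powr P + (K1 / (2^j) powr \<alpha>) powr P)" for j
    proof -
      have "(\<integral>\<^sup>+t. H j t \<partial>lborel) = ennreal (c j) * emeasure lborel {(1/2::real)^Suc j<..(1/2)^j} + ennreal (d j) * emeasure lborel {2^j..<2*2^j::real}"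
        unfolding H_def by (subst nn_integral_add) (auto simp: nn_integral_cmult_indicator)
      also have "\<dots> = ennreal (c j) * ennreal ((1/2)^Suc j) + ennreal (d j) * ennreal (2^j)"
        by simp
      also have "\<dots> = ennreal (c j * (1/2)^Suc j + d j * 2^j)"
        using cd0 by (simp add: ennreal_mult del: power_Suc)
      finally show ?thesis by (simp add: c_def d_def half_Suc del: power_Suc)
    qed
    have "F t * indicator {0<..} t \<le> (\<Sum>j. H j t)" for t
    proof (cases "0 < t")
      case t: True
      show ?thesis
      proof (cases "t \<le> 1")
        case True
        obtain j where j: "(1/2)^Suc j < t" "t \<le> (1/2)^j" using dyadic_interval[OF t True] .
        have "F t \<le> ennreal (c j)" unfolding c_def
          by (rule F_le) (use j a0 \<eta>_le[OF j(2)] in auto)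
        also have "\<dots> \<le> H j t" using j by (simp add: H_def)
        finally show ?thesis using t term_le[of j t] by simp
      next
        case False
        then have "0 < 1 / t" "1 / t \<le> 1" by auto
        then obtain j where j: "(1/2)^Suc j < 1 / t" "1 / t \<le> (1/2)^j" using dyadic_interval by blast
        then have j: "2^j \<le> t" "t < 2 * 2^j" using t by (auto simp: field_simps power_one_over)
        have "F t \<le> ennreal (d j)" unfolding d_def
          by (rule F_le) (use j K1 \<eta>_le' in auto)
        also have "\<dots> \<le> H j t" using j by (simp add: H_def)
        finally show ?thesis using t term_le[of j t] by simp
      qed
    qed simp
    then have "(\<integral>\<^sup>+t\<in>{0<..}. F t \<partial>lborel) \<le> (\<integral>\<^sup>+t. (\<Sum>j. H j t) \<partial>lborel)"
      by (rule nn_integral_mono)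
    also have "\<dots> = (\<Sum>j. \<integral>\<^sup>+t. H j t \<partial>lborel)"
      by (rule nn_integral_suminf) (simp add: H_def)
    also have "\<dots> = (\<Sum>j. ennreal ((2 powr \<alpha> * (2 powr (j * \<alpha>) * a j)) powr P + (K1 / (2^j) powr \<alpha>) powr P))"
      by (simp only: H_int)
    also have "(\<Sum>j. ennreal ((2 powr \<alpha> * (2 powr (j * \<alpha>) * a j)) powr P + (K1 / (2^j) powr \<alpha>) powr P))
       \<le> ennreal ((2 * K + C * K1) powr P)"
    proof (rule suminf_le_const)
      fix J
      have s1: "(\<Sum>j<J. (2 powr \<alpha> * (2 powr (j * \<alpha>) * a j)) powr P) \<le> (2 * K) powr P"
      proof -
        have "(\<Sum>j<J. (2 powr \<alpha> * (2 powr (j * \<alpha>) * a j)) powr P) = (2 powr \<alpha>) powr P * (\<Sum>j<J. (2 powr (j * \<alpha>) * a j) powr P)"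
          unfolding sum_distrib_left by (intro sum.cong refl) (use a0 in \<open>simp add: powr_mult\<close>)
        also have "\<dots> \<le> 2 powr P * K powr P"
        proof (intro mult_mono)
          show "(\<Sum>j<J. (2 powr (j * \<alpha>) * a j) powr P) \<le> K powr P"
            unfolding P_def by (rule lp_polar_dual[where a = a]) (use a0 p False K dual_a in auto)
          show "(2 powr \<alpha>) powr P \<le> 2 powr P" using two\<alpha> P by (intro powr_mono2) auto
        qed (auto intro: sum_nonneg)
        finally show ?thesis using K by (simp add: powr_mult)
      qed
      \<comment> \<open>Here C is the sum of the series of 2^(-j \<alpha>). Terms at most 1 shrink
        under the power P, and C <= C^P since C is at least 1.\<close>
      have s2: "(\<Sum>j<J. (K1 / (2^j) powr \<alpha>) powr P) \<le> (C * K1) powr P"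
      proof -
        have "(\<Sum>j<J. (K1 / (2^j) powr \<alpha>) powr P) \<le> (\<Sum>j<J. K1 powr P * (2 powr (- \<alpha>))^j)"
        proof (rule sum_mono)
          fix j
          have "1 / (2^j) powr \<alpha> = 2 powr (- (j * \<alpha>))"
            by (simp add: powr_realpow[symmetric] powr_powr powr_minus_divide)
          also have "\<dots> = (2 powr (- \<alpha>))^j"
            by (simp add: powr_power)
          finally have e: "1 / (2^j) powr \<alpha> = (2 powr (- \<alpha>))^j" .
          have "(K1 / (2^j) powr \<alpha>) powr P = (K1 * (2 powr (- \<alpha>))^j) powr P"
            unfolding e[symmetric] by simp
          also have "\<dots> = K1 powr P * ((2 powr (- \<alpha>))^j) powr P" using K1 by (simp add: powr_mult)
          also have "\<dots> \<le> K1 powr P * ((2 powr (- \<alpha>))^j) powr 1"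
            using q P by (intro mult_left_mono powr_mono') (auto intro: power_le_one)
          finally show "(K1 / (2^j) powr \<alpha>) powr P \<le> K1 powr P * (2 powr (- \<alpha>))^j" by simp
        qed
        also have "\<dots> = K1 powr P * ((1 - (2 powr (- \<alpha>))^J) / (1 - 2 powr (- \<alpha>)))"
          using q \<alpha> by (simp add: sum_distrib_left[symmetric] sum_gp_strict)
        also have "\<dots> \<le> K1 powr P * C"
          unfolding C_def using q by (intro mult_left_mono divide_right_mono) auto
        also have "\<dots> \<le> K1 powr P * C powr P"
          using C P powr_mono[of 1 P C] by (intro mult_left_mono) auto
        finally show ?thesis using C K1 by (simp add: powr_mult mult.commute)
      qed
      have "(\<Sum>j<J. (2 powr \<alpha> * (2 powr (j * \<alpha>) * a j)) powr P + (K1 / (2^j) powr \<alpha>) powr P) \<le> (2 * K) powr P + (C * K1) powr P"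
        using s1 s2 by (simp add: sum.distrib add_mono)
      also have "\<dots> \<le> (2 * K + C * K1) powr P"
        using K K1 C P by (intro superadditive_powr) auto
      finally show "(\<Sum>j<J. ennreal ((2 powr \<alpha> * (2 powr (j * \<alpha>) * a j)) powr P + (K1 / (2^j) powr \<alpha>) powr P))
        \<le> ennreal ((2 * K + C * K1) powr P)"
        by (subst sum_ennreal) (auto intro!: ennreal_leI)
    qed simp
    finally show ?thesis
      unfolding C_def[symmetric] F_def P_def
      by (subst zygmund_finite_exponent_le_iff) (use K K1 C p False in auto)
  qed
qed

section \<open>From the Besov norm to scalar components\<close>

text \<open>An increment of step h is half the increment of step 2 h minus half a second difference.
  Doubling until the step reaches size 1, where the sup bound takes over, contracts by 2^(\<gamma> -
  1) each time; this is where \<gamma> < 1 enters. The induction counts the doublings.\<close>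

lemma holder_of_second_diff:
  fixes f :: "'a::real_normed_vector \<Rightarrow> real"
  assumes \<gamma>: "0 < \<gamma>" "\<gamma> < 1" and M: "\<And>x. \<bar>f x\<bar> \<le> M"
    and sdiff: "\<And>x h. norm h \<le> 1 \<Longrightarrow> \<bar>sdiff f x h\<bar> \<le> A * norm h powr \<gamma>"
    and C: "2 * M \<le> C" "A / (2 * (1 - 2 powr (\<gamma> - 1))) \<le> C"
  shows "\<bar>f x - f y\<bar> \<le> C * norm (x - y) powr \<gamma>"
proof -
  define q :: real where "q = 2 powr (\<gamma> - 1)"
  have q: "q < 1" using powr_less_mono[of "\<gamma> - 1" 0 "2::real"] \<gamma> by (simp add: q_def)
  have C0: "0 \<le> C" using M[of x] C(1) by linarith
  \<comment> \<open>A / (2 (1 - q)) is the fixed point of C -> A / 2 + q C, so every larger C is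
    preserved by one doubling.\<close>
  have AC: "A + 2 * (C * q) \<le> 2 * C"
    using C(2) q unfolding q_def[symmetric] by (simp add: field_simps)
  have "\<bar>f (x + h) - f x\<bar> \<le> C * norm h powr \<gamma>" if "(1/2)^k \<le> norm h" for k x h
    using that
  proof (induction k arbitrary: h)
    case 0
    have "\<bar>f (x + h) - f x\<bar> \<le> 2 * M" using M[of "x + h"] M[of x] by linarith
    also have "\<dots> \<le> C * 1" using C by simp
    also have "\<dots> \<le> C * norm h powr \<gamma>"
      using 0 \<gamma> C0 by (intro mult_left_mono ge_one_powr_ge_zero) auto
    finally show ?case .
  next
    case (Suc k)
    show ?case
    proof (cases "norm h \<le> 1")
      case True
      have "(1/2)^k \<le> norm (2 *\<^sub>R h)" using Suc.prems by simp
      then have 2: "\<bar>f (x + 2 *\<^sub>R h) - f x\<bar> \<le> C * norm (2 *\<^sub>R h) powr \<gamma>" by (rule Suc.IH)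
      have "norm (2 *\<^sub>R h) powr \<gamma> = 2 * q * norm h powr \<gamma>"
        by (simp add: powr_mult q_def powr_diff)
      with 2 have 2: "\<bar>f (x + 2 *\<^sub>R h) - f x\<bar> \<le> 2 * (C * q) * norm h powr \<gamma>" by (simp add: mult_ac)
      have "2 * (f (x + h) - f x) = (f (x + 2 *\<^sub>R h) - f x) - sdiff f x h" by (simp add: sdiff_def)
      then have "2 * \<bar>f (x + h) - f x\<bar> \<le> 2 * (C * q) * norm h powr \<gamma> + A * norm h powr \<gamma>"
        using 2 sdiff[OF True, of x] by linarith
      also have "\<dots> = (A + 2 * (C * q)) * norm h powr \<gamma>" by (simp add: algebra_simps)
      also have "\<dots> \<le> 2 * C * norm h powr \<gamma>" using AC by (intro mult_right_mono) auto
      finally show ?thesis by simp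
    next
      case False
      have "\<bar>f (x + h) - f x\<bar> \<le> 2 * M" using M[of "x + h"] M[of x] by linarith
      also have "\<dots> \<le> C * 1" using C by simp
      also have "\<dots> \<le> C * norm h powr \<gamma>"
        using False \<gamma> C0 by (intro mult_left_mono ge_one_powr_ge_zero) auto
      finally show ?thesis .
    qed
  qed
  note main = this
  show ?thesis
  proof (cases "x = y")
    case False
    then obtain k where "(1/2)^k < norm (x - y)" using real_arch_pow_inv[of "norm (x - y)" "1/2"] by auto
    then show ?thesis using main[of k "x - y" y] by simp
  qed simp
qed

text \<open>The mean value theorem on the segment, applied to f minus its linearisation at x, leaves
  an increment of the gradient.\<close>

lemma taylor_of_holder_gradient:
  fixes f :: "'a::euclidean_space \<Rightarrow> real" and A :: real
  assumes d: "\<And>x. (f has_derivative (\<lambda>h. g x \<bullet> h)) (at x)"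
    and g: "\<And>i x y. i \<in> Basis \<Longrightarrow> \<bar>g x \<bullet> i - g y \<bullet> i\<bar> \<le> A * norm (x - y) powr \<gamma>" and \<gamma>: "0 < \<gamma>"
  shows "\<bar>f (x + h) - f x - g x \<bullet> h\<bar> \<le> DIM('a) * A * norm h powr (1 + \<gamma>)"
proof -
  define F where "F t = f (x + t *\<^sub>R h) - t * (g x \<bullet> h)" for t :: real
  have F: "(F has_derivative (\<lambda>s. s * (g (x + t *\<^sub>R h) \<bullet> h - g x \<bullet> h))) (at t within {0..1})" for t
  proof -
    have "((\<lambda>t. f (x + t *\<^sub>R h)) has_derivative (\<lambda>s. g (x + t *\<^sub>R h) \<bullet> (s *\<^sub>R h))) (at t within {0..1})"
      by (rule has_derivative_compose[OF _ d]) (auto intro!: derivative_eq_intros)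
    then show ?thesis
      unfolding F_def by (auto intro!: derivative_eq_intros simp: algebra_simps)
  qed
  obtain b :: 'a where b: "b \<in> Basis" using nonempty_Basis by blast
  have A: "0 \<le> A" using order_trans[OF abs_ge_zero g[OF b, of b 0]] b by simp
  obtain t where t: "0 < t" "t < 1" "F 1 - F 0 = (1 - 0) * (g (x + t *\<^sub>R h) \<bullet> h - g x \<bullet> h)"
    using mvt_simple[of 0 1 F "\<lambda>t s. s * (g (x + t *\<^sub>R h) \<bullet> h - g x \<bullet> h)"] F by auto
  then have "\<bar>f (x + h) - f x - g x \<bullet> h\<bar> = \<bar>(g (x + t *\<^sub>R h) - g x) \<bullet> h\<bar>"
    by (simp add: F_def inner_diff_left)
  also have "\<dots> \<le> DIM('a) * (A * norm h powr \<gamma>) * norm h"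
  proof (rule abs_inner_le_basis)
    fix i :: 'a assume i: "i \<in> Basis"
    have "\<bar>(g (x + t *\<^sub>R h) - g x) \<bullet> i\<bar> \<le> A * norm (t *\<^sub>R h) powr \<gamma>"
      using g[OF i, of "x + t *\<^sub>R h" x] by (simp add: inner_diff_left)
    also have "\<dots> \<le> A * norm h powr \<gamma>"
      using t A \<gamma> by (intro mult_left_mono powr_mono2) (auto simp: mult_left_le_one_le)
    finally show "\<bar>(g (x + t *\<^sub>R h) - g x) \<bullet> i\<bar> \<le> A * norm h powr \<gamma>" .
  qed
  also have "\<dots> = DIM('a) * A * norm h powr (1 + \<gamma>)"
    by (cases "h = 0") (auto simp: powr_add)
  finally show ?thesis .
qed

text \<open>The Besov norm controls second differences of the top derivative only, whereas
  \<open>bes\<close> asks for the Zygmund condition at every level. Below the top it comes for free,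
  since second differences have order 1 + \<gamma>.\<close>

lemma (in besov_scale) bes0_of_taylor:
  fixes f :: "'a::euclidean_space \<Rightarrow> real" and A :: real
  assumes f: "\<And>x. \<bar>f x\<bar> \<le> A" and g: "\<And>i x. i \<in> Basis \<Longrightarrow> \<bar>g x \<bullet> i\<bar> \<le> A"
    and T: "\<And>x h. \<bar>f (x + h) - f x - g x \<bullet> h\<bar> \<le> A * norm h powr (1 + \<gamma>)"
  shows "bb 0 ((DIM('a) + 2 + 2 * S) * A) f"
proof -
  have A: "0 \<le> A" using order_trans[OF abs_ge_zero f] .
  have "1 * A \<le> (DIM('a) + 2 + 2 * S) * A" using A S_nonneg by (intro mult_right_mono) auto
  then have 1: "\<bar>f x\<bar> \<le> (DIM('a) + 2 + 2 * S) * A" for x using order_trans[OF f] by simp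
  have 2: "\<bar>f x - f y\<bar> \<le> (DIM('a) + 2 + 2 * S) * A * norm (x - y) powr \<gamma>" for x y
  proof -
    have "\<bar>f x - f y\<bar> \<le> (DIM('a) + 2) * A * norm (x - y) powr \<gamma>"
    proof (cases "norm (x - y) \<le> 1")
      case True
      have n: "norm (x - y) powr (1 + \<gamma>) \<le> norm (x - y) powr \<gamma>" "norm (x - y) \<le> norm (x - y) powr \<gamma>"
        using powr_mono'[of \<gamma> "1 + \<gamma>" "norm (x - y)"] powr_mono'[of \<gamma> 1 "norm (x - y)"] True gamma_pos gamma_le by auto
      have "\<bar>g y \<bullet> (x - y)\<bar> \<le> DIM('a) * A * norm (x - y)" by (rule abs_inner_le_basis[OF g])
      also have "\<dots> \<le> DIM('a) * A * norm (x - y) powr \<gamma>" using n A by (intro mult_left_mono) auto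
      finally have "\<bar>g y \<bullet> (x - y)\<bar> \<le> DIM('a) * A * norm (x - y) powr \<gamma>" .
      moreover have "\<bar>f (y + (x - y)) - f y - g y \<bullet> (x - y)\<bar> \<le> A * norm (x - y) powr \<gamma>"
        by (rule order_trans[OF T mult_left_mono[OF n(1) A]])
      ultimately have "\<bar>f x - f y\<bar> \<le> DIM('a) * A * norm (x - y) powr \<gamma> + A * norm (x - y) powr \<gamma>" by simp
      also have "\<dots> \<le> (DIM('a) + 2) * A * norm (x - y) powr \<gamma>" using A by (simp add: algebra_simps)
      finally show ?thesis .
    next
      case False
      have "\<bar>f x - f y\<bar> \<le> 2 * A" using f[of x] f[of y] by linarith
      also have "\<dots> \<le> (DIM('a) + 2) * A * 1" using A by (simp add: algebra_simps)
      also have "\<dots> \<le> (DIM('a) + 2) * A * norm (x - y) powr \<gamma>"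
        using False gamma_pos A by (intro mult_left_mono ge_one_powr_ge_zero) auto
      finally show ?thesis .
    qed
    also have "\<dots> \<le> (DIM('a) + 2 + 2 * S) * A * norm (x - y) powr \<gamma>"
      using A S_nonneg by (intro mult_right_mono) auto
    finally show ?thesis .
  qed
  have "zyg_le Y ((DIM('a) + 2 + 2 * S) * A) f"
    unfolding zyg_le_def
  proof (intro ballI allI impI)
    fix y J and x h :: "nat \<Rightarrow> 'a" assume y: "y \<in> Y" and h: "\<forall>j<J. norm (h j) \<le> (1/2)^j"
    have "(\<Sum>j<J. y j * \<bar>sdiff f (x j) (h j)\<bar>) \<le> (\<Sum>j<J. y j * (2 * A * norm (h j) powr (1 + \<gamma>)))"
      by (intro sum_mono mult_left_mono taylor_second_diff[OF T] Y_nonneg[OF y])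
    also have "\<dots> = 2 * A * (\<Sum>j<J. y j * norm (h j) powr (1 + \<gamma>))"
      by (simp add: sum_distrib_left mult_ac)
    also have "\<dots> \<le> 2 * A * S"
    proof (intro mult_left_mono sum_remainder_le[OF y])
      have "\<gamma> * \<gamma> \<le> \<gamma> * 1" using gamma_pos gamma_le by (intro mult_left_mono) auto
      then show "\<gamma> + \<gamma> * \<gamma> \<le> 1 + \<gamma>" using gamma_le by simp
    qed (use h A in auto)
    also have "\<dots> \<le> (DIM('a) + 2 + 2 * S) * A" using A S_nonneg by (simp add: algebra_simps)
    finally show "(\<Sum>j<J. y j * \<bar>sdiff f (x j) (h j)\<bar>) \<le> (DIM('a) + 2 + 2 * S) * A" .
  qed
  with 1 2 show ?thesis by auto
qed

section \<open>From multilinear derivatives to real components\<close>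

lemma bounded_multilinear_linear_Cons:
  assumes "D \<in> bounded_multilinear (Suc k)" "length vs = k"
  shows "linear (\<lambda>h. D (h # vs))"
proof -
  have "\<forall>us ws. Suc (length us + length ws) = Suc k \<longrightarrow> linear (\<lambda>v. D (us @ v # ws))"
    using assms(1) unfolding bounded_multilinear_def by blast
  from this[rule_format, of "[]" vs] show ?thesis using assms(2) by simp
qed

text \<open>Evaluation at a list from the unit ball is dominated by the operator norm, so it turns
  convergence there into ordinary Frechet differentiability.\<close>

lemma has_multi_derivative_component:
  fixes G :: "'a::euclidean_space \<Rightarrow> 'a list \<Rightarrow> 'b::euclidean_space"
  assumes D: "has_multi_derivative k G D x" and vs: "length vs = k" "\<forall>v\<in>set vs. norm v \<le> 1"
  shows "((\<lambda>y. G y vs \<bullet> e) has_derivative (\<lambda>h. D (h # vs) \<bullet> e)) (at x)"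
proof -
  have lin: "bounded_linear (\<lambda>h. D (h # vs))"
    unfolding linear_conv_bounded_linear[symmetric]
    by (rule bounded_multilinear_linear_Cons[OF _ vs(1)]) (use D in \<open>simp only: has_multi_derivative_def\<close>)
  have "((\<lambda>h. ennreal (norm (G (x + h) vs - G x vs - D (h # vs)) / norm h)) \<longlongrightarrow> 0) (at 0)"
  proof (rule tendsto_sandwich[OF _ _ tendsto_const])
    show "((\<lambda>h. multi_norm k (\<lambda>vs. G (x + h) vs - G x vs - D (h # vs)) / ennreal (norm h)) \<longlongrightarrow> 0) (at 0)"
      using D unfolding has_multi_derivative_def by blast
    have "ennreal (norm (G (x + h) vs - G x vs - D (h # vs)) / norm h)
      \<le> multi_norm k (\<lambda>vs. G (x + h) vs - G x vs - D (h # vs)) / ennreal (norm h)" if "h \<noteq> 0" for h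
    proof -
      have "ennreal (norm (G (x + h) vs - G x vs - D (h # vs)) / norm h) = ennreal (norm (G (x + h) vs - G x vs - D (h # vs))) / ennreal (norm h)"
        using that by (simp add: divide_ennreal)
      also have "\<dots> \<le> multi_norm k (\<lambda>vs. G (x + h) vs - G x vs - D (h # vs)) / ennreal (norm h)"
        by (intro divide_right_mono_ennreal multi_norm_upper[of vs k "\<lambda>vs. G (x + h) vs - G x vs - D (h # vs)"] vs)
      finally show ?thesis .
    qed
    then show "\<forall>\<^sub>F h in at 0. ennreal (norm (G (x + h) vs - G x vs - D (h # vs)) / norm h)
      \<le> multi_norm k (\<lambda>vs. G (x + h) vs - G x vs - D (h # vs)) / ennreal (norm h)"
      by (auto simp: eventually_at_filter)
  qed auto
  then have "((\<lambda>h. ennreal (norm (G (x + h) vs - G x vs - D (h # vs)) / norm h)) \<longlongrightarrow> ennreal 0) (at 0)" by simp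
  then have "((\<lambda>h. norm (G (x + h) vs - G x vs - D (h # vs)) / norm h) \<longlongrightarrow> 0) (at 0)"
    by (subst (asm) tendsto_ennreal_iff) auto
  then have "((\<lambda>y. G y vs) has_derivative (\<lambda>h. D (h # vs))) (at x)"
    using lin by (simp add: has_derivative_at)
  then show ?thesis by (rule has_derivative_inner_left)
qed

lemma Cn_kth_deriv:
  assumes "f \<in> Cn n" "k < n"
  shows "has_multi_derivative k (kth_deriv f k) (kth_deriv f (Suc k) x) x"
proof -
  obtain D where D: "has_multi_derivative k (kth_deriv f k) D x" using assms unfolding Cn_def by blast
  then have "kth_deriv f (Suc k) x = D" by (auto intro: has_multi_derivative_unique)
  with D show ?thesis by simp
qed

lemma Cb_norm_component:
  assumes "Cb_norm n f \<le> ennreal m" "0 \<le> m" "k \<le> n" "length vs = k" "\<forall>v\<in>set vs. norm v \<le> 1"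
  shows "norm (kth_deriv f k x vs) \<le> m"
proof -
  have "ennreal (norm (kth_deriv f k x vs)) \<le> multi_norm k (kth_deriv f k x)"
    by (rule multi_norm_upper[OF assms(4,5)])
  also have "\<dots> \<le> (SUP x. multi_norm k (kth_deriv f k x))" by (rule SUP_upper) simp
  also have "\<dots> \<le> Cb_norm n f" unfolding Cb_norm_def by (rule SUP_upper) (use assms(3) in simp)
  also note assms(1)
  finally show ?thesis using assms(2) by simp
qed

lemma Basis_list_norm: "set vs \<subseteq> Basis \<Longrightarrow> \<forall>v\<in>set vs. norm v \<le> 1"
  by (auto simp: norm_Basis)

lemma sdiff_inner: "sdiff (\<lambda>x. G x vs \<bullet> e) x h = second_diff G h x vs \<bullet> e"
  by (simp add: sdiff_def second_diff_def inner_add_left inner_diff_left)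

lemma zyg_le_top_derivative:
  fixes f :: "'a::euclidean_space \<Rightarrow> 'a"
  assumes z: "zygmund n \<alpha> p (kth_deriv f n) \<le> ennreal m" and m: "0 < m" and \<alpha>: "0 < \<alpha>" "\<alpha> \<le> 1" and p: "1 \<le> p"
    and vs: "length vs = n" "set vs \<subseteq> Basis" and e: "e \<in> Basis"
  shows "zyg_le (lp_polar \<alpha> p) (4 * m) (\<lambda>x. kth_deriv f n x vs \<bullet> e)"
  unfolding zyg_le_def
proof (intro ballI allI impI)
  fix y J and x h :: "nat \<Rightarrow> 'a"
  assume y: "y \<in> lp_polar \<alpha> p" and h: "\<forall>j<J. norm (h j) \<le> (1/2)^j"
  define D where "D j = \<bar>sdiff (\<lambda>x. kth_deriv f n x vs \<bullet> e) (x j) (h j)\<bar>" for j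
  have "lp_ball \<alpha> p J (\<lambda>j. D j / (4 * m))"
  proof (rule zygmund_imp_lp_ball[OF z m \<alpha> p])
    fix j assume j: "j < J"
    let ?s = "second_diff (kth_deriv f n) (h j) (x j)"
    have "D j \<le> norm (?s vs)" unfolding D_def sdiff_inner using e by (rule Basis_le_norm)
    then have "ennreal (D j) \<le> ennreal (norm (?s vs))" by (rule ennreal_leI)
    also have "\<dots> \<le> multi_norm n ?s" by (intro multi_norm_upper vs Basis_list_norm)
    also have "\<dots> \<le> (SUP h'\<in>{h'. norm h' \<le> (1/2)^j}. multi_norm n (second_diff (kth_deriv f n) h' (x j)))"
      by (rule SUP_upper) (use h j in simp)
    also have "\<dots> \<le> smoothness_modulus n (kth_deriv f n) ((1/2)^j)"
      unfolding smoothness_modulus_def by (rule SUP_upper) simp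
    finally show "ennreal (D j) \<le> smoothness_modulus n (kth_deriv f n) ((1/2)^j)" .
  qed (simp add: D_def)
  then have "(\<Sum>j<J. y j * (D j / (4 * m))) \<le> 1"
    using m by (intro lp_polarD[OF y]) (auto simp: D_def)
  then show "(\<Sum>j<J. y j * \<bar>sdiff (\<lambda>x. kth_deriv f n x vs \<bullet> e) (x j) (h j)\<bar>) \<le> 4 * m"
    using m by (simp add: D_def sum_divide_distrib[symmetric])
qed

text \<open>The single-scale weight is tested at the dyadic radius next above the norm of h;
  rounding up costs 2^\<alpha> <= 2.\<close>

lemma sdiff_bound_of_zyg_le:
  assumes z: "zyg_le (lp_polar \<alpha> p) K f" and p: "1 \<le> p" and \<alpha>: "0 < \<alpha>" "\<alpha> \<le> 1" and \<gamma>: "\<gamma> \<le> \<alpha>" "0 < \<gamma>" and h: "norm h \<le> 1"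
  shows "\<bar>sdiff f x h\<bar> \<le> 2 * K * norm h powr \<gamma>"
proof (cases "h = 0")
  case False
  then obtain j where j: "(1/2)^Suc j < norm h" "norm h \<le> (1/2)^j" using dyadic_interval[of "norm h"] h by auto
  \<comment> \<open>Zero steps at the other scales satisfy the size constraints, and the weight
    ignores them.\<close>
  define hh where "hh i = (if i = j then h else 0)" for i
  have "(\<Sum>i<Suc j. (if i = j then 2 powr (j * \<alpha>) else 0) * \<bar>sdiff f x (hh i)\<bar>) \<le> K"
    by (rule zyg_leD[OF z unit_in_lp_polar[OF p]]) (use j in \<open>auto simp: hh_def\<close>)
  then have 1: "2 powr (j * \<alpha>) * \<bar>sdiff f x h\<bar> \<le> K" by (simp add: hh_def)
  then have K: "0 \<le> K" by (rule order_trans[rotated]) auto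
  have "2 powr (- (j * \<alpha>)) = 2 powr \<alpha> * ((1/2)^Suc j) powr \<alpha>"
    by (simp only: half_power_powr powr_add[symmetric]) (simp add: algebra_simps)
  also have "\<dots> \<le> 2 * norm h powr \<gamma>"
  proof (rule mult_mono)
    show "2 powr \<alpha> \<le> (2::real)" using \<alpha> powr_mono[of \<alpha> 1 "2::real"] by simp
    have "((1/2)^Suc j) powr \<alpha> \<le> norm h powr \<alpha>" using j \<alpha> by (intro powr_mono2) auto
    also have "\<dots> \<le> norm h powr \<gamma>" using \<gamma> h by (intro powr_mono') auto
    finally show "((1/2)^Suc j) powr \<alpha> \<le> norm h powr \<gamma>" .
  qed auto
  finally have "K * 2 powr (- (j * \<alpha>)) \<le> K * (2 * norm h powr \<gamma>)" using K by (rule mult_left_mono)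
  moreover have "\<bar>sdiff f x h\<bar> \<le> K * 2 powr (- (j * \<alpha>))" using 1 by (simp add: powr_minus field_simps)
  ultimately show ?thesis by simp
qed (simp add: sdiff_def)

locale besov_exponents =
  fixes \<alpha> :: real and p :: ennreal
  assumes \<alpha>: "0 < \<alpha>" "\<alpha> \<le> 1" and p: "1 \<le> p"
begin

definition gam :: real where "gam = \<alpha> / (1 + \<alpha> / 2)"

text \<open>The exponent \<open>\<gamma> = \<alpha> / (1 + \<alpha>/2)\<close> is smaller than \<open>\<alpha>\<close>, so that all functions of Zygmund
  class \<open>\<alpha>\<close> are \<open>\<gamma>\<close>-Hoelder, but so close to \<open>\<alpha>\<close> that \<open>\<gamma> + \<gamma>\<^sup>2 > \<alpha>\<close>.\<close>

lemma gam: "0 < gam" "gam < \<alpha>" "gam < 1" "\<alpha> < gam + gam * gam"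
proof -
  show "0 < gam" "gam < \<alpha>" using \<alpha> by (auto simp: gam_def field_simps)
  then show "gam < 1" using \<alpha> by simp
  have "gam + gam * gam - \<alpha> = \<alpha> * (\<alpha> / 2 - \<alpha> * \<alpha> / 4) / (1 + \<alpha> / 2)^2"
    using \<alpha> by (simp add: gam_def divide_simps power2_eq_square) (simp add: algebra_simps)
  moreover have "0 < \<alpha> / 2 - \<alpha> * \<alpha> / 4" using \<alpha> mult_left_mono[of \<alpha> 1 \<alpha>] by simp
  ultimately have "0 < gam + gam * gam - \<alpha>" using \<alpha> by simp
  then show "\<alpha> < gam + gam * gam" by simp
qed

text \<open>The geometric constant of \<open>lp_polar_sum\<close> at \<beta> =
  \<open>gam + gam * gam\<close>.\<close>

definition zyg_const :: real where "zyg_const = 1 / (1 - 2 powr (\<alpha> - (gam + gam * gam)))"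

sublocale besov_scale gam zyg_const "lp_polar \<alpha> p"
proof
  have "2 powr (\<alpha> - (gam + gam * gam)) < (1::real)"
    using gam powr_less_mono[of "\<alpha> - (gam + gam * gam)" 0 "2::real"] by simp
  then show "0 \<le> zyg_const" by (simp add: zyg_const_def)
  show "(\<Sum>j<J. y j * ((1/2)^j) powr (gam + gam * gam)) \<le> zyg_const" if "y \<in> lp_polar \<alpha> p" for y J
    unfolding zyg_const_def by (rule lp_polar_sum[OF that gam(4) p])
qed (use gam lp_polar_nonneg in auto)

text \<open>The recursion of \<open>bes\<close> is filled in from the top: the derivative of order n
  gives level 0 by the Zygmund condition, and each lower order gains one level, its gradient
  consisting of components of the next derivative.\<close>

lemma besov_imp_bes:
  "\<exists>C>0. \<forall>m>0. \<forall>f :: 'a::euclidean_space \<Rightarrow> 'a. f \<in> Cn n \<longrightarrow> besov_norm n \<alpha> p f \<le> ennreal m \<longrightarrow>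
     (\<forall>e\<in>Basis. bb n (C * m) (\<lambda>x. f x \<bullet> e))"
proof -
  have "\<exists>C\<ge>1. \<forall>m>0. \<forall>f :: 'a \<Rightarrow> 'a. \<forall>vs. \<forall>e\<in>Basis. f \<in> Cn n \<longrightarrow> besov_norm n \<alpha> p f \<le> ennreal m \<longrightarrow>
      length vs = n - k \<longrightarrow> set vs \<subseteq> Basis \<longrightarrow> bb k (C * m) (\<lambda>x. kth_deriv f (n - k) x vs \<bullet> e)"
    if "k \<le> n" for k
    using that
  proof (induction k)
    case 0
    \<comment> \<open>The 4 is the loss in \<open>zyg_le_top_derivative\<close>. It doubles to 8 in
      the bound on single second differences, and the quotient is the fixed point from
      \<open>holder_of_second_diff\<close>.\<close>
    define C where "C = 4 + 8 / (2 * (1 - 2 powr (gam - 1)))"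
    have q: "2 powr (gam - 1) < (1::real)" using powr_less_mono[of "gam - 1" 0 "2::real"] gam by simp
    then have C: "4 \<le> C" "8 / (2 * (1 - 2 powr (gam - 1))) \<le> C" by (auto simp: C_def)
    have "bb 0 (C * m) (\<lambda>x. kth_deriv f n x vs \<bullet> e)"
      if m: "0 < m" and e: "e \<in> Basis" and b: "besov_norm n \<alpha> p f \<le> ennreal m"
      and vs: "length vs = n" "set vs \<subseteq> Basis" for m vs e and f :: "'a \<Rightarrow> 'a"
    proof -
      let ?F = "\<lambda>x. kth_deriv f n x vs \<bullet> e"
      have F: "\<bar>?F x\<bar> \<le> m" for x
        using order_trans[OF Basis_le_norm[OF e] Cb_norm_component[OF _ _ order_refl vs(1) Basis_list_norm[OF vs(2)]]] b m
        by (simp add: besov_norm_def)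
      have z: "zyg_le (lp_polar \<alpha> p) (4 * m) ?F"
        using b by (intro zyg_le_top_derivative m \<alpha> p vs e) (simp add: besov_norm_def)
      have "\<bar>?F x - ?F y\<bar> \<le> C * m * norm (x - y) powr gam" for x y
      proof (rule holder_of_second_diff[OF gam(1,3) F])
        show "\<bar>sdiff ?F x h\<bar> \<le> 8 * m * norm h powr gam" if "norm h \<le> 1" for x h
          using sdiff_bound_of_zyg_le[OF z p \<alpha> _ gam(1) that, of x] gam by simp
        show "2 * m \<le> C * m" using C m by (intro mult_right_mono) auto
        have "8 * m / (2 * (1 - 2 powr (gam - 1))) = 8 / (2 * (1 - 2 powr (gam - 1))) * m" by simp
        also have "\<dots> \<le> C * m" using C m by (intro mult_right_mono) auto
        finally show "8 * m / (2 * (1 - 2 powr (gam - 1))) \<le> C * m" .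
      qed
      moreover have "\<bar>?F x\<bar> \<le> C * m" for x
        using F[of x] C m mult_right_mono[of 1 C m] by linarith
      moreover have "zyg_le (lp_polar \<alpha> p) (C * m) ?F"
        using z C m mult_right_mono[OF C(1), of m] unfolding zyg_le_def by (meson order_trans less_imp_le)
      ultimately show ?thesis by simp
    qed
    then show ?case using C by (intro exI[of _ C]) auto
  next
    case (Suc k)
    then obtain C where C: "1 \<le> C" "\<And>m f vs e. 0 < m \<Longrightarrow> e \<in> Basis \<Longrightarrow> f \<in> Cn n \<Longrightarrow> besov_norm n \<alpha> p f \<le> ennreal m \<Longrightarrow>
      length vs = n - k \<Longrightarrow> set vs \<subseteq> Basis \<Longrightarrow> bb k (C * m) (\<lambda>x::'a. kth_deriv f (n - k) x vs \<bullet> (e::'a))"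
      by (metis Suc_leD)
    define j where "j = n - Suc k"
    have j: "n - k = Suc j" "j < n" using Suc.prems by (auto simp: j_def)
    define C' where "C' = (DIM('a) + 2 + 2 * zyg_const) * (DIM('a) * C)"
    have DC: "1 \<le> DIM('a) * C" "C \<le> DIM('a) * C"
      using C mult_mono[of 1 "real DIM('a)" 1 C] mult_right_mono[of 1 "real DIM('a)" C] by (auto simp: DIM_ge_Suc0 Suc_leI)
    have C': "DIM('a) * C \<le> C'"
      using mult_right_mono[of 1 "DIM('a) + 2 + 2 * zyg_const" "DIM('a) * C"] DC S_nonneg by (simp add: C'_def)
    have "bb (Suc k) (C' * m) (\<lambda>x. kth_deriv f j x vs \<bullet> e)"
      if m: "0 < m" and e: "e \<in> Basis" and f: "f \<in> Cn n" and b: "besov_norm n \<alpha> p f \<le> ennreal m"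
      and vs: "length vs = j" "set vs \<subseteq> Basis" for m vs e and f :: "'a \<Rightarrow> 'a"
    proof -
      let ?F = "\<lambda>x. kth_deriv f j x vs \<bullet> e"
      \<comment> \<open>The direction of differentiation is the head of the argument list, so the
        partial derivatives are the values at i # vs.\<close>
      define g where "g x = (\<Sum>i\<in>Basis. (kth_deriv f (Suc j) x (i # vs) \<bullet> e) *\<^sub>R i)" for x
      have gi: "g x \<bullet> i = kth_deriv f (Suc j) x (i # vs) \<bullet> e" if "i \<in> Basis" for x i
        using that by (simp add: g_def)
      have bg: "bb k (C * m) (\<lambda>x. g x \<bullet> i)" if i: "i \<in> Basis" for i
        unfolding gi[OF i] using C(2)[OF m e f b, of "i # vs"] vs i j by simp
      have F: "\<bar>?F x\<bar> \<le> m" for x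
        by (rule order_trans[OF Basis_le_norm[OF e] Cb_norm_component[OF _ _ _ vs(1) Basis_list_norm[OF vs(2)]]])
          (use b m j in \<open>auto simp: besov_norm_def\<close>)
      have d: "(?F has_derivative (\<lambda>h. g x \<bullet> h)) (at x)" for x
      proof -
        have D: "has_multi_derivative j (kth_deriv f j) (kth_deriv f (Suc j) x) x"
          by (rule Cn_kth_deriv[OF f j(2)])
        have "linear (\<lambda>h. kth_deriv f (Suc j) x (h # vs))"
          by (rule bounded_multilinear_linear_Cons[OF _ vs(1)]) (use D in \<open>simp only: has_multi_derivative_def\<close>)
        then have lin: "linear (\<lambda>h. kth_deriv f (Suc j) x (h # vs) \<bullet> e)"
          by (simp add: linear_iff inner_add_left)
        have "kth_deriv f (Suc j) x (h # vs) \<bullet> e = g x \<bullet> h" for h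
        proof -
          have "kth_deriv f (Suc j) x (h # vs) \<bullet> e = kth_deriv f (Suc j) x ((\<Sum>i\<in>Basis. (h \<bullet> i) *\<^sub>R i) # vs) \<bullet> e"
            by (simp add: euclidean_representation)
          also have "\<dots> = (\<Sum>i\<in>Basis. (h \<bullet> i) * (kth_deriv f (Suc j) x (i # vs) \<bullet> e))"
            using linear_sum[OF lin, of "\<lambda>i. (h \<bullet> i) *\<^sub>R i" Basis] linear_scale[OF lin] by simp
          also have "\<dots> = g x \<bullet> h" unfolding g_def inner_sum_left
            by (intro sum.cong) (auto simp: inner_commute)
          finally show ?thesis .
        qed
        then show ?thesis
          using has_multi_derivative_component[OF D vs(1) Basis_list_norm[OF vs(2)], of e] by simp
      qed
      have T: "\<bar>?F (x + h) - ?F x - g x \<bullet> h\<bar> \<le> DIM('a) * C * m * norm h powr (1 + gam)" for x h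
        using taylor_of_holder_gradient[OF d bes_holder[OF bg] gam(1), of x h] by (simp add: mult_ac)
      show ?thesis
      proof (rule bes_SucI)
        have "bb 0 ((DIM('a) + 2 + 2 * zyg_const) * (DIM('a) * C * m)) ?F"
        proof (rule bes0_of_taylor[OF _ _ T])
          show "\<bar>?F x\<bar> \<le> DIM('a) * C * m" for x
          proof (rule order_trans[OF F])
            have "1 * m \<le> DIM('a) * C * m" using DC(1) m by (intro mult_right_mono) auto
            then show "m \<le> DIM('a) * C * m" by simp
          qed
          show "\<bar>g x \<bullet> i\<bar> \<le> DIM('a) * C * m" if "i \<in> Basis" for i x
            using bes_bound[OF bg[OF that], of x] mult_right_mono[OF DC(2), of m] m by simp
        qed
        then show "bb 0 (C' * m) ?F" by (simp only: C'_def mult.assoc)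
        show "\<bar>?F (x + h) - ?F x - g x \<bullet> h\<bar> \<le> C' * m * norm h powr (1 + gam)" for x h
          using C' m by (intro order_trans[OF T] mult_right_mono) auto
        show "bb k (C' * m) (\<lambda>x. g x \<bullet> i)" if "i \<in> Basis" for i
          by (rule bes_mono[OF bg[OF that]]) (use C' DC m in \<open>auto intro!: mult_right_mono\<close>)
      qed
    qed
    then show ?case using C' DC unfolding j_def by (intro exI[of _ C']) auto
  qed
  from this[of n] obtain C where C: "1 \<le> C" "\<forall>m>0. \<forall>f :: 'a \<Rightarrow> 'a. \<forall>vs. \<forall>e\<in>Basis. f \<in> Cn n \<longrightarrow> besov_norm n \<alpha> p f \<le> ennreal m \<longrightarrow>
      length vs = 0 \<longrightarrow> set vs \<subseteq> Basis \<longrightarrow> bb n (C * m) (\<lambda>x. kth_deriv f 0 x vs \<bullet> e)" by auto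
  have "bb n (C * m) (\<lambda>x. f x \<bullet> e)"
    if "0 < m" "f \<in> Cn n" "besov_norm n \<alpha> p f \<le> ennreal m" "e \<in> Basis" for m e and f :: "'a \<Rightarrow> 'a"
    using C(2)[rule_format, of m e f "[]"] that by simp
  then show ?thesis using C(1) by (intro exI[of _ C]) auto
qed

end

section \<open>From scalar components to the Besov norm\<close>

text \<open>The multilinear map with prescribed values on lists of basis vectors, by expansion of
  one argument at a time.\<close>

primrec multilinear_ext :: "('a::euclidean_space list \<Rightarrow> 'b::real_vector) \<Rightarrow> 'a list \<Rightarrow> 'b" where
  "multilinear_ext c [] = c []"
| "multilinear_ext c (v # vs) = (\<Sum>b\<in>Basis. (v \<bullet> b) *\<^sub>R multilinear_ext (\<lambda>bs. c (b # bs)) vs)"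

definition basis_lists :: "nat \<Rightarrow> 'a::euclidean_space list set" where
  "basis_lists k = {bs. set bs \<subseteq> Basis \<and> length bs = k}"

lemma finite_basis_lists [simp]: "finite (basis_lists k)"
  unfolding basis_lists_def by (rule finite_lists_length_eq) simp

lemma basis_lists_0 [simp]: "basis_lists 0 = {[]}"
  by (auto simp: basis_lists_def)

lemma basis_lists_Suc: "basis_lists (Suc k) = (\<lambda>(b, bs). b # bs) ` (Basis \<times> basis_lists k)"
  by (force simp: basis_lists_def length_Suc_conv image_iff)

lemma sum_basis_lists_Suc: "sum F (basis_lists (Suc k)) = (\<Sum>b\<in>Basis. \<Sum>bs\<in>basis_lists k. F (b # bs))"
  unfolding basis_lists_Suc
  by (subst sum.reindex) (auto simp: inj_on_def sum.cartesian_product intro!: sum.cong)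

lemma multilinear_ext_add: "multilinear_ext (\<lambda>bs. c bs + d bs) vs = multilinear_ext c vs + multilinear_ext d vs"
  by (induction vs arbitrary: c d) (simp_all add: scaleR_right_distrib sum.distrib)

lemma multilinear_ext_scaleR: "multilinear_ext (\<lambda>bs. r *\<^sub>R c bs) vs = r *\<^sub>R multilinear_ext c vs"
  by (induction vs arbitrary: c) (simp_all add: scaleR_sum_right mult.commute)

lemma multilinear_ext_diff: "multilinear_ext (\<lambda>bs. c bs - d bs) vs = multilinear_ext c vs - multilinear_ext d vs"
  by (induction vs arbitrary: c d) (simp_all add: scaleR_right_diff_distrib sum_subtractf)

lemma multilinear_ext_sum: "finite A \<Longrightarrow> multilinear_ext (\<lambda>bs. \<Sum>a\<in>A. c a bs) vs = (\<Sum>a\<in>A. multilinear_ext (c a) vs)"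
proof (induction A rule: finite_induct)
  case empty
  show ?case using multilinear_ext_scaleR[of 0 "\<lambda>_. 0" vs] by simp
qed (simp add: multilinear_ext_add)

lemma norm_multilinear_ext_le:
  fixes c :: "'a::euclidean_space list \<Rightarrow> 'b::real_normed_vector"
  assumes "\<forall>v\<in>set vs. norm v \<le> 1"
  shows "norm (multilinear_ext c vs) \<le> (\<Sum>bs\<in>basis_lists (length vs). norm (c bs))"
  using assms
proof (induction vs arbitrary: c)
  case Nil
  show ?case by simp
next
  case (Cons v vs)
  have "norm (multilinear_ext c (v # vs)) \<le> (\<Sum>b\<in>Basis. norm ((v \<bullet> b) *\<^sub>R multilinear_ext (\<lambda>bs. c (b # bs)) vs))"
    unfolding multilinear_ext.simps by (rule norm_sum)
  also have "\<dots> \<le> (\<Sum>b\<in>Basis. 1 * (\<Sum>bs\<in>basis_lists (length vs). norm (c (b # bs))))"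
    unfolding norm_scaleR
  proof (intro sum_mono mult_mono)
    fix b :: 'a assume "b \<in> Basis"
    then show "\<bar>v \<bullet> b\<bar> \<le> 1" using Basis_le_norm[of b v] Cons.prems by simp
    show "norm (multilinear_ext (\<lambda>bs. c (b # bs)) vs) \<le> (\<Sum>bs\<in>basis_lists (length vs). norm (c (b # bs)))"
      using Cons by simp
  qed auto
  finally show ?case by (simp add: sum_basis_lists_Suc)
qed

lemma linear_multilinear_ext: "linear (\<lambda>v. multilinear_ext c (us @ v # ws))"
proof (induction us arbitrary: c)
  case Nil
  show ?case
    by (rule linearI)
      (simp_all add: inner_add_left scaleR_left_distrib sum.distrib scaleR_sum_right)
next
  case (Cons a us)
  have "linear (\<lambda>v. \<Sum>b\<in>Basis. (a \<bullet> b) *\<^sub>R multilinear_ext (\<lambda>bs. c (b # bs)) (us @ v # ws))"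
    by (intro linear_compose_sum linear_compose_scale_right ballI Cons.IH)
  then show ?case by simp
qed

section \<open>Derivatives assembled from iterated partial derivatives\<close>

lemma multi_norm_leI:
  assumes "\<And>vs. length vs = k \<Longrightarrow> \<forall>v\<in>set vs. norm v \<le> 1 \<Longrightarrow> norm (T vs) \<le> B"
  shows "multi_norm k T \<le> ennreal B"
  unfolding multi_norm_def by (intro SUP_least ennreal_leI) (use assms in auto)

primrec partials :: "('a::euclidean_space \<Rightarrow> 'b::euclidean_space) \<Rightarrow> 'a list \<Rightarrow> 'a \<Rightarrow> 'b" where
  "partials f [] = f"
| "partials f (i # bs) = (\<lambda>x. frechet_derivative (partials f bs) (at x) i)"

text \<open>The value 0 on lists of the wrong length matches the normalisation of
  \<open>bounded_multilinear\<close>, so that the jet can equal \<open>kth_deriv\<close> as a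
  function on all lists.\<close>

definition jet :: "('a::euclidean_space \<Rightarrow> 'b::euclidean_space) \<Rightarrow> nat \<Rightarrow> 'a \<Rightarrow> 'a list \<Rightarrow> 'b" where
  "jet f k x = (\<lambda>vs. if length vs = k then multilinear_ext (\<lambda>bs. partials f bs x) vs else 0)"

context besov_exponents
begin

definition vec_bes :: "nat \<Rightarrow> real \<Rightarrow> ('a::euclidean_space \<Rightarrow> 'b::euclidean_space) \<Rightarrow> bool" where
  "vec_bes n K f \<longleftrightarrow> (\<forall>e\<in>Basis. bb n K (\<lambda>x. f x \<bullet> e))"

lemma tendsto_norm_powr_gam:
  "((\<lambda>h::'a::real_normed_vector. C * norm (h - x) powr gam) \<longlongrightarrow> 0) (at x)"
proof -
  have "((\<lambda>h::'a. C * norm (h - x) powr gam) \<longlongrightarrow> C * norm (x - x) powr gam) (at x)"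
    by (intro tendsto_intros tendsto_powr') (use gam in auto)
  then show ?thesis by simp
qed

lemma vec_bes_nonneg:
  fixes f :: "'a::euclidean_space \<Rightarrow> 'b::euclidean_space"
  assumes "vec_bes n K f"
  shows "0 \<le> K"
proof -
  obtain e :: 'b where "e \<in> Basis" using nonempty_Basis by blast
  then have "bb n K (\<lambda>x. f x \<bullet> e)" using assms by (simp add: vec_bes_def)
  then show ?thesis by (rule bes_nonneg)
qed

lemma vec_bes_norm_le:
  fixes f :: "'a::euclidean_space \<Rightarrow> 'b::euclidean_space" and K :: real
  assumes "vec_bes n K f"
  shows "norm (f x) \<le> DIM('b) * K"
proof -
  have "norm (f x) \<le> (\<Sum>e\<in>Basis. \<bar>f x \<bullet> e\<bar>)" by (rule norm_le_l1)
  also have "\<dots> \<le> DIM('b) * K"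
    using assms by (intro sum_bounded_above) (auto simp: vec_bes_def intro: bes_bound)
  finally show ?thesis .
qed

lemma vec_bes_holder:
  fixes f :: "'a::euclidean_space \<Rightarrow> 'b::euclidean_space" and K :: real
  assumes "vec_bes n K f"
  shows "norm (f x - f y) \<le> DIM('b) * (K * norm (x - y) powr gam)"
proof -
  have "norm (f x - f y) \<le> (\<Sum>e\<in>Basis. \<bar>(f x - f y) \<bullet> e\<bar>)" by (rule norm_le_l1)
  also have "\<dots> \<le> DIM('b) * (K * norm (x - y) powr gam)"
  proof (rule sum_bounded_above)
    fix e :: 'b assume "e \<in> Basis"
    then have "bb n K (\<lambda>x. f x \<bullet> e)" using assms by (simp add: vec_bes_def)
    then show "\<bar>(f x - f y) \<bullet> e\<bar> \<le> K * norm (x - y) powr gam"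
      unfolding inner_diff_left by (rule bes_holder)
  qed
  finally show ?thesis .
qed

text \<open>The gradients of the components assemble to a Frechet derivative. By its uniqueness the
  witnesses hidden in \<open>bes\<close> become values of \<open>frechet_derivative\<close>, and
  their class membership passes to the partial derivatives.\<close>

lemma vec_bes_Suc:
  fixes f :: "'a::euclidean_space \<Rightarrow> 'b::euclidean_space" and K :: real
  assumes f: "vec_bes (Suc n) K f"
  shows "norm (f (x + h) - f x - (\<Sum>i\<in>Basis. (h \<bullet> i) *\<^sub>R frechet_derivative f (at x) i)) \<le> DIM('b) * (K * norm h powr (1 + gam))"
    and "i \<in> Basis \<Longrightarrow> vec_bes n K (\<lambda>x. frechet_derivative f (at x) i)"
proof -
  have "\<forall>e\<in>Basis. \<exists>g. (\<forall>x h. \<bar>f (x + h) \<bullet> e - f x \<bullet> e - g x \<bullet> h\<bar> \<le> K * norm h powr (1 + gam)) \<and>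
       (\<forall>i\<in>Basis. bb n K (\<lambda>x. g x \<bullet> i))"
  proof
    fix e :: 'b assume "e \<in> Basis"
    then have "bb (Suc n) K (\<lambda>x. f x \<bullet> e)" using f by (simp add: vec_bes_def)
    from bes_SucE[OF this] show "\<exists>g. (\<forall>x h. \<bar>f (x + h) \<bullet> e - f x \<bullet> e - g x \<bullet> h\<bar> \<le> K * norm h powr (1 + gam)) \<and>
       (\<forall>i\<in>Basis. bb n K (\<lambda>x. g x \<bullet> i))" by metis
  qed
  then obtain g where g: "\<And>e x h. e \<in> Basis \<Longrightarrow> \<bar>f (x + h) \<bullet> e - f x \<bullet> e - g e x \<bullet> h\<bar> \<le> K * norm h powr (1 + gam)"
    "\<And>e i. e \<in> Basis \<Longrightarrow> i \<in> Basis \<Longrightarrow> bb n K (\<lambda>x. g e x \<bullet> i)" unfolding bchoice_iff by metis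
  define D where "D x h = (\<Sum>e\<in>Basis. (g e x \<bullet> h) *\<^sub>R e)" for x h
  have De: "D x h \<bullet> e = g e x \<bullet> h" if "e \<in> Basis" for x h e
    using that by (simp add: D_def)
  have lin: "bounded_linear (D x)" for x
    unfolding D_def by (intro bounded_linear_sum bounded_linear_scaleR_const bounded_linear_inner_right)
  have T: "norm (f (x + h) - f x - D x h) \<le> DIM('b) * (K * norm h powr (1 + gam))" for x h
  proof -
    have "norm (f (x + h) - f x - D x h) \<le> (\<Sum>e\<in>Basis. \<bar>(f (x + h) - f x - D x h) \<bullet> e\<bar>)" by (rule norm_le_l1)
    also have "\<dots> \<le> DIM('b) * (K * norm h powr (1 + gam))"
      using g(1) by (intro sum_bounded_above) (auto simp: inner_diff_left De)
    finally show ?thesis .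
  qed
  have "(f has_derivative D x) (at x)" for x
    unfolding has_derivative_at
  proof (intro conjI lin)
    show "((\<lambda>h. norm (f (x + h) - f x - D x h) / norm h) \<longlongrightarrow> 0) (at 0)"
    proof (rule Lim_null_comparison[where g = "\<lambda>h. DIM('b) * K * norm (h - 0) powr gam", OF _ tendsto_norm_powr_gam])
      have "norm (norm (f (x + h) - f x - D x h) / norm h) \<le> DIM('b) * K * norm (h - 0) powr gam" if "h \<noteq> 0" for h
      proof -
        have "norm (f (x + h) - f x - D x h) / norm h \<le> (DIM('b) * (K * norm h powr (1 + gam))) / norm h"
          by (intro divide_right_mono T) simp
        also have "\<dots> = DIM('b) * K * norm h powr gam" using that by (simp add: powr_add)
        finally show ?thesis by simp
      qed
      then show "\<forall>\<^sub>F h in at 0. norm (norm (f (x + h) - f x - D x h) / norm h) \<le> DIM('b) * K * norm (h - 0) powr gam"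
        by (auto simp: eventually_at_filter)
    qed
  qed
  then have fd: "frechet_derivative f (at x) = D x" for x by (rule frechet_derivative_at[symmetric])
  have "D x h = D x (\<Sum>i\<in>Basis. (h \<bullet> i) *\<^sub>R i)" by (simp add: euclidean_representation)
  also have "\<dots> = (\<Sum>i\<in>Basis. (h \<bullet> i) *\<^sub>R D x i)"
    using lin[THEN bounded_linear.linear] by (simp add: linear_sum linear_scale)
  finally show "norm (f (x + h) - f x - (\<Sum>i\<in>Basis. (h \<bullet> i) *\<^sub>R frechet_derivative f (at x) i)) \<le> DIM('b) * (K * norm h powr (1 + gam))"
    using T[of x h] by (simp add: fd)
  show "vec_bes n K (\<lambda>x. frechet_derivative f (at x) i)" if "i \<in> Basis"
    using g(2) that by (simp add: vec_bes_def fd De)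
qed

lemma vec_bes_partials:
  fixes f :: "'a::euclidean_space \<Rightarrow> 'b::euclidean_space" and K :: real
  assumes "vec_bes n K f" "set bs \<subseteq> Basis" "length bs \<le> n"
  shows "vec_bes (n - length bs) K (partials f bs)"
  using assms(2,3)
proof (induction bs)
  case Nil then show ?case using assms(1) by simp
next
  case (Cons i bs)
  then have "vec_bes (n - length bs) K (partials f bs)" by simp
  moreover have "n - length bs = Suc (n - length (i # bs))" using Cons.prems by simp
  ultimately show ?case using vec_bes_Suc(2)[of "n - length (i # bs)" K "partials f bs" i] Cons.prems by simp
qed

lemma norm_jet_le:
  fixes c :: "'a::euclidean_space list \<Rightarrow> 'b::euclidean_space" and B :: real
  assumes "\<And>bs. bs \<in> basis_lists k \<Longrightarrow> norm (c bs) \<le> B" "length vs = k" "\<forall>v\<in>set vs. norm v \<le> 1"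
  shows "norm (multilinear_ext c vs) \<le> card (basis_lists k :: 'a list set) * B"
proof -
  have "norm (multilinear_ext c vs) \<le> (\<Sum>bs\<in>basis_lists k. norm (c bs))" using norm_multilinear_ext_le[OF assms(3), of c] assms(2) by simp
  also have "\<dots> \<le> card (basis_lists k :: 'a list set) * B" by (rule sum_bounded_above[OF assms(1)])
  finally show ?thesis .
qed

lemma multi_norm_jet_le:
  fixes f :: "'a::euclidean_space \<Rightarrow> 'b::euclidean_space" and K :: real
  assumes "vec_bes n K f" "k \<le> n"
  shows "multi_norm k (jet f k x) \<le> ennreal (card (basis_lists k :: 'a list set) * (DIM('b) * K))"
proof (rule multi_norm_leI)
  fix vs :: "'a list" assume "length vs = k" "\<forall>v\<in>set vs. norm v \<le> 1"
  then have "norm (multilinear_ext (\<lambda>bs. partials f bs x) vs) \<le> card (basis_lists k :: 'a list set) * (DIM('b) * K)"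
    using assms by (intro norm_jet_le vec_bes_norm_le[OF vec_bes_partials[OF assms(1)]]) (auto simp: basis_lists_def)
  then show "norm (jet f k x vs) \<le> card (basis_lists k :: 'a list set) * (DIM('b) * K)"
    using \<open>length vs = k\<close> by (simp add: jet_def)
qed

lemma jet_in_bounded_multilinear:
  fixes f :: "'a::euclidean_space \<Rightarrow> 'b::euclidean_space" and K :: real
  assumes "vec_bes n K f" "k \<le> n"
  shows "jet f k x \<in> bounded_multilinear k"
  unfolding bounded_multilinear_def
proof (intro CollectI conjI allI impI)
  fix us ws :: "'a list" assume "Suc (length us + length ws) = k"
  then have "(\<lambda>v. jet f k x (us @ v # ws)) = (\<lambda>v. multilinear_ext (\<lambda>bs. partials f bs x) (us @ v # ws))"
    by (auto simp: jet_def)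
  then show "linear (\<lambda>v. jet f k x (us @ v # ws))" using linear_multilinear_ext by simp
next
  show "multi_norm k (jet f k x) < \<infinity>"
    using multi_norm_jet_le[OF assms, of x] by (simp add: le_less_trans)
qed (simp add: jet_def)

text \<open>The remainder of the jet is the multilinear extension of the Taylor remainders of
  finitely many partial derivatives, each of order 1 + \<gamma>. \<open>partials\<close> puts the
  newest direction at the head, as \<open>has_multi_derivative\<close> does.\<close>

lemma jet_has_multi_derivative:
  fixes f :: "'a::euclidean_space \<Rightarrow> 'b::euclidean_space" and K :: real
  assumes f: "vec_bes n K f" and k: "k < n"
  shows "has_multi_derivative k (jet f k) (jet f (Suc k) x) x"
  unfolding has_multi_derivative_def
proof
  show "jet f (Suc k) x \<in> bounded_multilinear (Suc k)"
    using k by (intro jet_in_bounded_multilinear[OF f]) simp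
  let ?N = "\<lambda>h. multi_norm k (\<lambda>vs. jet f k (x + h) vs - jet f k x vs - jet f (Suc k) x (h # vs))"
  define C where "C = card (basis_lists k :: 'a list set) * (DIM('b) * K)"
  have C0: "0 \<le> C"
    unfolding C_def using vec_bes_nonneg[OF f] by simp
  have N: "?N h \<le> ennreal (C * norm h powr (1 + gam))" for h
  proof (rule multi_norm_leI)
    fix vs :: "'a list" assume vs: "length vs = k" "\<forall>v\<in>set vs. norm v \<le> 1"
    have eq: "jet f k (x + h) vs - jet f k x vs - jet f (Suc k) x (h # vs)
      = multilinear_ext (\<lambda>bs. partials f bs (x + h) - partials f bs x - (\<Sum>i\<in>Basis. (h \<bullet> i) *\<^sub>R partials f (i # bs) x)) vs"
      using vs by (simp add: jet_def multilinear_ext_diff multilinear_ext_sum multilinear_ext_scaleR del: partials.simps)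
    have "norm (jet f k (x + h) vs - jet f k x vs - jet f (Suc k) x (h # vs)) \<le> card (basis_lists k :: 'a list set) * (DIM('b) * (K * norm h powr (1 + gam)))"
      unfolding eq
    proof (rule norm_jet_le[OF _ vs])
      fix bs :: "'a list" assume bs: "bs \<in> basis_lists k"
      then have "vec_bes (n - k) K (partials f bs)" using vec_bes_partials[OF f, of bs] k by (simp add: basis_lists_def)
      moreover have "n - k = Suc (n - Suc k)" using k by simp
      ultimately have "vec_bes (Suc (n - Suc k)) K (partials f bs)" by simp
      from vec_bes_Suc(1)[OF this, of x h]
      show "norm (partials f bs (x + h) - partials f bs x - (\<Sum>i\<in>Basis. (h \<bullet> i) *\<^sub>R partials f (i # bs) x))
        \<le> DIM('b) * (K * norm h powr (1 + gam))" by simp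
    qed
    then show "norm (jet f k (x + h) vs - jet f k x vs - jet f (Suc k) x (h # vs)) \<le> C * norm h powr (1 + gam)"
      by (simp add: C_def mult_ac)
  qed
  show "((\<lambda>h. ?N h / ennreal (norm h)) \<longlongrightarrow> 0) (at 0)"
  proof (rule tendsto_sandwich[OF _ _ tendsto_const])
    have "((\<lambda>h::'a. ennreal (C * norm (h - 0) powr gam)) \<longlongrightarrow> ennreal 0) (at 0)"
      by (intro tendsto_ennrealI tendsto_norm_powr_gam)
    then show "((\<lambda>h::'a. ennreal (C * norm (h - 0) powr gam)) \<longlongrightarrow> 0) (at 0)" by simp
    have "?N h / ennreal (norm h) \<le> ennreal (C * norm (h - 0) powr gam)" if "h \<noteq> 0" for h
    proof -
      have "?N h / ennreal (norm h) \<le> ennreal (C * norm h powr (1 + gam)) / ennreal (norm h)"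
        by (intro divide_right_mono_ennreal N)
      also have "\<dots> = ennreal (C * norm (h - 0) powr gam)"
        using that C0 by (simp add: divide_ennreal powr_add)
      finally show ?thesis .
    qed
    then show "\<forall>\<^sub>F h in at 0. ?N h / ennreal (norm h) \<le> ennreal (C * norm (h - 0) powr gam)"
      by (auto simp: eventually_at_filter)
  qed auto
qed

text \<open>Uniqueness of derivatives evaluates the definite description in
  \<open>kth_deriv\<close>, one order at a time.\<close>

lemma kth_deriv_eq_jet:
  fixes f :: "'a::euclidean_space \<Rightarrow> 'b::euclidean_space" and K :: real
  assumes f: "vec_bes n K f" and "k \<le> n"
  shows "kth_deriv f k = jet f k"
  using assms(2)
proof (induction k)
  case 0
  show ?case by (auto simp: fun_eq_iff jet_def)
next
  case (Suc k)
  then have D: "has_multi_derivative k (jet f k) (jet f (Suc k) x) x" for x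
    by (intro jet_has_multi_derivative[OF f]) simp
  have the: "(THE D. has_multi_derivative k (jet f k) D x) = jet f (Suc k) x" for x
    by (rule the_equality, rule D, rule has_multi_derivative_unique[OF _ D])
  have IH: "kth_deriv f k = jet f k" using Suc by simp
  show ?case by (simp only: kth_deriv.simps IH the)
qed

lemma vec_bes_imp_Cn:
  fixes f :: "'a::euclidean_space \<Rightarrow> 'b::euclidean_space" and K :: real
  assumes f: "vec_bes n K f"
  shows "f \<in> Cn n"
  unfolding Cn_def
proof (intro CollectI conjI allI impI)
  fix k x assume "k < n"
  then show "\<exists>D. has_multi_derivative k (kth_deriv f k) D x"
    using jet_has_multi_derivative[OF f] kth_deriv_eq_jet[OF f, of k] by auto
next
  fix x
  define C where "C = card (basis_lists n :: 'a list set) * (DIM('b) * K)"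
  have N: "multi_norm n (\<lambda>vs. jet f n y vs - jet f n x vs) \<le> ennreal (C * norm (y - x) powr gam)" for y
  proof (rule multi_norm_leI)
    fix vs :: "'a list" assume vs: "length vs = n" "\<forall>v\<in>set vs. norm v \<le> 1"
    have "norm (multilinear_ext (\<lambda>bs. partials f bs y - partials f bs x) vs) \<le> card (basis_lists n :: 'a list set) * (DIM('b) * (K * norm (y - x) powr gam))"
      using vs by (intro norm_jet_le vec_bes_holder[OF vec_bes_partials[OF f]]) (auto simp: basis_lists_def)
    then show "norm (jet f n y vs - jet f n x vs) \<le> C * norm (y - x) powr gam"
      using vs by (simp add: jet_def multilinear_ext_diff C_def mult_ac)
  qed
  have "((\<lambda>y::'a. ennreal (C * norm (y - x) powr gam)) \<longlongrightarrow> ennreal 0) (at x)"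
    by (intro tendsto_ennrealI tendsto_norm_powr_gam)
  then have lim: "((\<lambda>y::'a. ennreal (C * norm (y - x) powr gam)) \<longlongrightarrow> 0) (at x)" by simp
  show "((\<lambda>y. multi_norm n (\<lambda>vs. kth_deriv f n y vs - kth_deriv f n x vs)) \<longlongrightarrow> 0) (at x)"
    unfolding kth_deriv_eq_jet[OF f order_refl]
    by (rule tendsto_sandwich[OF _ _ tendsto_const lim]) (simp_all add: N)
qed

text \<open>DIM^n basis lists times DIM components. The 2 belongs to scales up to 1; at larger
  scales a second difference is at most 4 K, multiplied by a geometric series.\<close>

definition norm_const :: "'a::euclidean_space itself \<Rightarrow> nat \<Rightarrow> real" where
  "norm_const t n = DIM('a) ^ n * DIM('a) * (2 + 4 / (1 - 2 powr (- \<alpha>)))"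

lemma card_basis_lists: "card (basis_lists k :: 'a::euclidean_space list set) = DIM('a) ^ k"
  unfolding basis_lists_def by (rule card_lists_length_eq) simp

text \<open>The majorant T is a finite sum of component second differences. Dual sums are linear in
  T, so the component bounds simply add up.\<close>

lemma vec_bes_imp_zygmund:
  fixes f :: "'a::euclidean_space \<Rightarrow> 'a" and K :: real
  assumes f: "vec_bes n K f"
  shows "zygmund n \<alpha> p (kth_deriv f n) \<le> ennreal (norm_const TYPE('a) n * K)"
proof -
  let ?L = "basis_lists n :: 'a list set"
  define T where "T x h = (\<Sum>bs\<in>?L. \<Sum>e\<in>Basis. \<bar>sdiff (\<lambda>x. partials f bs x \<bullet> e) x h\<bar>)" for x h
  have comp: "bb 0 K (\<lambda>x. partials f bs x \<bullet> e)" if "bs \<in> ?L" "e \<in> Basis" for bs e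
    using vec_bes_partials[OF f, of bs] that by (simp add: vec_bes_def basis_lists_def)
  have "zygmund n \<alpha> p (jet f n) \<le> ennreal (2 * (card ?L * (DIM('a) * K)) + 1 / (1 - 2 powr (- \<alpha>)) * (card ?L * (DIM('a) * (4 * K))))"
  proof (rule zygmund_le_of_dual[OF _ _ _ _ \<alpha> p, where T = T])
    show "multi_norm n (second_diff (jet f n) h x) \<le> ennreal (T x h)" for x h
    proof (rule multi_norm_leI)
      fix vs :: "'a list" assume vs: "length vs = n" "\<forall>v\<in>set vs. norm v \<le> 1"
      have eq: "second_diff (jet f n) h x vs = multilinear_ext (\<lambda>bs. partials f bs (x + 2 *\<^sub>R h) - 2 *\<^sub>R partials f bs (x + h) + partials f bs x) vs"
        using vs by (simp add: second_diff_def jet_def multilinear_ext_add multilinear_ext_diff multilinear_ext_scaleR)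
      have "norm (second_diff (jet f n) h x vs) \<le> (\<Sum>bs\<in>?L. norm (partials f bs (x + 2 *\<^sub>R h) - 2 *\<^sub>R partials f bs (x + h) + partials f bs x))"
        unfolding eq by (rule norm_multilinear_ext_le[OF vs(2), unfolded vs(1)])
      also have "\<dots> \<le> T x h"
        unfolding T_def
      proof (rule sum_mono)
        fix bs
        let ?v = "partials f bs (x + 2 *\<^sub>R h) - 2 *\<^sub>R partials f bs (x + h) + partials f bs x"
        show "norm ?v \<le> (\<Sum>e\<in>Basis. \<bar>sdiff (\<lambda>x. partials f bs x \<bullet> e) x h\<bar>)"
          using norm_le_l1[of ?v] by (simp add: sdiff_def inner_add_left inner_diff_left)
      qed
      finally show "norm (second_diff (jet f n) h x vs) \<le> T x h" .
    qed
    show "0 \<le> T x h" for x h by (simp add: T_def sum_nonneg)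
    show "T x h \<le> card ?L * (DIM('a) * (4 * K))" for x h
      unfolding T_def
    proof (intro sum_bounded_above)
      fix bs e assume "bs \<in> ?L" "e \<in> (Basis::'a set)"
      note b = bes_bound[OF comp[OF this]]
      show "\<bar>sdiff (\<lambda>x. partials f bs x \<bullet> e) x h\<bar> \<le> 4 * K"
        using b[of "x + 2 *\<^sub>R h"] b[of "x + h"] b[of x] unfolding sdiff_def by linarith
    qed
    show "(\<Sum>j<J. y j * T (x j) (h j)) \<le> card ?L * (DIM('a) * K)"
      if y: "y \<in> lp_polar \<alpha> p" and h: "\<And>j. j < J \<Longrightarrow> norm (h j) \<le> (1/2)^j" for y J x h
    proof -
      have "(\<Sum>j<J. y j * T (x j) (h j)) = (\<Sum>j<J. \<Sum>bs\<in>?L. \<Sum>e\<in>Basis. y j * \<bar>sdiff (\<lambda>x. partials f bs x \<bullet> e) (x j) (h j)\<bar>)"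
        by (simp add: T_def sum_distrib_left)
      also have "\<dots> = (\<Sum>bs\<in>?L. \<Sum>j<J. \<Sum>e\<in>Basis. y j * \<bar>sdiff (\<lambda>x. partials f bs x \<bullet> e) (x j) (h j)\<bar>)"
        by (rule sum.swap)
      also have "\<dots> = (\<Sum>bs\<in>?L. \<Sum>e\<in>Basis. \<Sum>j<J. y j * \<bar>sdiff (\<lambda>x. partials f bs x \<bullet> e) (x j) (h j)\<bar>)"
        by (intro sum.cong refl sum.swap)
      also have "\<dots> \<le> card ?L * (DIM('a) * K)"
        by (intro sum_bounded_above zyg_leD[OF bes_zyg[OF comp] y h])
      finally show ?thesis .
    qed
  qed
  also have "2 * (card ?L * (DIM('a) * K)) + 1 / (1 - 2 powr (- \<alpha>)) * (card ?L * (DIM('a) * (4 * K))) = norm_const TYPE('a) n * K"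
    by (simp add: norm_const_def card_basis_lists algebra_simps)
  finally show ?thesis unfolding kth_deriv_eq_jet[OF f order_refl] .
qed

lemma vec_bes_imp_besov:
  fixes f :: "'a::euclidean_space \<Rightarrow> 'a" and K :: real
  assumes f: "vec_bes n K f"
  shows "f \<in> besov n \<alpha> p" "besov_norm n \<alpha> p f \<le> ennreal (norm_const TYPE('a) n * K)"
proof -
  have K: "0 \<le> K" by (rule vec_bes_nonneg[OF f])
  have q: "2 powr (- \<alpha>) < (1::real)" using powr_less_mono[of "-\<alpha>" 0 "2::real"] \<alpha> by simp
  have "Cb_norm n f \<le> ennreal (norm_const TYPE('a) n * K)"
    unfolding Cb_norm_def
  proof (intro SUP_least)
    fix k x assume "k \<in> {..n}"
    then have k: "k \<le> n" by simp
    have "multi_norm k (kth_deriv f k x) \<le> ennreal (card (basis_lists k :: 'a list set) * (DIM('a) * K))"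
      unfolding kth_deriv_eq_jet[OF f k] by (rule multi_norm_jet_le[OF f k])
    also have "\<dots> \<le> ennreal (norm_const TYPE('a) n * K)"
    proof (rule ennreal_leI)
      have "real DIM('a) ^ k * (DIM('a) * K) * 1 \<le> real DIM('a) ^ n * (DIM('a) * K) * (2 + 4 / (1 - 2 powr (- \<alpha>)))"
      proof (intro mult_mono power_increasing k)
        have "0 \<le> 4 / (1 - 2 powr (- \<alpha>))" using q by simp
        then show "1 \<le> 2 + 4 / (1 - 2 powr (- \<alpha>))" by linarith
      qed (use K DIM_ge_Suc0[where 'a='a] in auto)
      then show "card (basis_lists k :: 'a list set) * (DIM('a) * K) \<le> norm_const TYPE('a) n * K"
        by (simp add: norm_const_def card_basis_lists mult_ac)
    qed
    finally show "multi_norm k (kth_deriv f k x) \<le> ennreal (norm_const TYPE('a) n * K)" .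
  qed
  then show n: "besov_norm n \<alpha> p f \<le> ennreal (norm_const TYPE('a) n * K)"
    using vec_bes_imp_zygmund[OF f] by (simp add: besov_norm_def)
  then show "f \<in> besov n \<alpha> p"
    using vec_bes_imp_Cn[OF f] by (simp add: besov_def le_less_trans)
qed

end

section \<open>The flow\<close>

lemma upto_int_eq:
  assumes "t \<in> {0..1}"
  shows "(\<integral>s. F s \<partial>lebesgue_on {0..t}) = upto_int F t"
proof -
  have "(\<integral>s. F s \<partial>lebesgue_on {0..t}) = (\<integral>s. indicator {0..t} s *\<^sub>R F s \<partial>lebesgue)"
    by (rule integral_restrict_space) simp
  also have "\<dots> = (\<integral>s. indicator {0..1} s *\<^sub>R (indicator {0..t} s *\<^sub>R F s) \<partial>lebesgue)"
    using assms by (intro Bochner_Integration.integral_cong) (auto simp: indicator_def)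
  also have "\<dots> = upto_int F t"
    unfolding upto_int_def by (rule integral_restrict_space[symmetric]) simp
  finally show ?thesis .
qed

section \<open>Absolute continuity and identification of the flow\<close>

lemma division_real_interval:
  fixes \<D> :: "real set set"
  assumes "\<D> division_of T" "K \<in> \<D>"
  obtains a b where "K = {a..b}" "a \<le> b"
  using division_ofD(3,4)[OF assms(1,2)] by (metis atLeastatMost_empty_iff2 cbox_interval)

lemma division_unit_interval:
  fixes \<D> :: "real set set"
  assumes "\<D> division_of \<Union>\<D>" "\<Union>\<D> \<subseteq> {0..1}" "K \<in> \<D>"
  shows "0 \<le> Inf K \<and> Inf K \<le> Sup K \<and> Sup K \<le> 1"
proof -
  obtain a b where K: "K = {a..b}" "a \<le> b" using division_real_interval[OF assms(1,3)] .
  moreover have "K \<subseteq> {0..1}" using assms(2,3) by blast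
  ultimately show ?thesis by auto
qed

text \<open>Members of a division are closed and may share end points; without the left end points
  they are disjoint, so their measures add.\<close>

lemma disjoint_half_open:
  fixes \<D> :: "real set set"
  assumes D: "\<D> division_of T" and KL: "K \<in> \<D>" "L \<in> \<D>" "K \<noteq> L"
  shows "{Inf K<..Sup K} \<inter> {Inf L<..Sup L} = {}"
proof (rule ccontr)
  assume "\<not> ?thesis"
  then obtain t where t: "Inf K < t" "t \<le> Sup K" "Inf L < t" "t \<le> Sup L"
    by (metis disjoint_iff greaterThanAtMost_iff)
  obtain a b where K: "K = {a..b}" "a \<le> b" using division_real_interval[OF D KL(1)] .
  obtain c d where L: "L = {c..d}" "c \<le> d" using division_real_interval[OF D KL(2)] .
  have "interior K \<inter> interior L = {}" using division_ofD(5)[OF D KL] .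
  \<comment> \<open>A point strictly between both left ends and t is interior to both
    intervals.\<close>
  moreover have "(max a c + t) / 2 \<in> interior K \<inter> interior L"
    using t K L by (auto simp: max_def field_simps)
  ultimately show False by blast
qed

text \<open>The increments over a family of intervals are dominated by one integral of the norm of F
  over the union of the half-open intervals, a set of small measure.\<close>

lemma abs_continuous_on_upto_int:
  fixes F :: "real \<Rightarrow> 'b::euclidean_space"
  assumes F: "integrable \<mu> F"
  shows "abs_continuous_on {0..1} (\<lambda>t. x + upto_int F t)"
  unfolding abs_continuous_on_def
proof (intro allI impI)
  fix e :: real assume "0 < e"
  interpret finite_measure \<mu> by (rule finite_measure_unit)
  have nF: "integrable \<mu> (\<lambda>s. norm (F s))" using F by (rule integrable_norm)
  obtain d where d: "0 < d" "\<And>A. A \<in> sets \<mu> \<Longrightarrow> measure \<mu> A < d \<Longrightarrow> (\<integral>s. indicator A s * norm (F s) \<partial>\<mu>) < e"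
    using integral_small_sets[OF nF _ \<open>0 < e\<close>] by auto
  have "(\<Sum>K\<in>\<D>. norm (x + upto_int F (Sup K) - (x + upto_int F (Inf K)))) < e"
    if D: "\<D> division_of \<Union>\<D>" "\<Union>\<D> \<subseteq> {0..1}" and len: "(\<Sum>K\<in>\<D>. Sup K - Inf K) < d" for \<D>
  proof -
    define H where "H K = {Inf K<..Sup K}" for K :: "real set"
    have fin: "finite \<D>" using D(1) by (rule division_of_finite)
    have K: "0 \<le> Inf K \<and> Inf K \<le> Sup K \<and> Sup K \<le> 1" if "K \<in> \<D>" for K
      by (rule division_unit_interval[OF D that])
    have H: "H K \<in> sets \<mu>" if "K \<in> \<D>" for K
      unfolding H_def using K[OF that] by (intro sets_unit_interval) auto
    have disj: "disjoint_family_on H \<D>"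
      unfolding disjoint_family_on_def H_def using disjoint_half_open[OF D(1)] by blast
    have m: "measure \<mu> (H K) = Sup K - Inf K" if "K \<in> \<D>" for K
      using K[OF that] by (subst measure_restrict_space) (auto simp: H_def)
    have "measure \<mu> (\<Union>K\<in>\<D>. H K) = (\<Sum>K\<in>\<D>. measure \<mu> (H K))"
      using fin H disj by (intro finite_measure_finite_Union) auto
    also have "\<dots> = (\<Sum>K\<in>\<D>. Sup K - Inf K)" using m by (rule sum.cong[OF refl])
    finally have small: "measure \<mu> (\<Union>K\<in>\<D>. H K) < d" using len by simp
    have int: "integrable \<mu> (\<lambda>s. indicator (H K) s * norm (F s))" if "K \<in> \<D>" for K
      using integrable_mult_indicator[OF H[OF that] nF] by simp
    have "(\<Sum>K\<in>\<D>. norm (x + upto_int F (Sup K) - (x + upto_int F (Inf K)))) \<le> (\<Sum>K\<in>\<D>. \<integral>s. indicator (H K) s * norm (F s) \<partial>\<mu>)"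
    proof (rule sum_mono)
      fix K assume "K \<in> \<D>"
      then have "x + upto_int F (Sup K) - (x + upto_int F (Inf K)) = (\<integral>s. indicator (H K) s *\<^sub>R F s \<partial>\<mu>)"
        using upto_int_diff[OF F] K by (simp add: H_def)
      then have "norm (x + upto_int F (Sup K) - (x + upto_int F (Inf K))) \<le> (\<integral>s. norm (indicator (H K) s *\<^sub>R F s) \<partial>\<mu>)"
        by (metis integral_norm_bound)
      then show "norm (x + upto_int F (Sup K) - (x + upto_int F (Inf K))) \<le> (\<integral>s. indicator (H K) s * norm (F s) \<partial>\<mu>)"
        by simp
    qed
    also have "\<dots> = (\<integral>s. (\<Sum>K\<in>\<D>. indicator (H K) s * norm (F s)) \<partial>\<mu>)"
      using int by (intro Bochner_Integration.integral_sum[symmetric])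
    also have "\<dots> = (\<integral>s. indicator (\<Union>K\<in>\<D>. H K) s * norm (F s) \<partial>\<mu>)"
      by (simp only: indicator_UN_disjoint[OF fin disj] sum_distrib_right)
    also have "\<dots> < e" using fin H by (intro d(2) small) auto
    finally show ?thesis .
  qed
  then show "\<exists>\<delta>>0. \<forall>\<D>. \<D> division_of \<Union>\<D> \<and> \<Union>\<D> \<subseteq> {0..1} \<and> (\<Sum>K\<in>\<D>. Sup K - Inf K) < \<delta>
      \<longrightarrow> (\<Sum>K\<in>\<D>. norm (x + upto_int F (Sup K) - (x + upto_int F (Inf K)))) < e"
    using d(1) by blast
qed

text \<open>\<open>flow\<close> is a definite description, so existence and uniqueness as a total
  function are both needed; restriction to the unit interval settles the values outside it.\<close>

lemma (in lipschitz_field) flow_eq_solution: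
  assumes "t \<in> {0..1}"
  shows "flow u t = solution t"
proof -
  define \<Phi> where "\<Phi> = (\<lambda>t\<in>{0..1}. solution t)"
  have \<Phi>: "\<Phi> t x = solution t x" if "t \<in> {0..1}" for t x using that by (simp add: \<Phi>_def)
  have int: "integrable \<mu> (\<lambda>s. u s (\<Phi> s x))" for x
    using solution_integrable[of x] by (rule Bochner_Integration.integrable_cong[THEN iffD1, rotated -1]) (auto simp: \<Phi>)
  have upto: "upto_int (\<lambda>s. u s (\<Phi> s x)) t = upto_int (\<lambda>s. u s (solution s x)) t" for x t
    unfolding upto_int_def by (rule Bochner_Integration.integral_cong) (auto simp: \<Phi>)
  have eq: "\<Phi> t x = x + upto_int (\<lambda>s. u s (\<Phi> s x)) t" if "t \<in> {0..1}" for t x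
    using solution_eq[OF that] by (simp add: \<Phi>[OF that] upto)
  have "is_flow u \<Phi>"
    unfolding is_flow_def
  proof (intro conjI allI ballI int)
    show "\<Phi> \<in> extensional {0..1}" by (simp add: \<Phi>_def)
    show "abs_continuous_on {0..1} (\<lambda>t. \<Phi> t x)" for x
    proof -
      have "abs_continuous_on {0..1} (\<lambda>t. x + upto_int (\<lambda>s. u s (\<Phi> s x)) t)"
        by (rule abs_continuous_on_upto_int[OF int])
      moreover have "(\<Sum>K\<in>\<D>. norm (\<Phi> (Sup K) x - \<Phi> (Inf K) x))
        = (\<Sum>K\<in>\<D>. norm (x + upto_int (\<lambda>s. u s (\<Phi> s x)) (Sup K) - (x + upto_int (\<lambda>s. u s (\<Phi> s x)) (Inf K))))"
        if D: "\<D> division_of \<Union>\<D>" "\<Union>\<D> \<subseteq> {0..1}" for \<D>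
      proof (rule sum.cong[OF refl])
        fix K assume "K \<in> \<D>"
        then have "Sup K \<in> {0..1}" "Inf K \<in> {0..1}" using division_unit_interval[OF D] by force+
        then show "norm (\<Phi> (Sup K) x - \<Phi> (Inf K) x)
          = norm (x + upto_int (\<lambda>s. u s (\<Phi> s x)) (Sup K) - (x + upto_int (\<lambda>s. u s (\<Phi> s x)) (Inf K)))"
          by (simp only: eq[symmetric])
      qed
      ultimately show ?thesis unfolding abs_continuous_on_def by (metis (no_types, lifting))
    qed
    show "\<Phi> t x = x + (\<integral>s. u s (\<Phi> s x) \<partial>lebesgue_on {0..t})" if "t \<in> {0..1}" for t x
      using eq[OF that] by (simp add: upto_int_eq[OF that])
  qed
  moreover have "\<Psi> = \<Phi>" if \<Psi>: "is_flow u \<Psi>" for \<Psi>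
  proof (rule extensionalityI[of _ "{0..1}"])
    show "\<Psi> \<in> extensional {0..1}" "\<Phi> \<in> extensional {0..1}" using \<Psi> by (auto simp: is_flow_def \<Phi>_def)
    fix t :: real assume t: "t \<in> {0..1}"
    show "\<Psi> t = \<Phi> t"
    proof
      fix x
      have "\<Psi> t x = x + upto_int (\<lambda>s. u s (\<Psi> s x)) t" if "t \<in> {0..1}" for t
        using \<Psi> that unfolding is_flow_def by (simp add: upto_int_eq[OF that, symmetric])
      moreover have "integrable \<mu> (\<lambda>s. u s (\<Psi> s x))" using \<Psi> unfolding is_flow_def by blast
      ultimately have "\<Psi> t x = solution t x" using t by (intro solution_unique[where \<Psi> = "\<lambda>t. \<Psi> t x"])
      then show "\<Psi> t x = \<Phi> t x" using \<Phi>[OF t] by simp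
    qed
  qed
  ultimately have "flow u = \<Phi>" unfolding flow_def by (rule the_equality)
  then show ?thesis using assms by (simp add: \<Phi>_def)
qed

theorem theorem1:
  fixes u :: "real \<Rightarrow> real ^ 'd \<Rightarrow> real ^ 'd"
    and n :: nat and \<alpha> :: real and p :: ennreal
  assumes "n \<ge> 1" and "0 < \<alpha>" and "\<alpha> \<le> 1" and "1 \<le> p"
    and "u \<in> vector_fields n \<alpha> p"
  shows "(\<forall>t\<in>{0..1}. flow_disp u t \<in> besov n \<alpha> p) \<and>
    (\<forall>t\<in>{0..1}. ((\<lambda>s. besov_norm n \<alpha> p (\<lambda>x. flow_disp u s x - flow_disp u t x)) \<longlongrightarrow> 0)
      (at t within {0..1}))"
proof -
  interpret besov_exponents \<alpha> p by standard (use assms in auto)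
  let ?T = "TYPE(real ^ 'd)"
  obtain C where C: "0 < C" "\<And>m f e. 0 < m \<Longrightarrow> (f :: real ^ 'd \<Rightarrow> real ^ 'd) \<in> Cn n \<Longrightarrow>
      besov_norm n \<alpha> p f \<le> ennreal m \<Longrightarrow> e \<in> Basis \<Longrightarrow> bb n (C * m) (\<lambda>x. f x \<bullet> e)"
    using besov_imp_bes[where 'a = "real ^ 'd"] by metis
  \<comment> \<open>The summand 1 supplies the strictly positive bound that
    \<open>besov_imp_bes\<close> asks for.\<close>
  define m where "m s = C * (1 + enn2real (besov_norm n \<alpha> p (u s)))" for s
  have u: "u s \<in> Cn n" "besov_norm n \<alpha> p (u s) < \<infinity>" if "s \<in> {0..1}" for s
    using assms(5) that by (auto simp: vector_fields_def besov_def)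
  interpret finite_measure \<mu> by (rule finite_measure_unit)
  interpret besov_field gam zyg_const "lp_polar \<alpha> p" u n m
  proof
    show "integrable \<mu> m"
      unfolding m_def using assms(5) by (auto simp: vector_fields_def)
    show "bb n (m s) (\<lambda>x. u s x \<bullet> e)" if s: "s \<in> {0..1}" and e: "e \<in> Basis" for s e
      unfolding m_def
    proof (rule C(2)[OF _ u(1)[OF s] _ e])
      have "besov_norm n \<alpha> p (u s) = ennreal (enn2real (besov_norm n \<alpha> p (u s)))"
        using u(2)[OF s] by simp
      also have "\<dots> \<le> ennreal (1 + enn2real (besov_norm n \<alpha> p (u s)))" by (rule ennreal_leI) simp
      finally show "besov_norm n \<alpha> p (u s) \<le> ennreal (1 + enn2real (besov_norm n \<alpha> p (u s)))" .
    qed (simp add: add_pos_nonneg)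
  qed (use assms in \<open>auto simp: vector_fields_def\<close>)
  obtain C' where C': "0 \<le> C'" "\<And>r t e. 0 \<le> r \<Longrightarrow> r \<le> t \<Longrightarrow> t \<le> 1 \<Longrightarrow> e \<in> Basis \<Longrightarrow>
      bb n (C' * (upto_int m t - upto_int m r)) (\<lambda>x. (solution t x - solution r x) \<bullet> e)"
    using solution_increment_bes by blast
  \<comment> \<open>For s before t the increment is reversed by multiplication with the constant -1,
    which costs a factor \<open>mult_const\<close>.\<close>
  define C1 where "C1 = (1 + mult_const ?T n) * C'"
  have C1: "C' \<le> C1" "mult_const ?T n * C' \<le> C1"
    using C'(1) mult_const_nonneg[of ?T n] by (auto simp: C1_def algebra_simps)
  have vec_bes: "vec_bes n (C1 * \<bar>upto_int m s - upto_int m t\<bar>) (\<lambda>x. solution s x - solution t x)"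
    if st: "s \<in> {0..1}" "t \<in> {0..1}" for s t
    unfolding vec_bes_def
  proof
    fix e :: "real ^ 'd" assume e: "e \<in> Basis"
    show "bb n (C1 * \<bar>upto_int m s - upto_int m t\<bar>) (\<lambda>x. (solution s x - solution t x) \<bullet> e)"
    proof (cases "t \<le> s")
      case True
      then have "upto_int m t \<le> upto_int m s"
        using st by (intro upto_int_mono_time m_int m_nonneg) auto
      then have "C' * (upto_int m s - upto_int m t) \<le> C1 * \<bar>upto_int m s - upto_int m t\<bar>"
        using C1 C' by (simp add: mult_right_mono)
      then show ?thesis using C'(2)[of t s e] True st e by (auto intro: bes_mono)
    next
      case False
      then have le: "upto_int m s \<le> upto_int m t"
        using st by (intro upto_int_mono_time m_int m_nonneg) auto
      have "bb n (C' * (upto_int m t - upto_int m s)) (\<lambda>x. (solution t x - solution s x) \<bullet> e)"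
        using False st e by (intro C') auto
      from bes_mult[OF bes_const[of "-1" 1] this]
      have "bb n (mult_const ?T n * 1 * (C' * (upto_int m t - upto_int m s))) (\<lambda>x. (solution s x - solution t x) \<bullet> e)"
        by (simp add: inner_diff_left)
      moreover have "mult_const ?T n * 1 * (C' * (upto_int m t - upto_int m s)) \<le> C1 * \<bar>upto_int m s - upto_int m t\<bar>"
        using mult_right_mono[OF C1(2), of "upto_int m t - upto_int m s"] le by (simp add: mult.assoc)
      ultimately show ?thesis by (rule bes_mono)
    qed
  qed
  have disp: "flow_disp u t x = solution t x - x" if "t \<in> {0..1}" for t x
    using flow_eq_solution[OF that] by (simp add: flow_disp_def)
  show ?thesis
  proof (intro conjI ballI)
    fix t :: real assume t: "t \<in> {0..1}"
    \<comment> \<open>The displacement at time t is thus the increment from time 0, and membership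
      in the space is a case of the increment estimate.\<close>
    have "solution 0 x = x" for x
      using solution_eq[of 0 x] upto_int_0[OF solution_integrable] by simp
    then have "flow_disp u t = (\<lambda>x. solution t x - solution 0 x)"
      using disp[OF t] by auto
    then show "flow_disp u t \<in> besov n \<alpha> p"
      using vec_bes_imp_besov(1)[OF vec_bes[OF t, of 0]] by simp
    have eq: "(\<lambda>x. flow_disp u s x - flow_disp u t x) = (\<lambda>x. solution s x - solution t x)" if "s \<in> {0..1}" for s
      using disp[OF t] disp[OF that] by auto
    have N: "besov_norm n \<alpha> p (\<lambda>x. flow_disp u s x - flow_disp u t x)
        \<le> ennreal (norm_const ?T n * (C1 * \<bar>upto_int m s - upto_int m t\<bar>))" if "s \<in> {0..1}" for s
      unfolding eq[OF that] by (rule vec_bes_imp_besov(2)[OF vec_bes[OF that t]])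
    have "continuous_on {0..1} (upto_int m)"
      by (rule uniformly_continuous_imp_continuous[OF continuous_upto_int[OF m_int]])
    then have "(upto_int m \<longlongrightarrow> upto_int m t) (at t within {0..1})"
      using t by (simp add: continuous_on_def)
    then have "((\<lambda>s. norm_const ?T n * (C1 * \<bar>upto_int m s - upto_int m t\<bar>)) \<longlongrightarrow> norm_const ?T n * (C1 * \<bar>upto_int m t - upto_int m t\<bar>)) (at t within {0..1})"
      by (intro tendsto_intros)
    then have "((\<lambda>s. ennreal (norm_const ?T n * (C1 * \<bar>upto_int m s - upto_int m t\<bar>))) \<longlongrightarrow> 0) (at t within {0..1})"
      using tendsto_ennrealI by fastforce
    then show "((\<lambda>s. besov_norm n \<alpha> p (\<lambda>x. flow_disp u s x - flow_disp u t x)) \<longlongrightarrow> 0) (at t within {0..1})"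
      by (rule tendsto_sandwich[OF _ _ tendsto_const, rotated 2]) (auto simp: eventually_at_filter N)
  qed
qed

end
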